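(* Let $\mathbf{A}$ be a unital separable $\mathrm{C}^*$-algebra, let $\mathbf{A}^\#$ be a computable, computably unital presentation of $\mathbf{A}$, and let $a$ be a normal element of $\mathbf{A}$ that is a computable point of $\mathbf{A}^\#$. Suppose that $f : \sigma(a) \to \mathbb{C}$ is a computable function. Then $f(a)$ is a computable point of $\mathbf{A}^\#$.
   Context: A presentation $\mathbf{A}^\#$ of a (separable) $\mathrm{C}^*$-algebra $\mathbf{A}$ is $\mathbf{A}$ together with a finite or infinite sequence $(a_n)$ of elements of $\mathbf{A}$, called special points, that generate a dense $*$-subalgebra. The generated points of $\mathbf{A}^\#$ are the elements $p(a_0,\dots,a_m)$ with $p$ a rational $*$-polynomial (a noncommutative polynomial in $x_0,\dots,x_m,x_0^*,\dots,x_m^*$ with coefficients in $\mathbb{Q}(i)$ and no constant term); a code of a generated point is a natural-number code of such a $p$. $\mathbf{A}^\#$ is computable if from a code of a generated point $\rho$ and $k\in\mathbb{N}$ one can compute a rational $q$ with $|\,\|\rho\|-q\,|<2^{-k}$. A point $x$ is a computable point of $\mathbf{A}^\#$ if there is an algorithm which from $k$ computes a code of a generated point $\rho$ with $\|x-\rho\|<2^{-k}$. $\mathbf{A}^\#$ is computably unital if $1_{\mathbf{A}}$ is a computable point of $\mathbf{A}^\#$. A function $f:K\to\mathbb{C}$ with $K\subseteq\mathbb{C}$ is computable if there is an algorithm (oracle machine) that converts any sequence $(q_k)$ in $\mathbb{Q}(i)$ with $|z-q_k|<2^{-k}$, $z\in K$, into a sequence $(r_k)$ in $\mathbb{Q}(i)$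 with $|f(z)-r_k|<2^{-k}$. For $f$ continuous on $\sigma(a)$, $f(a)$ is the image of $f$ under the continuous functional calculus, the unique $*$-homomorphism $C(\sigma(a))\to\mathbf{A}$ sending the constant function $1$ to $1_{\mathbf{A}}$ and the identity function to $a$. *)

theory Defs
  imports "HOL-Analysis.Analysis" "HOL-Library.Countable" "HOL-Library.Extended_Nat"
begin

section \<open>Unital C*-algebras\<close>

text \<open>The sort \<open>monoid_mult\<close> (rather than \<open>ring_1\<close>) provides the unit without
  imposing \<open>0 \<noteq> 1\<close>, so the zero algebra is not excluded. Complex scaling is required to extend
  the real scaling of the underlying real Banach algebra.\<close>

class unital_cstar_algebra = banach + real_normed_algebra + monoid_mult +
  fixes scaleC :: "complex \<Rightarrow> 'a \<Rightarrow> 'a"  (infixr \<open>*\<^sub>C\<close> 75)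
    and star :: "'a \<Rightarrow> 'a"
  assumes scaleC_add_right: "c *\<^sub>C (x + y) = c *\<^sub>C x + c *\<^sub>C y"
    and scaleC_add_left: "(c + d) *\<^sub>C x = c *\<^sub>C x + d *\<^sub>C x"
    and scaleC_scaleC: "c *\<^sub>C d *\<^sub>C x = (c * d) *\<^sub>C x"
    and scaleC_of_real: "complex_of_real r *\<^sub>C x = r *\<^sub>R x"
    and mult_scaleC_left: "(c *\<^sub>C x) * y = c *\<^sub>C (x * y)"
    and mult_scaleC_right: "x * (c *\<^sub>C y) = c *\<^sub>C (x * y)"
    and norm_scaleC: "norm (c *\<^sub>C x) = cmod c * norm x"
    and star_star: "star (star x) = x"
    and star_add: "star (x + y) = star x + star y"
    and star_scaleC: "star (c *\<^sub>C x) = cnj c *\<^sub>C star x"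
    and star_mult: "star (x * y) = star y * star x"
    and cstar_identity: "norm (star x * x) = (norm x)\<^sup>2"

definition normal_element :: "'a::unital_cstar_algebra \<Rightarrow> bool" where
  "normal_element a \<longleftrightarrow> star a * a = a * star a"

definition invertible_element :: "'a::unital_cstar_algebra \<Rightarrow> bool" where
  "invertible_element x \<longleftrightarrow> (\<exists>y. x * y = 1 \<and> y * x = 1)"

definition spectrum :: "'a::unital_cstar_algebra \<Rightarrow> complex set" where
  "spectrum a = {z. \<not> invertible_element (a - z *\<^sub>C 1)}"

definition star_subalgebra :: "'a::unital_cstar_algebra set \<Rightarrow> bool" where
  "star_subalgebra B \<longleftrightarrow> 0 \<in> B \<and> (\<forall>x\<in>B. \<forall>y\<in>B. x + y \<in> B \<and> x * y \<in> B)
     \<and> (\<forall>c. \<forall>x\<in>B. c *\<^sub>C x \<in> B) \<and> (\<forall>x\<in>B. star x \<in> B)"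


section \<open>Continuous functional calculus\<close>

text \<open>Elements of \<open>C(\<sigma>(a))\<close> are represented by total functions that are continuous on
  \<open>\<sigma>(a)\<close>; the last clause makes \<open>\<Phi>\<close> well defined on \<open>C(\<sigma>(a))\<close>. The values of
  \<open>\<Phi>\<close> on functions that are not continuous on \<open>\<sigma>(a)\<close> are unconstrained.\<close>

definition is_functional_calculus ::
  "'a::unital_cstar_algebra \<Rightarrow> ((complex \<Rightarrow> complex) \<Rightarrow> 'a) \<Rightarrow> bool" where
  "is_functional_calculus a \<Phi> \<longleftrightarrow>
     (\<forall>g h. continuous_on (spectrum a) g \<longrightarrow> continuous_on (spectrum a) h \<longrightarrow>
        \<Phi> (\<lambda>z. g z + h z) = \<Phi> g + \<Phi> h \<and> \<Phi> (\<lambda>z. g z * h z) = \<Phi> g * \<Phi> h) \<and>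
     (\<forall>c g. continuous_on (spectrum a) g \<longrightarrow> \<Phi> (\<lambda>z. c * g z) = c *\<^sub>C \<Phi> g) \<and>
     (\<forall>g. continuous_on (spectrum a) g \<longrightarrow> \<Phi> (\<lambda>z. cnj (g z)) = star (\<Phi> g)) \<and>
     \<Phi> (\<lambda>z. 1) = 1 \<and> \<Phi> (\<lambda>z. z) = a \<and>
     (\<forall>g h. continuous_on (spectrum a) g \<longrightarrow> continuous_on (spectrum a) h \<longrightarrow>
        (\<forall>z\<in>spectrum a. g z = h z) \<longrightarrow> \<Phi> g = \<Phi> h)"

definition cfc :: "'a::unital_cstar_algebra \<Rightarrow> (complex \<Rightarrow> complex) \<Rightarrow> 'a" where
  "cfc a f = (THE y. \<exists>\<Phi>. is_functional_calculus a \<Phi> \<and> y = \<Phi> f)"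


section \<open>Partial recursive functions with an oracle\<close>

text \<open>Algorithms are terms for partial recursive functions relative to an oracle
  \<open>\<nat> \<Rightarrow> \<nat>\<close>; the term is independent of the oracle, which is a parameter of the
  semantics (\<open>None\<close> stands for divergence). \<open>Mu f\<close> is unbounded search,
  \<open>PrimRec f g\<close> is primitive recursion on the first argument.\<close>

datatype algorithm =
    Zero
  | Succ
  | Proj nat
  | Oracle
  | Comp algorithm "algorithm list"
  | PrimRec algorithm algorithm
  | Mu algorithm

primrec run :: "algorithm \<Rightarrow> (nat \<Rightarrow> nat) \<Rightarrow> nat list \<Rightarrow> nat option" where
  "run Zero = (\<lambda>or xs. Some 0)"
| "run Succ = (\<lambda>or xs. case xs of [] \<Rightarrow> None | x # _ \<Rightarrow> Some (Suc x))"
| "run (Proj i) = (\<lambda>or xs. if i < length xs then Some (xs ! i) else None)"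
| "run Oracle = (\<lambda>or xs. case xs of [] \<Rightarrow> None | x # _ \<Rightarrow> Some (or x))"
| "run (Comp f gs) = (\<lambda>or xs.
     Option.bind (those (map (\<lambda>r. r or xs) (map run gs))) (run f or))"
| "run (PrimRec f g) = (\<lambda>or xs. case xs of [] \<Rightarrow> None
     | n # ys \<Rightarrow> rec_nat (run f or ys)
         (\<lambda>m r. Option.bind r (\<lambda>y. run g or (m # y # ys))) n)"
| "run (Mu f) = (\<lambda>or xs.
     if \<exists>n. run f or (n # xs) = Some 0 \<and> (\<forall>m<n. run f or (m # xs) \<noteq> None)
     then Some (LEAST n. run f or (n # xs) = Some 0) else None)"

text \<open>The constant zero oracle is computable, so it yields exactly the partial recursive
  functions.\<close>

abbreviation run_plain :: "algorithm \<Rightarrow> nat list \<Rightarrow> nat option" where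
  "run_plain P \<equiv> run P (\<lambda>_. 0)"

definition decode_gaussian :: "nat \<Rightarrow> complex" where
  "decode_gaussian n = (case prod_decode n of (r, s) \<Rightarrow>
     Complex (of_rat (nat_to_rat_surj r)) (of_rat (nat_to_rat_surj s)))"

text \<open>The oracle presents a sequence in \<open>\<rat>(\<i>)\<close> through codes; every oracle presents
  one, since every natural number is a code.\<close>

definition computable_function_on :: "complex set \<Rightarrow> (complex \<Rightarrow> complex) \<Rightarrow> bool" where
  "computable_function_on K f \<longleftrightarrow> (\<exists>P. \<forall>z\<in>K. \<forall>q :: nat \<Rightarrow> nat.
     (\<forall>k. cmod (z - decode_gaussian (q k)) < (1/2) ^ k) \<longrightarrow>
     (\<forall>k. \<exists>r. run P q [k] = Some r \<and> cmod (f z - decode_gaussian r) < (1/2) ^ k))"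


section \<open>Rational *-polynomials and their codes\<close>

text \<open>A letter \<open>Inl i\<close> is the indeterminate \<open>x\<^sub>i\<close> and \<open>Inr i\<close> is
  \<open>x\<^sub>i\<^sup>*\<close>. A polynomial is written as a finite list of terms, each a coefficient and a
  word. The lists are not normalised (like terms may occur repeatedly), so a noncommutative
  polynomial has several representations.\<close>

type_synonym star_poly = "(complex \<times> (nat + nat) list) list"

definition rational_star_poly :: "star_poly \<Rightarrow> bool" where
  "rational_star_poly p \<longleftrightarrow> (\<forall>(c, w)\<in>set p. Re c \<in> \<rat> \<and> Im c \<in> \<rat> \<and> w \<noteq> [])"

fun letter_index :: "nat + nat \<Rightarrow> nat" where
  "letter_index (Inl i) = i"
| "letter_index (Inr i) = i"

definition poly_indices :: "star_poly \<Rightarrow> nat set" where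
  "poly_indices p = (\<Union>(c, w)\<in>set p. letter_index ` set w)"

fun letter_value :: "(nat \<Rightarrow> 'a::unital_cstar_algebra) \<Rightarrow> nat + nat \<Rightarrow> 'a" where
  "letter_value s (Inl i) = s i"
| "letter_value s (Inr i) = star (s i)"

definition poly_value :: "(nat \<Rightarrow> 'a::unital_cstar_algebra) \<Rightarrow> star_poly \<Rightarrow> 'a" where
  "poly_value s p = (\<Sum>(c, w)\<leftarrow>p. c *\<^sub>C prod_list (map (letter_value s) w))"

text \<open>A word is coded by its first letter and the list of remaining letters, so that exactly
  the nonempty words have codes.\<close>

definition decode_word :: "nat \<Rightarrow> (nat + nat) list" where
  "decode_word n = (case prod_decode n of (x, xs) \<Rightarrow> map sum_decode (x # list_decode xs))"

definition decode_term :: "nat \<Rightarrow> complex \<times> (nat + nat) list" where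
  "decode_term n = (case prod_decode n of (c, w) \<Rightarrow> (decode_gaussian c, decode_word w))"

definition decode_poly :: "nat \<Rightarrow> star_poly" where
  "decode_poly n = map decode_term (list_decode n)"

lemma range_decode_gaussian: "range decode_gaussian = {c. Re c \<in> \<rat> \<and> Im c \<in> \<rat>}"
proof (intro equalityI subsetI)
  fix c assume "c \<in> {c. Re c \<in> \<rat> \<and> Im c \<in> \<rat>}"
  then obtain r s where "Re c = of_rat (nat_to_rat_surj r)" "Im c = of_rat (nat_to_rat_surj s)"
    by (auto elim!: Rats_cases) (metis surj_nat_to_rat_surj surjD)
  then have "c = decode_gaussian (prod_encode (r, s))"
    by (simp add: decode_gaussian_def complex_eq_iff)
  then show "c \<in> range decode_gaussian" by blast
qed (auto simp: decode_gaussian_def split: prod.splits)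

lemma range_decode_word: "range decode_word = {w. w \<noteq> []}"
proof (intro equalityI subsetI)
  fix w :: "(nat + nat) list" assume "w \<in> {w. w \<noteq> []}"
  then obtain x xs where "w = x # xs" by (auto simp: neq_Nil_conv)
  then have "w = decode_word (prod_encode (sum_encode x, list_encode (map sum_encode xs)))"
    by (simp add: decode_word_def comp_def)
  then show "w \<in> range decode_word" by blast
qed (auto simp: decode_word_def split: prod.splits)

lemma range_decode_poly: "range decode_poly = {p. rational_star_poly p}"
proof -
  have t: "range decode_term = range decode_gaussian \<times> range decode_word"
  proof (intro equalityI subsetI)
    fix y assume "y \<in> range decode_gaussian \<times> range decode_word"
    then obtain c w where "y = (decode_gaussian c, decode_word w)" by auto
    then have "y = decode_term (prod_encode (c, w))" by (simp add: decode_term_def)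
    then show "y \<in> range decode_term" by blast
  qed (auto simp: decode_term_def split: prod.splits)
  have "range decode_poly = map decode_term ` range list_decode"
    by (auto simp: decode_poly_def)
  also have "range list_decode = (UNIV :: nat list set)"
    by (metis list_encode_inverse surjI)
  also have "map decode_term ` UNIV = lists (range decode_term)"
    by (simp add: lists_image flip: lists_UNIV)
  finally show ?thesis
    unfolding t range_decode_gaussian range_decode_word rational_star_poly_def by auto
qed


section \<open>Presentations\<close>

text \<open>The special points are \<open>point A n\<close> for \<open>n < num A\<close>; \<open>num A = \<infinity>\<close> is the case of
  an infinite sequence, and otherwise the values \<open>point A n\<close> for \<open>n \<ge> num A\<close> are irrelevant.\<close>

record 'a presentation =
  num :: enat
  point :: "nat \<Rightarrow> 'a"

definition is_presentation :: "'a::unital_cstar_algebra presentation \<Rightarrow> bool" where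
  "is_presentation A \<longleftrightarrow> closure (star_subalgebra hull {point A n |n. enat n < num A}) = UNIV"

text \<open>\<open>is_code_of A e \<rho>\<close>: \<open>e\<close> is a code of the generated point \<open>\<rho>\<close>.\<close>

definition is_code_of :: "'a::unital_cstar_algebra presentation \<Rightarrow> nat \<Rightarrow> 'a \<Rightarrow> bool" where
  "is_code_of A e \<rho> \<longleftrightarrow>
     (\<forall>i\<in>poly_indices (decode_poly e). enat i < num A) \<and> \<rho> = poly_value (point A) (decode_poly e)"

definition computable_presentation :: "'a::unital_cstar_algebra presentation \<Rightarrow> bool" where
  "computable_presentation A \<longleftrightarrow> (\<exists>P. \<forall>e \<rho> k. is_code_of A e \<rho> \<longrightarrow>
     (\<exists>q. run_plain P [e, k] = Some q \<and>
       \<bar>norm \<rho> - of_rat (nat_to_rat_surj q)\<bar> < (1/2) ^ k))"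

definition computable_point :: "'a::unital_cstar_algebra presentation \<Rightarrow> 'a \<Rightarrow> bool" where
  "computable_point A x \<longleftrightarrow> (\<exists>P. \<forall>k. \<exists>e \<rho>. run_plain P [k] = Some e \<and>
     is_code_of A e \<rho> \<and> norm (x - \<rho>) < (1/2) ^ k)"

definition computably_unital :: "'a::unital_cstar_algebra presentation \<Rightarrow> bool" where
  "computably_unital A \<longleftrightarrow> computable_point A 1"

end

theory Submission
  imports Defs
begin

text \<open>
  Fix \<open>S\<close> with \<open>norm a \<le> S\<close>. On the disc \<open>\<bar>z\<bar> \<le> S\<close> the four affine functions
  \<open>(1 + Re (\<i>\<^sup>-\<^sup>l z) / S) / 4\<close> are nonnegative and have sum \<open>1\<close>, and \<open>z\<close> is the mean of the points
  \<open>2 S \<i>\<^sup>l\<close> with these weights. Drawing \<open>n\<close> letters \<open>l < 4\<close> independently with these probabilities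
  gives a word \<open>s\<close> with a probability \<open>b\<^sub>s(z)\<close>, a polynomial in \<open>z\<close> and its conjugate, and with a
  mean \<open>w\<^sub>s\<close> of its points that concentrates at \<open>z\<close>. So \<open>\<Sum>\<^sub>s g(w\<^sub>s) b\<^sub>s\<close> is a Bernstein
  approximation of \<open>g\<close>, and substituting \<open>a\<close> for \<open>z\<close> gives elements \<open>\<Sum>\<^sub>s g(w\<^sub>s) b\<^sub>s(a)\<close> of the
  algebra. These sums carry both halves of the proof.

  Existence and uniqueness of the functional calculus. Each \<open>b\<^sub>s(a)\<close> is the square of a self-adjoint
  element and these elements commute, so coefficients in a combination of them can be estimated by
  absolute values (\<open>norm_sum_squares_mono\<close>). The law of large numbers, in the form of an exact
  identity in the algebra (\<open>sum_dist_bern\<close>), then shows that the Bernstein elements of \<open>g\<close> converge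
  and that their limit is multiplicative in \<open>g\<close> (\<open>norm_bernstein_mult_diff_le\<close>). The limit
  annihilates functions supported in small discs outside the spectrum, hence depends only on the values
  on the spectrum (\<open>disc_calculus_eq_0\<close>). Every functional calculus is isometric
  (\<open>norm_\<Phi>_le\<close>, \<open>norm_\<Phi>_ge\<close>), and since its values on the polynomials \<open>b\<^sub>s\<close> are prescribed it is
  unique (\<open>functional_calculus_unique\<close>).

  The algorithm. A run of the algorithm for \<open>f\<close> on a finite list of approximations determines \<open>f\<close>, up
  to the required error, at all points of the spectrum that the list approximates (\<open>brun_sound\<close>). At
  stage \<open>m\<close>, such a run is searched for near each \<open>w\<^sub>s\<close>, among finitely many lists; a word is covered
  if one is found, and its result \<open>r\<^sub>s\<close> then serves as \<open>f(w\<^sub>s)\<close>. The spectrum is not given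
  effectively, so it cannot be decided directly whether the covered words suffice. But if \<open>u\<close> is the
  sum of \<open>b\<^sub>s\<close> over the uncovered words, then \<open>norm (u(a))\<close> is the supremum of \<open>u\<close> on the spectrum, and
  this norm can be computed from the presentation. The algorithm increases \<open>m\<close> until it sees that the
  norm is small and returns a generated point close to \<open>\<Sum>\<^sub>s r\<^sub>s b\<^sub>s(a)\<close>, the sum over covered words.
  The result is correct (\<open>accepted_close\<close>) because far words have little weight and uncovered
  words have little total weight. The search stops (\<open>ex_accepted\<close>) because, the spectrum being
  compact, for large \<open>m\<close> all words near the spectrum are covered.

  To see that the search is a partial recursive function, functions between types with a fixed coding
  are called computable if an algorithm computes them on codes, and this notion is shown to be closed
  under the constructs that the algorithm uses.
\<close>

section \<open>Elementary C*-algebra theory\<close>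

subsection \<open>Scaling and involution\<close>

lemma scaleC_zero_left [simp]: "0 *\<^sub>C (x::'a::unital_cstar_algebra) = 0"
  using scaleC_add_left[of 0 0 x] by simp

lemma scaleC_zero_right [simp]: "c *\<^sub>C (0::'a::unital_cstar_algebra) = 0"
  using scaleC_add_right[of c "0::'a" 0] by simp

lemma scaleC_one [simp]: "1 *\<^sub>C (x::'a::unital_cstar_algebra) = x"
  using scaleC_of_real[of 1 x] by simp

lemma scaleC_minus_left: "(- c) *\<^sub>C (x::'a::unital_cstar_algebra) = - (c *\<^sub>C x)"
  using scaleC_add_left[of "-c" c x] by (simp add: eq_neg_iff_add_eq_0)

lemma scaleC_minus_right: "c *\<^sub>C (- x) = - (c *\<^sub>C (x::'a::unital_cstar_algebra))"
  using scaleC_add_right[of c "-x" x] by (simp add: eq_neg_iff_add_eq_0)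

lemma scaleC_diff_left: "(c - d) *\<^sub>C (x::'a::unital_cstar_algebra) = c *\<^sub>C x - d *\<^sub>C x"
  using scaleC_add_left[of c "-d" x] by (simp add: scaleC_minus_left)

lemma scaleC_diff_right: "c *\<^sub>C (x - y) = c *\<^sub>C (x::'a::unital_cstar_algebra) - c *\<^sub>C y"
  using scaleC_add_right[of c x "-y"] by (simp add: scaleC_minus_right)

lemma scaleC_sum_left: "(\<Sum>i\<in>I. c i) *\<^sub>C (x::'a::unital_cstar_algebra) = (\<Sum>i\<in>I. c i *\<^sub>C x)"
  by (induction I rule: infinite_finite_induct) (auto simp: scaleC_add_left)

lemma scaleC_sum_right: "c *\<^sub>C (\<Sum>i\<in>I. x i) = (\<Sum>i\<in>I. c *\<^sub>C (x i::'a::unital_cstar_algebra))"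
  by (induction I rule: infinite_finite_induct) (auto simp: scaleC_add_right)

lemma scaleR_conv_scaleC: "r *\<^sub>R (x::'a::unital_cstar_algebra) = complex_of_real r *\<^sub>C x"
  by (simp add: scaleC_of_real)

lemma bounded_linear_scaleC: "bounded_linear (\<lambda>x::'a::unital_cstar_algebra. c *\<^sub>C x)"
  by (rule bounded_linear_intro[of _ "cmod c"])
    (auto simp: scaleC_add_right scaleR_conv_scaleC scaleC_scaleC mult.commute norm_scaleC)

lemma star_one [simp]: "star (1::'a::unital_cstar_algebra) = 1"
  by (metis mult_1_left mult_1_right star_mult star_star)

lemma star_zero [simp]: "star (0::'a::unital_cstar_algebra) = 0"
  using star_add[of "0::'a" 0] by simp

lemma star_minus: "star (- x) = - star (x::'a::unital_cstar_algebra)"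
  using star_add[of "-x" x] by (simp add: eq_neg_iff_add_eq_0)

lemma star_diff: "star (x - y) = star x - star (y::'a::unital_cstar_algebra)"
  using star_add[of x "-y"] by (simp add: star_minus)

lemma star_scaleR: "star (r *\<^sub>R x) = r *\<^sub>R star (x::'a::unital_cstar_algebra)"
  by (simp add: scaleR_conv_scaleC star_scaleC)

lemma star_sum: "star (\<Sum>i\<in>I. x i) = (\<Sum>i\<in>I. star (x i::'a::unital_cstar_algebra))"
  by (induction I rule: infinite_finite_induct) (auto simp: star_add)

lemma norm_star [simp]: "norm (star x) = norm (x::'a::unital_cstar_algebra)"
proof -
  have le: "norm y \<le> norm (star y)" for y :: 'a
  proof (cases "norm y = 0")
    case False
    have "norm y * norm y \<le> norm (star y) * norm y"
      using cstar_identity[of y] norm_mult_ineq[of "star y" y] by (simp add: power2_eq_square)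
    with False show ?thesis by simp
  qed simp
  show ?thesis using le[of x] le[of "star x"] by (simp add: star_star)
qed

lemma norm_one_le: "norm (1::'a::unital_cstar_algebra) \<le> 1"
proof -
  have "norm (1::'a) = norm (1::'a) * norm (1::'a)"
    using cstar_identity[of "1::'a"] by (simp add: power2_eq_square)
  then show ?thesis by (metis linear mult_cancel_right1 norm_zero order_refl zero_le_one)
qed

lemma bounded_linear_star: "bounded_linear (star :: 'a::unital_cstar_algebra \<Rightarrow> 'a)"
  by (rule bounded_linear_intro[of _ 1]) (auto simp: star_add star_scaleR)

lemmas tendsto_star = bounded_linear.tendsto[OF bounded_linear_star]
lemmas continuous_on_star = bounded_linear.continuous_on[OF bounded_linear_star]

subsection \<open>Inverses and square roots by fixed points\<close>

lemma closed_commutant: "closed {y::'a::unital_cstar_algebra. z * y = y * z}"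
  by (intro closed_Collect_eq continuous_intros)

text \<open>The Neumann series, summed as the fixed point of the contraction \<open>y \<mapsto> 1 + x y\<close>
  on the commutant of \<open>x\<close>, so that the one-sided inverse is two-sided.\<close>

lemma invertible_one_minus:
  fixes x :: "'a::unital_cstar_algebra"
  assumes "norm x < 1"
  shows "invertible_element (1 - x)"
proof -
  let ?C = "{y. x * y = y * x}"
  have "\<exists>!y\<in>?C. 1 + x * y = y"
  proof (rule Banach_fix[where c = "norm x"])
    show "complete ?C" using closed_commutant by (simp add: complete_eq_closed)
    show "?C \<noteq> {}" by (auto intro: exI[of _ 0])
    show "(\<lambda>y. 1 + x * y) ` ?C \<subseteq> ?C"       by (auto simp: distrib_left distrib_right mult.assoc) (metis mult.assoc)
    show "dist (1 + x * y) (1 + x * z) \<le> norm x * dist y z" for y z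
      using norm_mult_ineq[of x "y - z"] by (simp add: dist_norm algebra_simps)
  qed (use assms in auto)
  then obtain y where y: "x * y = y * x" "1 + x * y = y" by blast
  have "(1 - x) * y = 1" using y(2) by (metis add_diff_cancel_right' left_diff_distrib mult_1_left)
  moreover have "y * (1 - x) = 1"
    using y by (metis add_diff_cancel_right' right_diff_distrib mult_1_right)
  ultimately have "(1 - x) * y = 1 \<and> y * (1 - x) = 1" ..
  then show ?thesis by (auto simp: invertible_element_def)
qed

lemma invertible_element_mult:
  fixes x :: "'a::unital_cstar_algebra"
  assumes "invertible_element x" "invertible_element y"
  shows "invertible_element (x * y)"
proof -
  obtain x' y' where "x * x' = 1" "x' * x = 1" "y * y' = 1" "y' * y = 1"
    using assms by (auto simp: invertible_element_def)
  then have "(x * y) * (y' * x') = 1 \<and> (y' * x') * (x * y) = 1"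
    by (metis mult.assoc mult_1_right)
  then show ?thesis unfolding invertible_element_def by blast
qed

lemma norm_less_imp_notin_spectrum:
  assumes "norm (a::'a::unital_cstar_algebra) < cmod z"
  shows "z \<notin> spectrum a"
proof -
  have z: "z \<noteq> 0" using assms by (metis norm_ge_zero norm_zero not_le)
  have "norm (inverse z *\<^sub>C a) < 1"
    using assms z by (simp add: norm_scaleC norm_inverse) (simp add: inverse_eq_divide)
  then obtain y where y: "(1 - inverse z *\<^sub>C a) * y = 1" "y * (1 - inverse z *\<^sub>C a) = 1"
    using invertible_one_minus by (auto simp: invertible_element_def)
  have eq: "a - z *\<^sub>C 1 = (- z) *\<^sub>C (1 - inverse z *\<^sub>C a)"
    using z by (simp add: scaleC_diff_right scaleC_scaleC scaleC_minus_left)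
  have "(a - z *\<^sub>C 1) * ((- inverse z) *\<^sub>C y) = 1 \<and> ((- inverse z) *\<^sub>C y) * (a - z *\<^sub>C 1) = 1"
    unfolding eq using y z by (simp add: mult_scaleC_left mult_scaleC_right scaleC_scaleC)
  then show ?thesis unfolding spectrum_def invertible_element_def by blast
qed

lemma spectrum_subset_cball: "spectrum (a::'a::unital_cstar_algebra) \<subseteq> cball 0 (norm a)"
  using norm_less_imp_notin_spectrum by (force simp: not_less)

lemma closed_spectrum: "closed (spectrum (a::'a::unital_cstar_algebra))"
proof -
  have "open (- spectrum a)"
    unfolding open_dist
  proof
    fix z assume "z \<in> - spectrum a"
    then obtain y where y: "(a - z *\<^sub>C 1) * y = 1" "y * (a - z *\<^sub>C 1) = 1"
      by (auto simp: spectrum_def invertible_element_def)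
    have "w \<in> - spectrum a" if "dist w z < 1 / (norm y + 1)" for w
    proof -
      have "0 < norm y + 1" by (simp add: add_nonneg_pos)
      then have "cmod (w - z) * (norm y + 1) < 1"
        using that by (simp add: dist_norm field_simps)
      then have "norm ((w - z) *\<^sub>C y) < 1"
        unfolding norm_scaleC by (smt (verit) mult_left_mono norm_ge_zero)
      then have "invertible_element ((a - z *\<^sub>C 1) * (1 - (w - z) *\<^sub>C y))"
        using y by (intro invertible_element_mult invertible_one_minus)
          (auto simp: invertible_element_def)
      moreover have "(a - z *\<^sub>C 1) * (1 - (w - z) *\<^sub>C y) = a - w *\<^sub>C 1"
        by (simp add: right_diff_distrib mult_scaleC_right y scaleC_diff_left)
      ultimately show ?thesis by (simp add: spectrum_def)
    qed
    then show "\<exists>e>0. \<forall>w. dist w z < e \<longrightarrow> w \<in> - spectrum a"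
      by (intro exI[of _ "1 / (norm y + 1)"]) (auto simp: add_nonneg_pos)
  qed
  then show ?thesis by (simp add: closed_def)
qed

lemma compact_spectrum: "compact (spectrum (a::'a::unital_cstar_algebra))"
  using closed_spectrum spectrum_subset_cball bounded_subset bounded_cball compact_eq_bounded_closed
  by metis

text \<open>If \<open>y = (x + y\<^sup>2)/2\<close> then \<open>(1 - y)\<^sup>2 = 1 - x\<close>. The map \<open>y \<mapsto> (x + y\<^sup>2)/2\<close> is a
  contraction of the ball of radius \<open>norm x\<close>; running it inside the self-adjoint part of the
  bicommutant of \<open>x\<close> gives the root these properties.\<close>

lemma sqrt_one_minus:
  fixes x :: "'a::unital_cstar_algebra"
  assumes "star x = x" "norm x < 1"
  obtains p where "star p = p" "p * p = 1 - x" "\<And>z. z * x = x * z \<Longrightarrow> z * p = p * z"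
proof -
  define r where "r = norm x"
  define f where "f y = (1/2) *\<^sub>R (x + y * y)" for y
  let ?C = "cball 0 r \<inter> {y. star y = y} \<inter> (\<Inter>z\<in>{z. z * x = x * z}. {y. z * y = y * z})"
  have "\<exists>!y\<in>?C. f y = y"
  proof (rule Banach_fix[where c = r])
    have "closed {y::'a. star y = y}"
      by (intro closed_Collect_eq continuous_on_star continuous_intros)
    then show "complete ?C"
      unfolding complete_eq_closed by (intro closed_Int closed_INT ballI closed_commutant) auto
    have "0 \<in> ?C" by (simp add: r_def)
    then show "?C \<noteq> {}" by blast
    show "f ` ?C \<subseteq> ?C"
    proof (rule image_subsetI)
      fix y assume yC: "y \<in> ?C"
      then have y: "norm y \<le> r" "star y = y" by simp_all
      have "norm y * norm y \<le> r * 1"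
        using y(1) assms by (intro mult_mono) (auto simp: r_def)
      then have "norm (x + y * y) \<le> r + r"
        using norm_triangle_ineq[of x "y * y"] norm_mult_ineq[of y y] by (simp add: r_def)
      then have "f y \<in> cball 0 r" by (simp add: f_def)
      moreover have "star (f y) = f y"
        using y assms by (simp add: f_def star_scaleR star_add star_mult)
      moreover have "z * f y = f y * z" if z: "z * x = x * z" for z
      proof -
        have c: "z * y = y * z" using yC z by blast
        have "z * (y * y) = (y * y) * z"
          by (metis c mult.assoc)
        then show ?thesis using z by (simp add: f_def distrib_left distrib_right)
      qed
      ultimately show "f y \<in> ?C" by blast
    qed
    fix y z assume yz: "y \<in> ?C" "z \<in> ?C"
    have "norm y \<le> r" "norm z \<le> r" using yz by simp_all
    have "y * y - z * z = y * (y - z) + (y - z) * z" by (simp add: algebra_simps)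
    then have "norm (y * y - z * z) \<le> norm y * norm (y - z) + norm (y - z) * norm z"
      by (metis norm_mult_ineq norm_triangle_mono)
    also have "\<dots> \<le> r * norm (y - z) + norm (y - z) * r"
      using \<open>norm y \<le> r\<close> \<open>norm z \<le> r\<close> by (intro add_mono mult_mono) (auto simp: r_def)
    finally show "dist (f y) (f z) \<le> r * dist y z"
      by (simp add: f_def dist_norm scaleR_diff_right[symmetric] del: scaleR_diff_right)
  qed (use assms in \<open>auto simp: r_def\<close>)
  then obtain y where y: "y \<in> ?C" "f y = y" by blast
  from y(1) have y: "star y = y" "f y = y" "\<And>z. z * x = x * z \<Longrightarrow> z * y = y * z"
    using y(2) by blast+
  have "y + y = x + y * y"
    using y(2) by (metis f_def scaleR_2 scaleR_half_double scaleR_add_right)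
  then have "(1 - y) * (1 - y) = 1 - x" by (simp add: algebra_simps)
  moreover have "star (1 - y) = 1 - y" by (simp add: star_diff y)
  moreover have "z * (1 - y) = (1 - y) * z" if "z * x = x * z" for z
    using y(3)[OF that] by (simp add: algebra_simps)
  ultimately show thesis using that by blast
qed

subsection \<open>Positive elements\<close>

text \<open>A metric form of positivity: for self-adjoint \<open>h\<close> the norm condition with \<open>t\<close> says that the spectrum
  lies in \<open>{0..2*t}\<close>. In this form the positive elements obviously form a convex cone.\<close>

definition positive_element :: "'a::unital_cstar_algebra \<Rightarrow> bool" where
  "positive_element h \<longleftrightarrow> star h = h \<and> (\<exists>t\<ge>0. norm (t *\<^sub>R 1 - h) \<le> t)"

lemma positive_zero: "positive_element 0"
  by (auto simp: positive_element_def intro!: exI[of _ 0])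

lemma positive_add: "positive_element h \<Longrightarrow> positive_element k \<Longrightarrow> positive_element (h + k)"
  unfolding positive_element_def
proof safe
  fix t s assume "0 \<le> t" "0 \<le> s" "norm (t *\<^sub>R 1 - h) \<le> t" "norm (s *\<^sub>R 1 - k) \<le> s"
  moreover have "(t + s) *\<^sub>R 1 - (h + k) = (t *\<^sub>R 1 - h) + (s *\<^sub>R 1 - k)"
    by (simp add: algebra_simps)
  ultimately show "\<exists>r\<ge>0. norm (r *\<^sub>R 1 - (h + k)) \<le> r"
    by (intro exI[of _ "t + s"]) (smt (verit) norm_triangle_ineq)
qed (simp add: star_add)

lemma positive_scaleR: "0 \<le> r \<Longrightarrow> positive_element h \<Longrightarrow> positive_element (r *\<^sub>R h)"
  unfolding positive_element_def
proof safe
  fix t assume "0 \<le> r" "0 \<le> t" "norm (t *\<^sub>R 1 - h) \<le> t"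
  moreover have "(r * t) *\<^sub>R 1 - r *\<^sub>R h = r *\<^sub>R (t *\<^sub>R 1 - h)"
    by (simp add: algebra_simps)
  ultimately show "\<exists>s\<ge>0. norm (s *\<^sub>R 1 - r *\<^sub>R h) \<le> s"
    by (intro exI[of _ "r * t"]) (simp add: mult_left_mono)
qed (simp add: star_scaleR)

lemma positive_sum: "(\<And>i. i \<in> I \<Longrightarrow> positive_element (h i)) \<Longrightarrow> positive_element (\<Sum>i\<in>I. h i)"
  by (induction I rule: infinite_finite_induct) (auto intro: positive_add positive_zero)

text \<open>If \<open>p\<^sup>2 + q\<^sup>2 = c\<close> then \<open>p + \<i> q\<close> is \<open>sqrt c\<close> times a unitary, and \<open>2(p\<^sup>2 - q\<^sup>2)\<close>
  is the sum of its square and the adjoint of that. This is the source of all norm bounds below.\<close>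

lemma norm_diff_squares_le:
  fixes p q :: "'a::unital_cstar_algebra"
  assumes "star p = p" "star q = q" "p * q = q * p" "p * p + q * q = c *\<^sub>R 1" "0 \<le> c"
  shows "norm (q * q - p * p) \<le> c"
proof -
  define u where "u = p + \<i> *\<^sub>C q"
  have su: "star u = p - \<i> *\<^sub>C q"
    by (simp add: u_def star_add star_scaleC assms scaleC_minus_left)
  have "star u * u = c *\<^sub>R 1"
    unfolding su unfolding u_def
    by (simp add: algebra_simps mult_scaleC_left mult_scaleC_right scaleC_scaleC assms(3)
        scaleC_minus_left scaleC_diff_right scaleC_add_right flip: assms(4))
  then have "(norm u)\<^sup>2 = c * norm (1::'a)"
    using assms(5) by (simp flip: cstar_identity)
  also have "\<dots> \<le> c" using norm_one_le[where 'a='a] assms(5) by (simp add: mult_left_le)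
  finally have nu: "norm u * norm u \<le> c" by (simp add: power2_eq_square)
  have "u * u + star u * star u = 2 *\<^sub>R (p * p - q * q)"
    unfolding su unfolding u_def
    by (simp add: algebra_simps mult_scaleC_left mult_scaleC_right scaleC_scaleC assms(3)
        scaleC_minus_left scaleC_diff_right scaleC_add_right scaleR_2)
  then have "2 * norm (q * q - p * p) = norm (u * u + star u * star u)"
    by (simp add: norm_minus_commute)
  also have "\<dots> \<le> norm u * norm u + norm (star u) * norm (star u)"
    by (intro norm_triangle_mono norm_mult_ineq)
  finally show ?thesis using nu by simp
qed

lemma positive_square:
  fixes h :: "'a::unital_cstar_algebra"
  assumes h: "star h = h"
  shows "positive_element (h * h)"
proof -
  define r where "r = norm h + 1"
  have r: "r > 0" "norm h < r" by (auto simp: r_def add_nonneg_pos)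
  define k where "k = (1 / r) *\<^sub>R h"
  have k: "star k = k" "norm k < 1" using r by (auto simp: k_def star_scaleR h)
  have "norm (k * k) < 1"
    using norm_mult_ineq[of k k] k mult_strict_mono[of "norm k" 1 "norm k" 1] by (smt (verit) norm_ge_zero)
  then obtain q where q: "star q = q" "q * q = 1 - k * k" "k * q = q * k"
    using sqrt_one_minus[of "k * k"] by (metis k(1) mult.assoc star_mult)
  have "norm (q * q - k * k) \<le> 1"
    by (rule norm_diff_squares_le) (auto simp: k q)
  moreover have "(1/2) *\<^sub>R 1 - k * k = (1/2) *\<^sub>R (q * q - k * k)"
    unfolding q(2) by (simp add: algebra_simps flip: scaleR_add_left)
  ultimately have "norm ((1/2) *\<^sub>R 1 - k * k) \<le> 1/2" by simp
  then have "positive_element (k * k)"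
    unfolding positive_element_def by (intro conjI exI[of _ "1/2"]) (auto simp: star_mult k)
  then have "positive_element ((r * r) *\<^sub>R (k * k))" by (rule positive_scaleR[rotated]) simp
  then show ?thesis using r by (simp add: k_def)
qed

text \<open>The shift by \<open>e\<close> keeps the argument of the square root inside the open unit ball.\<close>

lemma positive_sqrt:
  fixes h :: "'a::unital_cstar_algebra"
  assumes "positive_element h" "0 < e"
  obtains p where "star p = p" "p * p = h + e *\<^sub>R 1" "\<And>z. z * h = h * z \<Longrightarrow> z * p = p * z"
proof -
  obtain t where t: "0 \<le> t" "norm (t *\<^sub>R 1 - h) \<le> t" and h: "star h = h"
    using assms(1) by (auto simp: positive_element_def)
  define x where "x = (1 / (t + e)) *\<^sub>R (t *\<^sub>R 1 - h)"
  have te: "t + e > 0" using t assms by simp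
  have "norm x < 1" using t assms te by (simp add: x_def)
  moreover have "star x = x" by (simp add: x_def star_scaleR star_diff h)
  ultimately obtain p where p: "star p = p" "p * p = 1 - x" "\<And>z. z * x = x * z \<Longrightarrow> z * p = p * z"
    using sqrt_one_minus by metis
  show thesis
  proof
    show "star (sqrt (t + e) *\<^sub>R p) = sqrt (t + e) *\<^sub>R p" by (simp add: star_scaleR p)
    have "(sqrt (t + e) *\<^sub>R p) * (sqrt (t + e) *\<^sub>R p) = (t + e) *\<^sub>R (1 - x)"
      using te by (simp add: p)
    also have "\<dots> = (t + e) *\<^sub>R 1 - (t + e) *\<^sub>R x" by (rule scaleR_diff_right)
    also have "(t + e) *\<^sub>R x = t *\<^sub>R 1 - h" using te by (simp add: x_def)
    also have "(t + e) *\<^sub>R 1 - (t *\<^sub>R 1 - h) = h + e *\<^sub>R 1" by (simp add: algebra_simps)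
    finally show "(sqrt (t + e) *\<^sub>R p) * (sqrt (t + e) *\<^sub>R p) = h + e *\<^sub>R 1" .
    fix z assume "z * h = h * z"
    then have "z * x = x * z" by (simp add: x_def algebra_simps)
    then show "z * (sqrt (t + e) *\<^sub>R p) = (sqrt (t + e) *\<^sub>R p) * z" by (simp add: p)
  qed
qed

lemma norm_le_if_positive:
  fixes h :: "'a::unital_cstar_algebra"
  assumes "positive_element (c *\<^sub>R 1 - h)" "positive_element (c *\<^sub>R 1 + h)" "0 \<le> c"
  shows "norm h \<le> c"
proof (rule field_le_epsilon)
  fix e :: real assume e: "0 < e"
  obtain p where p: "star p = p" "p * p = c *\<^sub>R 1 - h + e *\<^sub>R 1"
    "\<And>z. z * (c *\<^sub>R 1 - h) = (c *\<^sub>R 1 - h) * z \<Longrightarrow> z * p = p * z"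
    using positive_sqrt[OF assms(1) e] by metis
  obtain q where q: "star q = q" "q * q = c *\<^sub>R 1 + h + e *\<^sub>R 1"
    "\<And>z. z * (c *\<^sub>R 1 + h) = (c *\<^sub>R 1 + h) * z \<Longrightarrow> z * q = q * z"
    using positive_sqrt[OF assms(2) e] by metis
  have "h * p = p * h" by (rule p(3)) (simp add: algebra_simps)
  then have pq: "p * q = q * p" by (intro q(3)) (simp add: algebra_simps)
  have "p * p + q * q = (2 * (c + e)) *\<^sub>R 1"
    unfolding p q by (simp add: algebra_simps flip: scaleR_2)
  then have "norm (q * q - p * p) \<le> 2 * (c + e)"
    using p(1) q(1) pq e assms(3) by (intro norm_diff_squares_le) auto
  moreover have "q * q - p * p = 2 *\<^sub>R h" by (simp add: p q scaleR_2)
  ultimately show "norm h \<le> c + e" by simp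
qed

lemma positive_shift_square:
  fixes h :: "'a::unital_cstar_algebra"
  assumes "star h = h" "norm (h * h) \<le> c"
  shows "positive_element (c *\<^sub>R 1 - h * h)"
  unfolding positive_element_def
  using assms norm_ge_zero[of "h * h"]
  by (intro conjI exI[of _ c]) (auto simp: star_diff star_scaleR star_mult simp del: norm_ge_zero)

text \<open>Coefficients of a combination of commuting positive elements may be estimated in absolute
  value, as if the elements were nonnegative functions. With \<open>T\<close> the left and \<open>P\<close> the right
  combination, \<open>P\<^sup>2 - star T T\<close> and \<open>P\<^sup>2 + star T T\<close> are nonnegative combinations of the squares
  \<open>(d\<^sub>i d\<^sub>j)\<^sup>2\<close>.\<close>

lemma norm_sum_squares_mono:
  fixes d :: "'i \<Rightarrow> 'a::unital_cstar_algebra"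
  assumes d: "\<And>i. i \<in> I \<Longrightarrow> star (d i) = d i" "\<And>i j. i \<in> I \<Longrightarrow> j \<in> I \<Longrightarrow> d i * d j = d j * d i"
    and k: "\<And>i. i \<in> I \<Longrightarrow> cmod (k i) \<le> m i"
  shows "norm (\<Sum>i\<in>I. k i *\<^sub>C (d i * d i)) \<le> norm (\<Sum>i\<in>I. m i *\<^sub>R (d i * d i))"
proof -
  define T where "T = (\<Sum>i\<in>I. k i *\<^sub>C (d i * d i))"
  define P where "P = (\<Sum>i\<in>I. m i *\<^sub>R (d i * d i))"
  define D where "D i j = (d i * d j) * (d i * d j)" for i j
  define Q where "Q = (\<Sum>i\<in>I. \<Sum>j\<in>I. Re (cnj (k i) * k j) *\<^sub>R D i j)"
  have D: "(d i * d i) * (d j * d j) = D i j" "(d j * d j) * (d i * d i) = D i j"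
    if "i \<in> I" "j \<in> I" for i j
    using d(2)[OF that] unfolding D_def by (metis mult.assoc)+
  have PP: "P * P = (\<Sum>i\<in>I. \<Sum>j\<in>I. (m i * m j) *\<^sub>R D i j)"
    unfolding P_def sum_product by (intro sum.cong refl) (simp add: D)
  have TT: "star T * T = (\<Sum>i\<in>I. \<Sum>j\<in>I. (cnj (k i) * k j) *\<^sub>C D i j)"
    unfolding T_def star_sum sum_product
    by (intro sum.cong refl)
      (simp add: D d(1) star_scaleC star_mult mult_scaleC_left mult_scaleC_right scaleC_scaleC
        mult.commute[of "cnj _"])
  also have "\<dots> = (\<Sum>i\<in>I. \<Sum>j\<in>I. (cnj (k j) * k i) *\<^sub>C D i j)"
    by (subst sum.swap, intro sum.cong refl) (metis D)
  finally have TT': "star T * T = (\<Sum>i\<in>I. \<Sum>j\<in>I. (cnj (k j) * k i) *\<^sub>C D i j)" .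
  have "2 *\<^sub>R (star T * T) = (\<Sum>i\<in>I. \<Sum>j\<in>I. (cnj (k i) * k j + cnj (k j) * k i) *\<^sub>C D i j)"
    unfolding scaleR_2 by (subst (1) TT, subst TT') (simp add: sum.distrib scaleC_add_left)
  also have "\<dots> = (\<Sum>i\<in>I. \<Sum>j\<in>I. (2 * Re (cnj (k i) * k j)) *\<^sub>R D i j)"
  proof -
    have "cnj (k i) * k j + cnj (k j) * k i = complex_of_real (2 * Re (cnj (k i) * k j))" for i j
      by (simp add: complex_eq_iff)
    then show ?thesis by (simp only: scaleR_conv_scaleC)
  qed
  also have "\<dots> = 2 *\<^sub>R Q" unfolding Q_def scaleR_sum_right by simp
  finally have TQ: "star T * T = Q" by simp
  have P: "star P = P"
    unfolding P_def star_sum by (intro sum.cong refl) (simp add: d(1) star_scaleR star_mult)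
  have re: "\<bar>Re (cnj (k i) * k j)\<bar> \<le> m i * m j" if "i \<in> I" "j \<in> I" for i j
  proof -
    have "\<bar>Re (cnj (k i) * k j)\<bar> \<le> cmod (k i) * cmod (k j)"
      using abs_Re_le_cmod[of "cnj (k i) * k j"] by (simp add: norm_mult)
    also have "\<dots> \<le> m i * m j"
      using k that by (intro mult_mono) (auto intro: order_trans[OF norm_ge_zero])
    finally show ?thesis .
  qed
  have posD: "positive_element (D i j)" if "i \<in> I" "j \<in> I" for i j
    unfolding D_def using that by (intro positive_square) (simp add: star_mult d)
  have "norm Q \<le> norm (P * P)"
  proof (rule norm_le_if_positive)
    have "positive_element ((norm (P * P) *\<^sub>R 1 - P * P) +
        (\<Sum>i\<in>I. \<Sum>j\<in>I. (m i * m j - Re (cnj (k i) * k j)) *\<^sub>R D i j))"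
      using re by (intro positive_add positive_sum positive_scaleR posD positive_shift_square P)
        (auto simp: abs_le_iff)
    also have "(norm (P * P) *\<^sub>R 1 - P * P) +
        (\<Sum>i\<in>I. \<Sum>j\<in>I. (m i * m j - Re (cnj (k i) * k j)) *\<^sub>R D i j) = norm (P * P) *\<^sub>R 1 - Q"
      unfolding scaleR_diff_left sum_subtractf by (simp add: Q_def PP)
    finally show "positive_element (norm (P * P) *\<^sub>R 1 - Q)" .
    have "positive_element ((norm (P * P) *\<^sub>R 1 - P * P) +
        (\<Sum>i\<in>I. \<Sum>j\<in>I. (m i * m j + Re (cnj (k i) * k j)) *\<^sub>R D i j))"
      using re by (intro positive_add positive_sum positive_scaleR posD positive_shift_square P)
        (auto simp: abs_le_iff, smt (verit))
    also have "(norm (P * P) *\<^sub>R 1 - P * P) +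
        (\<Sum>i\<in>I. \<Sum>j\<in>I. (m i * m j + Re (cnj (k i) * k j)) *\<^sub>R D i j) = norm (P * P) *\<^sub>R 1 + Q"
      unfolding scaleR_add_left sum.distrib by (simp add: Q_def PP)
    finally show "positive_element (norm (P * P) *\<^sub>R 1 + Q)" .
  qed simp
  then have "(norm T)\<^sup>2 \<le> (norm P)\<^sup>2"
    using TQ P by (metis cstar_identity)
  then show ?thesis unfolding T_def P_def by (simp add: power2_le_iff_abs_le)
qed

section \<open>Bernstein polynomials of an operator\<close>

text \<open>Viewing \<open>\<complex>\<close> itself as a C*-algebra lets every identity below be read both for operators and
  for numbers.\<close>

instantiation complex :: unital_cstar_algebra
begin
definition "scaleC_complex = ((*) :: complex \<Rightarrow> complex \<Rightarrow> complex)"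
definition "star_complex = cnj"
instance
  by standard (auto simp: scaleC_complex_def star_complex_def algebra_simps norm_mult scaleR_conv_of_real
      complex_norm_square[symmetric] power2_eq_square norm_mult)
end

text \<open>Probabilistic reading, for \<open>\<bar>z\<bar> \<le> S\<close>: a letter \<open>l < 4\<close> is drawn with probability \<open>weight S z l\<close> and moves to the
  corner \<open>vertex S l\<close> of a square. Then \<open>bern S z s\<close> is the probability of the word \<open>s\<close>, and
  \<open>position S s\<close> is the sample mean of its corners, an estimator of \<open>z\<close>.\<close>

definition vertex :: "real \<Rightarrow> nat \<Rightarrow> complex" where
  "vertex S l = of_real (2 * S) * \<i> ^ l"

definition weight :: "real \<Rightarrow> 'a::unital_cstar_algebra \<Rightarrow> nat \<Rightarrow> 'a" where
  "weight S a l = (1/4) *\<^sub>R 1 + (1 / (8 * S)) *\<^sub>R (cnj (\<i> ^ l) *\<^sub>C a + \<i> ^ l *\<^sub>C star a)"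

definition words :: "nat \<Rightarrow> nat list set" where
  "words n = {s. set s \<subseteq> {..<4} \<and> length s = n}"

definition bern :: "real \<Rightarrow> 'a::unital_cstar_algebra \<Rightarrow> nat list \<Rightarrow> 'a" where
  "bern S a s = prod_list (map (weight S a) s)"

definition displacement :: "real \<Rightarrow> nat list \<Rightarrow> complex" where
  "displacement S s = sum_list (map (vertex S) s)"

definition position :: "real \<Rightarrow> nat list \<Rightarrow> complex" where
  "position S s = displacement S s / of_nat (length s)"

lemma finite_words [simp]: "finite (words n)"
  unfolding words_def by (rule finite_lists_length_eq) simp

lemma words_0: "words 0 = {[]}"
  by (auto simp: words_def)

lemma length_words: "s \<in> words n \<Longrightarrow> length s = n"
  by (simp add: words_def)

lemma sum_words_Suc: "(\<Sum>s\<in>words (Suc n). F s) = (\<Sum>l<4. \<Sum>s\<in>words n. F (l # s))"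
proof -
  have "words (Suc n) = (\<lambda>(l, s). l # s) ` ({..<4} \<times> words n)"
    by (auto simp: words_def length_Suc_conv image_iff)
  moreover have "inj_on (\<lambda>(l, s). l # s) ({..<4} \<times> words n)" by (auto simp: inj_on_def)
  ultimately show ?thesis
    by (simp add: sum.reindex sum.cartesian_product case_prod_unfold comp_def)
qed

lemma sum_lessThan_4: "(\<Sum>l<(4::nat). f l) = f 0 + f 1 + f 2 + (f 3 :: 'b::comm_monoid_add)"
  by (simp add: eval_nat_numeral add_ac)

lemma i_cubed: "\<i> ^ 3 = - \<i>"
  by (simp add: eval_nat_numeral)

lemma sum_weight: "(\<Sum>l<4. weight S a l) = (1::'a::unital_cstar_algebra)"
proof -
  have "(\<Sum>l<4. weight S a l) = 4 *\<^sub>R ((1/4) *\<^sub>R (1::'a))"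
    unfolding sum_lessThan_4 weight_def
    by (simp add: i_cubed scaleC_minus_left algebra_simps flip: scaleR_add_left)
  then show ?thesis by simp
qed

lemma sum_vertex_weight:
  assumes "S \<noteq> 0"
  shows "(\<Sum>l<4. vertex S l *\<^sub>C weight S a l) = (a::'a::unital_cstar_algebra)"
proof -
  have "vertex S l *\<^sub>C weight S a l = (vertex S l / 4) *\<^sub>C 1
      + (vertex S l * cnj (\<i> ^ l) / (8 * S)) *\<^sub>C a + (vertex S l * \<i> ^ l / (8 * S)) *\<^sub>C star a" for l
    by (simp add: weight_def scaleR_conv_scaleC scaleC_add_right scaleC_scaleC)
  then have "(\<Sum>l<4. vertex S l *\<^sub>C weight S a l) = (\<Sum>l<4. vertex S l / 4) *\<^sub>C 1
      + (\<Sum>l<4. vertex S l * cnj (\<i> ^ l) / (8 * S)) *\<^sub>C a + (\<Sum>l<4. vertex S l * \<i> ^ l / (8 * S)) *\<^sub>C star a"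
    by (simp only: sum.distrib scaleC_sum_left)
  moreover have "(\<Sum>l<4. vertex S l / 4) = 0" "(\<Sum>l<4. vertex S l * \<i> ^ l / (8 * S)) = 0"
    "(\<Sum>l<4. vertex S l * cnj (\<i> ^ l) / (8 * S)) = 1"
    using assms by (simp_all add: sum_lessThan_4 vertex_def i_cubed field_simps)
  ultimately show ?thesis by simp
qed

lemma star_weight [simp]: "star (weight S a l) = weight S (a::'a::unital_cstar_algebra) l"
  unfolding weight_def by (simp add: star_add star_scaleR star_scaleC star_star add.commute)

lemma sum_cnj_vertex_weight:
  assumes "S \<noteq> 0"
  shows "(\<Sum>l<4. cnj (vertex S l) *\<^sub>C weight S a l) = star (a::'a::unital_cstar_algebra)"
  using arg_cong[OF sum_vertex_weight[OF assms, of a], of star]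
  by (simp add: star_sum star_scaleC)

lemma sum_norm_vertex_weight:
  "(\<Sum>l<4. (vertex S l * cnj (vertex S l)) *\<^sub>C weight S a l) = (4 * S\<^sup>2) *\<^sub>R (1::'a::unital_cstar_algebra)"
proof -
  have "vertex S l * cnj (vertex S l) = of_real (4 * S\<^sup>2)" for l
  proof -
    have "\<i> ^ l * (- \<i>) ^ l = (1::complex)" by (simp flip: power_mult_distrib)
    then have "vertex S l * cnj (vertex S l) = of_real (2*S) * of_real (2*S) * 1"
      unfolding vertex_def by (simp add: mult_ac)
    then show ?thesis by (simp add: power2_eq_square)
  qed
  then have "(\<Sum>l<4. (vertex S l * cnj (vertex S l)) *\<^sub>C weight S a l) = (4 * S\<^sup>2) *\<^sub>R (\<Sum>l<4. weight S a l)"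
    unfolding scaleR_sum_right by (simp only: scaleC_of_real)
  then show ?thesis by (simp add: sum_weight)
qed

lemma bern_Nil [simp]: "bern S a [] = 1" and bern_Cons [simp]: "bern S a (l # s) = weight S a l * bern S a s"
  by (simp_all add: bern_def)

text \<open>Independence of the first letter from the others; the moments of the sample mean follow from it
  by induction on the number of letters.\<close>

lemma sum_words_product:
  "(\<Sum>l<4. \<Sum>s\<in>words n. (p l * q s) *\<^sub>C bern S a (l # s)) =
     (\<Sum>l<4. p l *\<^sub>C weight S a l) * (\<Sum>s\<in>words n. q s *\<^sub>C bern S (a::'a::unital_cstar_algebra) s)"
  unfolding sum_product by (simp add: mult_scaleC_left mult_scaleC_right scaleC_scaleC mult.commute)

lemma sum_bern: "(\<Sum>s\<in>words n. bern S a s) = (1::'a::unital_cstar_algebra)"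
proof (induction n)
  case (Suc n)
  then show ?case
    using sum_words_product[where p = "\<lambda>_. 1" and q = "\<lambda>_. 1" and n = n and S = S and a = a]
    by (simp add: sum_words_Suc sum_weight)
qed (simp add: words_0)

lemma sum_displacement_bern:
  assumes "S \<noteq> 0"
  shows "(\<Sum>s\<in>words n. displacement S s *\<^sub>C bern S a s) = of_nat n *\<^sub>C (a::'a::unital_cstar_algebra)"
proof (induction n)
  case (Suc n)
  have "(\<Sum>s\<in>words (Suc n). displacement S s *\<^sub>C bern S a s) =
      (\<Sum>l<4. \<Sum>s\<in>words n. (vertex S l * 1) *\<^sub>C bern S a (l # s)) +
      (\<Sum>l<4. \<Sum>s\<in>words n. (1 * displacement S s) *\<^sub>C bern S a (l # s))"
    by (simp add: sum_words_Suc displacement_def scaleC_add_left sum.distrib)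
  also have "\<dots> = a + of_nat n *\<^sub>C a"
    unfolding sum_words_product by (simp add: Suc sum_vertex_weight assms sum_weight sum_bern)
  finally show ?case by (simp add: scaleC_add_left)
qed (simp add: words_0 displacement_def)

lemma star_bern:
  assumes "star a * a = a * star (a::'a::unital_cstar_algebra)"
  shows "star (bern S a s) = bern S a s"
proof -
  have wz: "z * weight S a l = weight S a l * z" if "z * a = a * z" "z * star a = star a * z" for z l
    using that by (simp add: weight_def algebra_simps mult_scaleC_left mult_scaleC_right)
  have bz: "z * bern S a s = bern S a s * z" if "z * a = a * z" "z * star a = star a * z" for z s
    by (induction s) (use wz[OF that] in \<open>simp_all\<close>, metis mult.assoc)
  have ww: "weight S a l * a = a * weight S a l" "weight S a l * star a = star a * weight S a l" for l
    using assms wz[of a] wz[of "star a"] by simp_all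
  show ?thesis
    by (induction s) (simp_all add: star_mult bz[OF ww])
qed

text \<open>Second moment: each of the \<open>n\<close> letters contributes \<open>4 S\<^sup>2\<close>, and each of the \<open>n (n - 1)\<close> ordered
  pairs of different letters contributes \<open>star a * a\<close>, by independence.\<close>

lemma sum_norm_displacement_bern:
  assumes "S \<noteq> 0" "star a * a = a * star (a::'a::unital_cstar_algebra)"
  shows "(\<Sum>s\<in>words n. (displacement S s * cnj (displacement S s)) *\<^sub>C bern S a s) =
    (n * (4 * S\<^sup>2)) *\<^sub>R 1 + (real n * (real n - 1)) *\<^sub>R (star a * a)"
proof (induction n)
  case (Suc n)
  have T: "displacement S (l # s) = vertex S l + displacement S s" for l s by (simp add: displacement_def)
  have ct: "(\<Sum>s\<in>words n. cnj (displacement S s) *\<^sub>C bern S a s) = of_nat n *\<^sub>C star a"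
    using arg_cong[OF sum_displacement_bern[OF assms(1), where n = n and a = a], of star]
    by (simp add: star_sum star_scaleC star_bern[OF assms(2)])
  have "(\<Sum>s\<in>words (Suc n). (displacement S s * cnj (displacement S s)) *\<^sub>C bern S a s) =
      (\<Sum>l<4. \<Sum>s\<in>words n. ((vertex S l * cnj (vertex S l)) * 1) *\<^sub>C bern S a (l # s)) +
      (\<Sum>l<4. \<Sum>s\<in>words n. (vertex S l * cnj (displacement S s)) *\<^sub>C bern S a (l # s)) +
      (\<Sum>l<4. \<Sum>s\<in>words n. (cnj (vertex S l) * displacement S s) *\<^sub>C bern S a (l # s)) +
      (\<Sum>l<4. \<Sum>s\<in>words n. (1 * (displacement S s * cnj (displacement S s))) *\<^sub>C bern S a (l # s))"
    unfolding sum_words_Suc T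
    by (simp add: scaleC_add_left sum.distrib algebra_simps del: bern_Cons)
  also have "\<dots> = (4 * S\<^sup>2) *\<^sub>R 1 + a * (of_nat n *\<^sub>C star a) + star a * (of_nat n *\<^sub>C a)
      + ((n * (4 * S\<^sup>2)) *\<^sub>R 1 + (real n * (real n - 1)) *\<^sub>R (star a * a))"
    unfolding sum_words_product sum_norm_vertex_weight sum_vertex_weight[OF assms(1)]
      sum_cnj_vertex_weight[OF assms(1)] sum_displacement_bern[OF assms(1)] ct Suc
    by (simp add: sum_weight sum_bern)
  also have "\<dots> = (4 * S\<^sup>2 + n * (4 * S\<^sup>2)) *\<^sub>R 1 + (real n + real n + real n * (real n - 1)) *\<^sub>R (star a * a)"
    unfolding scaleR_add_left mult_scaleC_right
    using scaleC_of_real[of "real n" "star a * a"] by (simp flip: assms(2))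
  finally show ?case by (simp add: algebra_simps)
qed (simp add: words_0 displacement_def)

lemma sum_position_bern:
  assumes "S \<noteq> 0" "n > 0"
  shows "(\<Sum>s\<in>words n. position S s *\<^sub>C bern S a s) = (a::'a::unital_cstar_algebra)"
proof -
  have "(\<Sum>s\<in>words n. position S s *\<^sub>C bern S a s) =
      (1 / of_nat n) *\<^sub>C (\<Sum>s\<in>words n. displacement S s *\<^sub>C bern S a s)"
    by (simp add: scaleC_sum_right scaleC_scaleC position_def length_words)
  then show ?thesis using assms by (simp add: sum_displacement_bern scaleC_scaleC)
qed

lemma sum_cnj_position_bern:
  assumes "S \<noteq> 0" "n > 0" "star a * a = a * star (a::'a::unital_cstar_algebra)"
  shows "(\<Sum>s\<in>words n. cnj (position S s) *\<^sub>C bern S a s) = star a"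
  using arg_cong[OF sum_position_bern[OF assms(1,2), of a], of star]
  by (simp add: star_sum star_scaleC star_bern[OF assms(3)])

lemma sum_norm_position_bern:
  assumes "S \<noteq> 0" "n > 0" "star a * a = a * star (a::'a::unital_cstar_algebra)"
  shows "(\<Sum>s\<in>words n. (position S s * cnj (position S s)) *\<^sub>C bern S a s) =
      (4 * S\<^sup>2 / n) *\<^sub>R 1 + (1 - 1/n) *\<^sub>R (star a * a)"
proof -
  have "(\<Sum>s\<in>words n. (position S s * cnj (position S s)) *\<^sub>C bern S a s) =
      (1 / (real n * real n)) *\<^sub>R (\<Sum>s\<in>words n. (displacement S s * cnj (displacement S s)) *\<^sub>C bern S a s)"
    by (simp add: scaleC_sum_right scaleR_conv_scaleC scaleC_scaleC position_def length_words)
  also have "\<dots> = ((1 / (real n * real n)) * (n * (4 * S\<^sup>2))) *\<^sub>R 1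
      + ((1 / (real n * real n)) * (real n * (real n - 1))) *\<^sub>R (star a * a)"
    by (simp only: sum_norm_displacement_bern[OF assms(1,3)] scaleR_add_right scaleR_scaleR)
  also have "(1 / (real n * real n)) * (n * (4 * S\<^sup>2)) = 4 * S\<^sup>2 / n"
    using assms(2) by simp
  also have "(1 / (real n * real n)) * (real n * (real n - 1)) = 1 - 1/n"
    using assms(2) by (simp add: field_simps)
  finally show ?thesis .
qed

lemma of_real_norm_diff_square:
  "complex_of_real ((cmod (u - v))\<^sup>2) = u * cnj u + v * cnj v - u * cnj v - cnj u * v"
  unfolding complex_norm_square by (simp add: algebra_simps)

text \<open>The mean squared distance of two independent sample means. It tends to \<open>0\<close> as both sample sizes
  grow: the weak law of large numbers, inside the algebra.\<close>

lemma sum_dist_bern: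
  assumes "S \<noteq> 0" "star a * a = a * star (a::'a::unital_cstar_algebra)" "n > 0" "m > 0"
  shows "(\<Sum>s\<in>words n. \<Sum>t\<in>words m. (cmod (position S s - position S t))\<^sup>2 *\<^sub>R (bern S a s * bern S a t))
    = (1/n + 1/m) *\<^sub>R ((4 * S\<^sup>2) *\<^sub>R 1 - star a * a)"
proof -
  let ?b = "bern S a" and ?P = "position S"
  have prod: "(\<Sum>s\<in>words n. \<Sum>t\<in>words m. (p s * q t) *\<^sub>C (?b s * ?b t)) =
      (\<Sum>s\<in>words n. p s *\<^sub>C ?b s) * (\<Sum>t\<in>words m. q t *\<^sub>C ?b t)" for p q
    unfolding sum_product by (simp add: mult_scaleC_left mult_scaleC_right scaleC_scaleC mult.commute)
  have "(\<Sum>s\<in>words n. \<Sum>t\<in>words m. (cmod (?P s - ?P t))\<^sup>2 *\<^sub>R (?b s * ?b t)) =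
      (\<Sum>s\<in>words n. \<Sum>t\<in>words m. ((?P s * cnj (?P s)) * 1) *\<^sub>C (?b s * ?b t))
    + (\<Sum>s\<in>words n. \<Sum>t\<in>words m. (1 * (?P t * cnj (?P t))) *\<^sub>C (?b s * ?b t))
    - (\<Sum>s\<in>words n. \<Sum>t\<in>words m. (?P s * cnj (?P t)) *\<^sub>C (?b s * ?b t))
    - (\<Sum>s\<in>words n. \<Sum>t\<in>words m. (cnj (?P s) * ?P t) *\<^sub>C (?b s * ?b t))"
    unfolding sum.distrib[symmetric] sum_subtractf[symmetric]
    by (intro sum.cong refl)
      (simp only: scaleR_conv_scaleC of_real_norm_diff_square scaleC_diff_left scaleC_add_left mult_1_left mult_1_right)
  also have "\<dots> = ((4 * S\<^sup>2 / n) *\<^sub>R 1 + (1 - 1/n) *\<^sub>R (star a * a)) +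
      ((4 * S\<^sup>2 / m) *\<^sub>R 1 + (1 - 1/m) *\<^sub>R (star a * a)) - star a * a - star a * a"
    unfolding prod by (simp add: assms sum_bern sum_position_bern sum_cnj_position_bern sum_norm_position_bern)
  also have "\<dots> = (1/n + 1/m) *\<^sub>R ((4 * S\<^sup>2) *\<^sub>R 1 - star a * a)"
    by (simp add: algebra_simps)
  finally show ?thesis .
qed

lemma vertex_in_cball: "0 \<le> S \<Longrightarrow> cmod (vertex S l) = 2 * S"
  by (simp add: vertex_def norm_mult norm_power)

lemma position_in_cball:
  assumes "0 \<le> S" shows "position S s \<in> cball 0 (2 * S)"
proof -
  have "cmod (displacement S s) \<le> length s * (2 * S)"
  proof (induction s)
    case (Cons l s)
    then show ?case using norm_triangle_ineq[of "vertex S l" "displacement S s"]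
      by (simp add: displacement_def vertex_in_cball assms algebra_simps)
  qed (simp add: displacement_def)
  then show ?thesis using assms by (cases "length s = 0")
    (auto simp: position_def norm_divide divide_le_eq mult.commute)
qed

subsection \<open>The numerical weights\<close>

definition bern_num :: "real \<Rightarrow> complex \<Rightarrow> nat list \<Rightarrow> real" where
  "bern_num S z s = prod_list (map (\<lambda>l. (1 + Re (cnj (\<i> ^ l) * z) / S) / 4) s)"

lemma bern_num_complex: "S \<noteq> 0 \<Longrightarrow> bern S z s = complex_of_real (bern_num S z s)"
proof -
  assume S: "S \<noteq> 0"
  have "weight S z l = complex_of_real ((1 + Re (cnj (\<i> ^ l) * z) / S) / 4)" for l
  proof -
    have "cnj (\<i> ^ l) * z + \<i> ^ l * cnj z = complex_of_real (2 * Re (cnj (\<i> ^ l) * z))"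
      using complex_add_cnj[of "cnj (\<i> ^ l) * z"] by simp
    then have "weight S z l = (1/4) *\<^sub>R 1 + (1 / (8 * S)) *\<^sub>R complex_of_real (2 * Re (cnj (\<i> ^ l) * z))"
      unfolding weight_def scaleC_complex_def star_complex_def by (simp only:)
    also have "\<dots> = complex_of_real (1/4 + 1 / (8 * S) * (2 * Re (cnj (\<i> ^ l) * z)))"
      by (simp only: scaleR_conv_of_real of_real_add of_real_mult mult_1_right)
    also have "1/4 + 1 / (8 * S) * (2 * Re (cnj (\<i> ^ l) * z)) = (1 + Re (cnj (\<i> ^ l) * z) / S) / 4"
      using S by (simp add: field_simps)
    finally show ?thesis .
  qed
  then show ?thesis by (induction s) (simp_all add: bern_num_def)
qed

lemma bern_num_nonneg:
  assumes "cmod z \<le> S"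
  shows "0 \<le> bern_num S z s"
proof -
  have "0 \<le> (1 + Re (cnj (\<i> ^ l) * z) / S) / 4" for l
  proof -
    have "\<bar>Re (cnj (\<i> ^ l) * z)\<bar> \<le> cmod (cnj (\<i> ^ l) * z)" by (rule abs_Re_le_cmod)
    also have "\<dots> \<le> S" using assms by (simp add: norm_mult norm_power)
    finally have "\<bar>Re (cnj (\<i> ^ l) * z) / S\<bar> \<le> 1"
      by (cases "S = 0") (auto simp: abs_divide divide_le_eq)
    then have "-1 \<le> Re (cnj (\<i> ^ l) * z) / S" by (simp only: abs_le_iff) linarith
    then show ?thesis by simp
  qed
  then show ?thesis unfolding bern_num_def by (induction s) auto
qed

lemma sum_bern_num: "S \<noteq> 0 \<Longrightarrow> (\<Sum>s\<in>words n. bern_num S z s) = 1"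
  using sum_bern[where S = S and a = z and n = n] by (simp add: bern_num_complex flip: of_real_sum)

text \<open>The variance of the sample mean at a point \<open>z\<close>; Chebyshev's inequality follows.\<close>

lemma sum_dist_bern_num:
  assumes "S \<noteq> 0" "n > 0"
  shows "(\<Sum>s\<in>words n. (cmod (z - position S s))\<^sup>2 * bern_num S z s) = (4 * S\<^sup>2 - (cmod z)\<^sup>2) / n"
proof -
  let ?P = "position S" and ?b = "bern_num S z"
  have m1: "(\<Sum>s\<in>words n. ?P s * ?b s) = z"
    using sum_position_bern[OF assms, of z] by (simp add: bern_num_complex assms scaleC_complex_def)
  have m1': "(\<Sum>s\<in>words n. cnj (?P s) * ?b s) = cnj z"
    using arg_cong[OF m1, of cnj] by simp
  have m2: "(\<Sum>s\<in>words n. (?P s * cnj (?P s)) * ?b s) = of_real (4 * S\<^sup>2 / n) + of_real (1 - 1/n) * (cnj z * z)"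
    using sum_norm_position_bern[OF assms, of z]
    by (simp add: bern_num_complex assms scaleC_complex_def star_complex_def mult.commute scaleR_conv_of_real)
  have m0: "(\<Sum>s\<in>words n. complex_of_real (?b s)) = 1"
    using sum_bern_num[OF assms(1), where n = n and z = z] by (simp flip: of_real_sum)
  have "complex_of_real (\<Sum>s\<in>words n. (cmod (z - ?P s))\<^sup>2 * ?b s) =
      (\<Sum>s\<in>words n. z * cnj z * ?b s - z * (cnj (?P s) * ?b s) - cnj z * (?P s * ?b s) + (?P s * cnj (?P s)) * ?b s)"
    unfolding of_real_sum
    by (intro sum.cong refl) (simp only: of_real_mult of_real_norm_diff_square, simp only: algebra_simps)
  also have "\<dots> = z * cnj z * 1 - z * cnj z - cnj z * z +
     (of_real (4 * S\<^sup>2 / n) + of_real (1 - 1/n) * (cnj z * z))"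
    unfolding sum.distrib sum_subtractf sum_distrib_left[symmetric] m0 m1 m1' m2 ..
  also have "\<dots> = complex_of_real ((4 * S\<^sup>2 - (cmod z)\<^sup>2) / n)"
    using assms complex_norm_square[of z] by (simp add: field_simps)
  finally show ?thesis by (simp only: of_real_eq_iff)
qed

lemma sum_far_bern_num:
  assumes "cmod z \<le> S" "S > 0" "n > 0" "r > 0" "I \<subseteq> words n"
    "\<And>s. s \<in> I \<Longrightarrow> r \<le> cmod (z - position S s)"
  shows "(\<Sum>s\<in>I. bern_num S z s) \<le> 4 * S\<^sup>2 / (n * r\<^sup>2)"
proof -
  have "r\<^sup>2 * (\<Sum>s\<in>I. bern_num S z s) \<le> (\<Sum>s\<in>I. (cmod (z - position S s))\<^sup>2 * bern_num S z s)"
    unfolding sum_distrib_left using assms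
    by (intro sum_mono mult_right_mono power_mono bern_num_nonneg) auto
  also have "\<dots> \<le> (\<Sum>s\<in>words n. (cmod (z - position S s))\<^sup>2 * bern_num S z s)"
    using assms bern_num_nonneg by (intro sum_mono2) auto
  also have "\<dots> \<le> 4 * S\<^sup>2 / n"
    using assms by (simp add: sum_dist_bern_num divide_right_mono)
  finally show ?thesis using assms by (simp add: field_simps)
qed

section \<open>Functional calculus on a disc around the spectrum\<close>

text \<open>The expectation of \<open>g\<close> at the sample mean of \<open>n\<close> letters, with \<open>a\<close> in place of the point.\<close>

definition bernstein :: "real \<Rightarrow> 'a::unital_cstar_algebra \<Rightarrow> nat \<Rightarrow> (complex \<Rightarrow> complex) \<Rightarrow> 'a" where
  "bernstein S a n g = (\<Sum>s\<in>words n. g (position S s) *\<^sub>C bern S a s)"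

locale normal_in_ball =
  fixes a :: "'a::unital_cstar_algebra" and S :: real
  assumes normal: "star a * a = a * star a" and norm_less: "norm a < S"
begin

lemma S_pos: "0 < S"
  using norm_less norm_ge_zero[of a] by linarith

text \<open>Each weight is \<open>(1 - y)/4\<close> with \<open>y\<close> self-adjoint of norm below 1, hence a square; so is every
  product of weights.\<close>

lemma bern_eq_square:
  obtains d where "\<And>s. star (d s) = d s" "\<And>s. d s * d s = bern S a s"
    "\<And>s t. d s * d t = d t * d s"
proof -
  have "\<exists>c. star c = c \<and> c * c = weight S a l \<and>
      (\<forall>z. z * a = a * z \<longrightarrow> z * star a = star a * z \<longrightarrow> z * c = c * z)" for l
  proof -
    define y where "y = - ((1 / (2 * S)) *\<^sub>R (cnj (\<i> ^ l) *\<^sub>C a + \<i> ^ l *\<^sub>C star a))"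
    have "star y = y" unfolding y_def
      by (simp add: star_minus star_add star_scaleR star_scaleC star_star add.commute)
    moreover have "norm y < 1"
    proof -
      have "norm (cnj (\<i> ^ l) *\<^sub>C a + \<i> ^ l *\<^sub>C star a) \<le> norm a + norm a"
        by (rule order_trans[OF norm_triangle_ineq]) (simp add: norm_scaleC norm_power)
      then have "norm (cnj (\<i> ^ l) *\<^sub>C a + \<i> ^ l *\<^sub>C star a) < 2 * S" using norm_less by linarith
      then show ?thesis using S_pos by (simp add: y_def)
    qed
    ultimately obtain p where p: "star p = p" "p * p = 1 - y" "\<And>z. z * y = y * z \<Longrightarrow> z * p = p * z"
      using sqrt_one_minus by metis
    have "((1/2) *\<^sub>R p) * ((1/2) *\<^sub>R p) = (1/4) *\<^sub>R (1 - y)"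
      by (simp add: p(2))
    also have "\<dots> = weight S a l"
    proof -
      have "1 / (8 * S) = (1/4) * (1 / (2 * S))" by simp
      then show ?thesis
        unfolding weight_def y_def diff_minus_eq_add scaleR_add_right scaleR_scaleR by simp
    qed
    finally have "((1/2) *\<^sub>R p) * ((1/2) *\<^sub>R p) = weight S a l" .
    moreover have "z * ((1/2) *\<^sub>R p) = ((1/2) *\<^sub>R p) * z" if "z * a = a * z" "z * star a = star a * z" for z
    proof -
      have "z * y = y * z"
        using that by (simp add: y_def algebra_simps mult_scaleC_left mult_scaleC_right)
      then show ?thesis by (simp add: p(3))
    qed
    ultimately show ?thesis using p(1) by (intro exI[of _ "(1/2) *\<^sub>R p"]) (simp add: star_scaleR)
  qed
  then obtain c where c: "\<And>l. star (c l) = c l" "\<And>l. c l * c l = weight S a l"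
    "\<And>l z. z * a = a * z \<Longrightarrow> z * star a = star a * z \<Longrightarrow> z * c l = c l * z" by metis
  have cc: "c l * c k = c k * c l" for l k
    by (rule c(3)) (use c(3)[of a l] c(3)[of "star a" l] normal in auto)
  define d where "d s = prod_list (map c s)" for s
  have cd: "c l * d s = d s * c l" for l s
    by (induction s) (simp add: d_def, simp add: d_def, metis cc mult.assoc)
  show thesis
  proof
    show "star (d s) = d s" for s
      by (induction s) (use cd in \<open>simp_all add: d_def star_mult c\<close>)
    show "d s * d s = bern S a s" for s
    proof (induction s)
      case (Cons l s)
      have "d (l # s) * d (l # s) = (c l * c l) * (d s * d s)"
        using cd[of l s] by (simp add: d_def) (metis mult.assoc)
      then show ?case by (simp add: Cons c(2))
    qed (simp add: d_def)
    show "d s * d t = d t * d s" for s t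
    proof (induction s)
      case (Cons l s)
      then show ?case using cd[of l t] by (simp add: d_def) (metis mult.assoc)
    qed (simp add: d_def)
  qed
qed

text \<open>The coefficients may be replaced by the bounds \<open>e + r \<bar>w\<^sub>s - w\<^sub>t\<bar>\<^sup>2\<close>, whose quadratic term has the
  small mean computed above.\<close>

lemma norm_bern_sum2_mono:
  assumes "\<And>s t. s \<in> words n \<Longrightarrow> t \<in> words m \<Longrightarrow> cmod (k s t) \<le> e + r * (cmod (position S s - position S t))\<^sup>2"
    and "n > 0" "m > 0" "0 \<le> e" "0 \<le> r"
  shows "norm (\<Sum>s\<in>words n. \<Sum>t\<in>words m. k s t *\<^sub>C (bern S a s * bern S a t))
    \<le> e + r * (5 * S\<^sup>2 * (1/n + 1/m))"
proof -
  obtain d where d: "\<And>s. star (d s) = d s" "\<And>s. d s * d s = bern S a s"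
    "\<And>s t. d s * d t = d t * d s" using bern_eq_square by blast
  define D where "D p = d (fst p) * d (snd p)" for p
  have DD: "D p * D p = bern S a (fst p) * bern S a (snd p)" for p
    using d(3)[of "snd p" "fst p"] unfolding D_def d(2)[symmetric] by (metis mult.assoc)
  have lc: "d s * (d t * x) = d t * (d s * x)" for s t x
    by (metis d(3) mult.assoc)
  have Dc: "D p * D q = D q * D p" for p q
    unfolding D_def by (simp add: mult.assoc d(3) lc)
  let ?m = "\<lambda>p. e + r * (cmod (position S (fst p) - position S (snd p)))\<^sup>2"
  have "norm (\<Sum>s\<in>words n. \<Sum>t\<in>words m. k s t *\<^sub>C (bern S a s * bern S a t)) =
      norm (\<Sum>p\<in>words n \<times> words m. k (fst p) (snd p) *\<^sub>C (D p * D p))"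
    by (simp add: sum.cartesian_product DD case_prod_unfold)
  also have "\<dots> \<le> norm (\<Sum>p\<in>words n \<times> words m. ?m p *\<^sub>R (D p * D p))"
    by (rule norm_sum_squares_mono) (use assms in \<open>auto simp: Dc\<close>, simp add: D_def star_mult d)
  also have "(\<Sum>p\<in>words n \<times> words m. ?m p *\<^sub>R (D p * D p)) =
     (\<Sum>s\<in>words n. \<Sum>t\<in>words m. e *\<^sub>R (bern S a s * bern S a t)) +
     r *\<^sub>R (\<Sum>s\<in>words n. \<Sum>t\<in>words m. (cmod (position S s - position S t))\<^sup>2 *\<^sub>R (bern S a s * bern S a t))"
    unfolding DD scaleR_sum_right sum.distrib[symmetric]
    by (simp add: sum.cartesian_product case_prod_unfold scaleR_add_left)
  also have "\<dots> = e *\<^sub>R 1 + r *\<^sub>R ((1/n + 1/m) *\<^sub>R ((4 * S\<^sup>2) *\<^sub>R 1 - star a * a))"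
    using S_pos assms by (subst sum_dist_bern) (auto simp: normal sum_bern
        simp flip: scaleR_sum_right sum_distrib_left sum_distrib_right)
  also have "norm \<dots> \<le> e + r * (5 * S\<^sup>2 * (1/n + 1/m))"
  proof -
    have 1: "norm (c *\<^sub>R (1::'a)) \<le> c" if "0 \<le> c" for c
      using that norm_one_le[where 'a = 'a] by (simp add: mult_left_le)
    have "norm (star a * a) \<le> S\<^sup>2"
      using norm_less by (simp add: cstar_identity power_mono)
    then have "norm ((4 * S\<^sup>2) *\<^sub>R 1 - star a * a) \<le> 5 * S\<^sup>2"
      using 1[of "4 * S\<^sup>2"] norm_triangle_ineq4[of "(4 * S\<^sup>2) *\<^sub>R 1" "star a * a"] by simp
    then have "(1/n + 1/m) * norm ((4 * S\<^sup>2) *\<^sub>R 1 - star a * a) \<le> 5 * S\<^sup>2 * (1/n + 1/m)"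
      by (subst mult.commute) (intro mult_right_mono, auto)
    then have "norm (r *\<^sub>R ((1/n + 1/m) *\<^sub>R ((4 * S\<^sup>2) *\<^sub>R 1 - star a * a))) \<le> r * (5 * S\<^sup>2 * (1/n + 1/m))"
      using mult_left_mono[OF _ assms(5)] assms by (simp add: abs_of_nonneg mult.assoc)
    then show ?thesis using 1[OF assms(4)] by (intro norm_triangle_mono)
  qed
  finally show ?thesis .
qed

lemma norm_bernstein_le:
  assumes "\<And>z. z \<in> cball 0 (2 * S) \<Longrightarrow> cmod (g z) \<le> M"
  shows "norm (bernstein S a n g) \<le> M"
proof -
  obtain d where d: "\<And>s. star (d s) = d s" "\<And>s. d s * d s = bern S a s"
    "\<And>s t. d s * d t = d t * d s" using bern_eq_square by blast
  have M: "0 \<le> M" using assms[of 0] S_pos by (auto intro: order_trans[OF norm_ge_zero])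
  have "norm (bernstein S a n g) \<le> norm (\<Sum>s\<in>words n. M *\<^sub>R (d s * d s))"
    unfolding bernstein_def d(2)[symmetric]
    by (rule norm_sum_squares_mono) (use d S_pos in \<open>auto intro!: assms position_in_cball[of S, simplified]\<close>)
  also have "\<dots> = M * norm (1::'a)"
    using M by (simp add: d(2) sum_bern flip: scaleR_sum_right)
  also have "\<dots> \<le> M" using M norm_one_le[where 'a='a] by (simp add: mult_left_le)
  finally show ?thesis .
qed

text \<open>The sample points concentrate, so the Bernstein operator is nearly multiplicative: the defect
  is a combination of the \<open>b\<^sub>s b\<^sub>t\<close> with coefficients \<open>g(w\<^sub>s) (h(w\<^sub>s) - h(w\<^sub>t))\<close>.\<close>

lemma norm_bernstein_mult_diff_le:
  assumes "\<And>z. z \<in> cball 0 (2 * S) \<Longrightarrow> cmod (g z) \<le> G"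
    and "\<And>u v. u \<in> cball 0 (2 * S) \<Longrightarrow> v \<in> cball 0 (2 * S) \<Longrightarrow> cmod (h u - h v) \<le> e + r * (cmod (u - v))\<^sup>2"
    and "n > 0" "m > 0" "0 \<le> e" "0 \<le> r"
  shows "norm (bernstein S a n (\<lambda>z. g z * h z) - bernstein S a n g * bernstein S a m h)
    \<le> G * (e + r * (5 * S\<^sup>2 * (1/n + 1/m)))"
proof -
  let ?b = "bern S a" and ?P = "position S"
  have P: "?P s \<in> cball 0 (2 * S)" for s using position_in_cball S_pos by simp
  have G: "0 \<le> G" using assms(1)[OF P[of "[]"]] by (auto intro: order_trans[OF norm_ge_zero])
  have "bernstein S a n (\<lambda>z. g z * h z) = bernstein S a n (\<lambda>z. g z * h z) * (\<Sum>t\<in>words m. 1 *\<^sub>C ?b t)"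
    by (simp add: sum_bern)
  then have "bernstein S a n (\<lambda>z. g z * h z) - bernstein S a n g * bernstein S a m h =
      (\<Sum>s\<in>words n. \<Sum>t\<in>words m. (g (?P s) * h (?P s) * 1) *\<^sub>C (?b s * ?b t)) -
      (\<Sum>s\<in>words n. \<Sum>t\<in>words m. (g (?P s) * h (?P t)) *\<^sub>C (?b s * ?b t))"
    unfolding bernstein_def sum_product
    by (simp add: mult_scaleC_left mult_scaleC_right scaleC_scaleC mult.commute)
  also have "\<dots> = (\<Sum>s\<in>words n. \<Sum>t\<in>words m. (g (?P s) * (h (?P s) - h (?P t))) *\<^sub>C (?b s * ?b t))"
    by (simp add: sum_subtractf right_diff_distrib scaleC_diff_left)
  also have "norm \<dots> \<le> G * e + (G * r) * (5 * S\<^sup>2 * (1/n + 1/m))"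
  proof (rule norm_bern_sum2_mono)
    fix s t
    have "cmod (g (?P s)) * cmod (h (?P s) - h (?P t)) \<le> G * (e + r * (cmod (?P s - ?P t))\<^sup>2)"
      by (intro mult_mono assms P G) simp
    then show "cmod (g (?P s) * (h (?P s) - h (?P t))) \<le> G * e + G * r * (cmod (?P s - ?P t))\<^sup>2"
      unfolding norm_mult by (simp add: distrib_left mult.assoc)
  qed (use assms G in auto)
  also have "\<dots> = G * (e + r * (5 * S\<^sup>2 * (1/n + 1/m)))" by (simp add: algebra_simps)
  finally show ?thesis .
qed

end

lemma norm_power_mult_le: "norm (y ^ n * x) \<le> norm y ^ n * norm (x::'a::unital_cstar_algebra)"
proof (induction n)
  case (Suc n)
  have "norm (y ^ Suc n * x) \<le> norm y * norm (y ^ n * x)"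
    using norm_mult_ineq[of y "y ^ n * x"] by (simp add: mult.assoc)
  also have "\<dots> \<le> norm y * (norm y ^ n * norm x)" by (intro mult_left_mono Suc) simp
  finally show ?case by (simp add: mult.assoc)
qed simp

text \<open>Where \<open>\<bar>u - v\<bar>\<close> is at least the modulus \<open>d\<close> of uniform continuity, \<open>\<bar>u - v\<bar>\<^sup>2 / d\<^sup>2 \<ge> 1\<close> and the bound
  \<open>2 H\<close> on differences of values is absorbed by the quadratic term.\<close>

lemma uniformly_continuous_quadratic_modulus:
  fixes h :: "complex \<Rightarrow> complex"
  assumes "compact D" "continuous_on D h" "0 < e"
  obtains r where "0 \<le> r" "\<And>u v. u \<in> D \<Longrightarrow> v \<in> D \<Longrightarrow> cmod (h u - h v) \<le> e + r * (cmod (u - v))\<^sup>2"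
proof -
  obtain d where d: "0 < d" "\<And>u v. u \<in> D \<Longrightarrow> v \<in> D \<Longrightarrow> dist u v < d \<Longrightarrow> dist (h u) (h v) < e"
    using compact_uniformly_continuous[OF assms(2,1)] assms(3)
    unfolding uniformly_continuous_on_def by metis
  obtain H where H: "0 < H" "\<And>u. u \<in> D \<Longrightarrow> cmod (h u) \<le> H"
    using compact_imp_bounded[OF compact_continuous_image[OF assms(2,1)]]
    unfolding bounded_pos by auto
  show thesis
  proof
    show "0 \<le> 2 * H / d\<^sup>2" using H by simp
    fix u v assume uv: "u \<in> D" "v \<in> D"
    show "cmod (h u - h v) \<le> e + 2 * H / d\<^sup>2 * (cmod (u - v))\<^sup>2"
    proof (cases "cmod (u - v) < d")
      case True
      then have "cmod (h u - h v) \<le> e" using d(2)[OF uv] by (simp add: dist_norm less_imp_le)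
      then show ?thesis using H by (simp add: add_increasing2)
    next
      case False
      then have "1 \<le> (cmod (u - v))\<^sup>2 / d\<^sup>2" using d by (simp add: power_mono)
      then have "2 * H * 1 \<le> 2 * H * ((cmod (u - v))\<^sup>2 / d\<^sup>2)" using H by (intro mult_left_mono) auto
      moreover have "cmod (h u - h v) \<le> 2 * H"
        using norm_triangle_ineq4[of "h u" "h v"] H(2)[OF uv(1)] H(2)[OF uv(2)] by linarith
      ultimately show ?thesis using assms(3) by simp
    qed
  qed
qed

context normal_in_ball
begin

text \<open>The two sample sizes are independent here: equal sizes give multiplicativity of the limit, and
  \<open>g = 1\<close> gives the Cauchy property.\<close>

lemma bernstein_mult_limit:
  assumes g: "continuous_on (cball 0 (2 * S)) g" and h: "continuous_on (cball 0 (2 * S)) h" and "0 < e"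
  obtains N where "\<And>n m. n \<ge> N \<Longrightarrow> m \<ge> N \<Longrightarrow>
    norm (bernstein S a n (\<lambda>z. g z * h z) - bernstein S a n g * bernstein S a m h) < e"
proof -
  obtain G where G: "0 < G" "\<And>u. u \<in> cball 0 (2 * S) \<Longrightarrow> cmod (g u) \<le> G"
    using compact_imp_bounded[OF compact_continuous_image[OF g compact_cball]]
    unfolding bounded_pos by auto
  have "0 < e / (2 * G)" using G assms by simp
  then obtain r where r: "0 \<le> r" "\<And>u v. u \<in> cball 0 (2 * S) \<Longrightarrow> v \<in> cball 0 (2 * S) \<Longrightarrow>
      cmod (h u - h v) \<le> e / (2 * G) + r * (cmod (u - v))\<^sup>2"
    using uniformly_continuous_quadratic_modulus[OF compact_cball h] by metis
  obtain N where N: "real N > 40 * G * r * S\<^sup>2 / e" using reals_Archimedean2 by blast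
  show thesis
  proof (rule that[of "Suc N"])
    fix n m assume nm: "n \<ge> Suc N" "m \<ge> Suc N"
    have inv: "1 / real k \<le> 1 / real (Suc N)" if "k \<ge> Suc N" for k
      using that by (intro divide_left_mono) auto
    have "40 * G * r * S\<^sup>2 < e * real (Suc N)" using N assms(3) by (simp add: field_simps)
    then have N': "G * (r * (5 * S\<^sup>2 * (2 / real (Suc N)))) \<le> e / 4" by (simp add: field_simps)
    have "norm (bernstein S a n (\<lambda>z. g z * h z) - bernstein S a n g * bernstein S a m h)
        \<le> G * (e / (2 * G) + r * (5 * S\<^sup>2 * (1/n + 1/m)))"
      by (rule norm_bernstein_mult_diff_le) (use G r nm assms in auto)
    also have "\<dots> \<le> G * (e / (2 * G) + r * (5 * S\<^sup>2 * (2 / real (Suc N))))"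
      using inv[OF nm(1)] inv[OF nm(2)] G r by (intro mult_left_mono add_left_mono) auto
    also have "\<dots> < e" using N' G assms(3) by (simp add: distrib_left del: of_nat_Suc)
    finally show "norm (bernstein S a n (\<lambda>z. g z * h z) - bernstein S a n g * bernstein S a m h) < e" .
  qed
qed

lemma bernstein_one: "bernstein S a n (\<lambda>z. 1) = 1"
  by (simp add: bernstein_def sum_bern)

lemma bernstein_id: "n > 0 \<Longrightarrow> bernstein S a n (\<lambda>z. z) = a"
  using S_pos by (simp add: bernstein_def sum_position_bern)

definition disc_calculus :: "(complex \<Rightarrow> complex) \<Rightarrow> 'a" where
  "disc_calculus g = lim (\<lambda>n. bernstein S a n g)"

lemma bernstein_tendsto:
  assumes g: "continuous_on (cball 0 (2 * S)) g"
  shows "(\<lambda>n. bernstein S a n g) \<longlonglongrightarrow> disc_calculus g"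
proof -
  have "Cauchy (\<lambda>n. bernstein S a n g)"
  proof (rule metric_CauchyI)
    fix e :: real assume "0 < e"
    then obtain N where N: "\<And>n m. n \<ge> N \<Longrightarrow> m \<ge> N \<Longrightarrow>
        norm (bernstein S a n (\<lambda>z. 1 * g z) - bernstein S a n (\<lambda>z. 1) * bernstein S a m g) < e"
      using bernstein_mult_limit[OF continuous_on_const g] by metis
    then show "\<exists>N. \<forall>n\<ge>N. \<forall>m\<ge>N. dist (bernstein S a n g) (bernstein S a m g) < e"
      by (intro exI[of _ N]) (auto simp: dist_norm bernstein_one)
  qed
  then show ?thesis
    unfolding disc_calculus_def by (simp add: Cauchy_convergent_iff convergent_LIMSEQ_iff)
qed

lemma disc_calculus_eqI:
  "(\<lambda>n. bernstein S a n g) \<longlonglongrightarrow> x \<Longrightarrow> disc_calculus g = x"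
  unfolding disc_calculus_def by (rule limI)

lemma disc_calculus_add:
  assumes "continuous_on (cball 0 (2 * S)) g" "continuous_on (cball 0 (2 * S)) h"
  shows "disc_calculus (\<lambda>z. g z + h z) = disc_calculus g + disc_calculus h"
  using tendsto_add[OF bernstein_tendsto[OF assms(1)] bernstein_tendsto[OF assms(2)]]
  by (intro disc_calculus_eqI) (simp add: bernstein_def scaleC_add_left sum.distrib)

lemma disc_calculus_scaleC:
  assumes "continuous_on (cball 0 (2 * S)) g"
  shows "disc_calculus (\<lambda>z. c * g z) = c *\<^sub>C disc_calculus g"
  using bounded_linear.tendsto[OF bounded_linear_scaleC[of c] bernstein_tendsto[OF assms(1)]]
  by (intro disc_calculus_eqI) (simp add: bernstein_def scaleC_sum_right scaleC_scaleC)

lemma disc_calculus_cnj: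
  assumes "continuous_on (cball 0 (2 * S)) g"
  shows "disc_calculus (\<lambda>z. cnj (g z)) = star (disc_calculus g)"
  using tendsto_star[OF bernstein_tendsto[OF assms(1)]]
  by (intro disc_calculus_eqI) (simp add: bernstein_def star_sum star_scaleC star_bern normal)

lemma disc_calculus_mult:
  assumes g: "continuous_on (cball 0 (2 * S)) g" and h: "continuous_on (cball 0 (2 * S)) h"
  shows "disc_calculus (\<lambda>z. g z * h z) = disc_calculus g * disc_calculus h"
proof (rule disc_calculus_eqI)
  have "(\<lambda>n. bernstein S a n (\<lambda>z. g z * h z) - bernstein S a n g * bernstein S a n h) \<longlonglongrightarrow> 0"
  proof (rule LIMSEQ_I)
    fix e :: real assume "0 < e"
    then obtain N where "\<And>n m. n \<ge> N \<Longrightarrow> m \<ge> N \<Longrightarrow>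
        norm (bernstein S a n (\<lambda>z. g z * h z) - bernstein S a n g * bernstein S a m h) < e"
      using bernstein_mult_limit[OF g h] by metis
    then show "\<exists>N. \<forall>n\<ge>N. norm (bernstein S a n (\<lambda>z. g z * h z)
        - bernstein S a n g * bernstein S a n h - 0) < e" by auto
  qed
  from tendsto_add[OF this tendsto_mult[OF bernstein_tendsto[OF g] bernstein_tendsto[OF h]]]
  show "(\<lambda>n. bernstein S a n (\<lambda>z. g z * h z)) \<longlonglongrightarrow> disc_calculus g * disc_calculus h" by simp
qed

lemma disc_calculus_one: "disc_calculus (\<lambda>z. 1) = 1"
  by (rule disc_calculus_eqI) (simp add: bernstein_one)

lemma disc_calculus_id: "disc_calculus (\<lambda>z. z) = a"
proof (rule disc_calculus_eqI)
  have "eventually (\<lambda>n. a = bernstein S a n (\<lambda>z. z)) sequentially"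
    using eventually_gt_at_top[of 0] by eventually_elim (simp add: bernstein_id)
  then show "(\<lambda>n. bernstein S a n (\<lambda>z. z)) \<longlonglongrightarrow> a"
    by (rule Lim_transform_eventually[OF tendsto_const])
qed

lemma norm_disc_calculus_le:
  assumes "continuous_on (cball 0 (2 * S)) g" "\<And>z. z \<in> cball 0 (2 * S) \<Longrightarrow> cmod (g z) \<le> M"
  shows "norm (disc_calculus g) \<le> M"
  by (rule Lim_norm_ubound[OF sequentially_bot bernstein_tendsto[OF assms(1)]])
    (intro always_eventually allI norm_bernstein_le assms(2))

text \<open>If \<open>g\<close> is supported in the disc of radius \<open>d\<close> around \<open>w\<close>, then the image of \<open>(z - w)\<^sup>n g\<close> has
  norm at most \<open>d\<^sup>n sup \<bar>g\<bar>\<close>. With the inverse \<open>y\<close> of \<open>a - w\<close>, the image of \<open>g\<close> is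
  \<open>y\<^sup>n\<close> times that, which tends to \<open>0\<close> when \<open>d norm y < 1\<close>.\<close>

lemma disc_calculus_eq_0_near_resolvent:
  assumes "w \<notin> spectrum a"
  obtains d where "0 < d" "\<And>g. continuous_on (cball 0 (2 * S)) g \<Longrightarrow> (\<And>z. d \<le> dist w z \<Longrightarrow> g z = 0) \<Longrightarrow>
    disc_calculus g = 0"
proof -
  obtain y where y: "y * (a - w *\<^sub>C 1) = 1"
    using assms by (auto simp: spectrum_def invertible_element_def)
  define d where "d = 1 / (2 * (norm y + 1))"
  have d: "0 < d" "norm y * d \<le> 1/2"
    using norm_ge_zero[of y] by (auto simp: d_def divide_le_eq add_nonneg_pos)
  show thesis
  proof (rule that[OF d(1)])
    fix g :: "complex \<Rightarrow> complex"
    assume g: "continuous_on (cball 0 (2 * S)) g" "\<And>z. d \<le> dist w z \<Longrightarrow> g z = 0"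
    obtain G where G: "0 < G" "\<And>u. u \<in> cball 0 (2 * S) \<Longrightarrow> cmod (g u) \<le> G"
      using compact_imp_bounded[OF compact_continuous_image[OF g(1) compact_cball]]
      unfolding bounded_pos by auto
    have "norm (disc_calculus g) \<le> (1/2) ^ n * G" for n
    proof -
      define q where "q z = (z - w) ^ n * g z" for z
      have cq: "continuous_on (cball 0 (2 * S)) (\<lambda>z. (z - w) ^ k * g z)" for k
        by (intro continuous_intros g)
      have "disc_calculus (\<lambda>z. (z - w) ^ n * g z) = (a - w *\<^sub>C 1) ^ n * disc_calculus g" for n
      proof (induction n)
        case (Suc k)
        have "disc_calculus (\<lambda>z. z + (- w) * 1) = a + (- w) *\<^sub>C 1"
          by (subst disc_calculus_add disc_calculus_scaleC; (intro continuous_intros)?)+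
            (simp add: disc_calculus_id disc_calculus_one)
        then have s: "disc_calculus (\<lambda>z. z - w) = a - w *\<^sub>C 1" by (simp add: scaleC_minus_left)
        have "disc_calculus (\<lambda>z. (z - w) * ((z - w) ^ k * g z)) = (a - w *\<^sub>C 1) * ((a - w *\<^sub>C 1) ^ k * disc_calculus g)"
          by (subst disc_calculus_mult) (use cq in \<open>auto intro!: continuous_intros simp: s Suc\<close>)
        then show ?case by (simp add: mult.assoc)
      qed simp
      moreover have "y ^ n * ((a - w *\<^sub>C 1) ^ n * x) = x" for x n
      proof (induction n)
        case (Suc n)
        have "y ^ Suc n * ((a - w *\<^sub>C 1) ^ Suc n * x) = y ^ n * ((y * (a - w *\<^sub>C 1)) * ((a - w *\<^sub>C 1) ^ n * x))"
          by (simp only: power_Suc2[of y] power_Suc[of "a - w *\<^sub>C 1"] mult.assoc)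
        then show ?case using Suc y by simp
      qed simp
      ultimately have "norm (disc_calculus g) = norm (y ^ n * disc_calculus (\<lambda>z. (z - w) ^ n * g z))"
        by metis
      also have "\<dots> \<le> norm y ^ n * norm (disc_calculus (\<lambda>z. (z - w) ^ n * g z))"
        by (rule norm_power_mult_le)
      also have "\<dots> \<le> norm y ^ n * (d ^ n * G)"
      proof (intro mult_left_mono norm_disc_calculus_le cq)
        fix z :: complex assume z: "z \<in> cball 0 (2 * S)"
        show "cmod ((z - w) ^ n * g z) \<le> d ^ n * G"
        proof (cases "d \<le> dist w z")
          case True
          then show ?thesis using g(2) d(1) G(1) by simp
        next
          case False
          then show ?thesis using G(2)[OF z] d(1) G(1)
            by (simp add: norm_mult norm_power dist_norm norm_minus_commute mult_mono power_mono)
        qed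
      qed simp
      also have "\<dots> = (norm y * d) ^ n * G" by (simp add: power_mult_distrib)
      also have "\<dots> \<le> (1/2) ^ n * G" using d G by (intro mult_right_mono power_mono) auto
      finally show ?thesis .
    qed
    moreover have "(\<lambda>n. (1/2) ^ n * G) \<longlonglongrightarrow> 0 * G" by (intro tendsto_intros LIMSEQ_realpow_zero) auto
    ultimately have "norm (disc_calculus g) \<le> 0"
      by (intro LIMSEQ_le_const) auto
    then show "disc_calculus g = 0" by simp
  qed
qed

text \<open>Let \<open>\<theta>\<close> be a finite sum of bumps outside the spectrum that the calculus annihilates, with
  \<open>\<theta> \<ge> c > 0\<close> on the compact set \<open>\<bar>g\<bar> \<ge> e\<close>. Subtracting from \<open>g\<close> its multiple \<open>g \<theta> / max c \<theta>\<close> leaves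
  the image unchanged and brings the function below \<open>e\<close> everywhere.\<close>

lemma disc_calculus_eq_0:
  assumes g: "continuous_on (cball 0 (2 * S)) g" and z: "\<And>z. z \<in> spectrum a \<Longrightarrow> g z = 0"
  shows "disc_calculus g = 0"
proof -
  have "norm (disc_calculus g) \<le> e" if e: "0 < e" for e
  proof -
    define K where "K = {z \<in> cball 0 (2 * S). e \<le> cmod (g z)}"
    have "closed K" unfolding K_def
      using continuous_closed_preimage[OF continuous_on_norm[OF g] closed_cball, of "{e..}"]
      by (simp add: vimage_def Int_def)
    then have K: "compact K"
      by (rule compact_eq_bounded_closed[THEN iffD2, OF conjI, rotated])
        (rule bounded_subset[OF bounded_cball[of 0 "2 * S"]], auto simp: K_def)
    have "\<exists>d. 0 < d \<and> (\<forall>g. continuous_on (cball 0 (2 * S)) g \<longrightarrow> (\<forall>z. d \<le> dist w z \<longrightarrow> g z = 0) \<longrightarrow>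
        disc_calculus g = 0)" if "w \<in> K" for w
    proof -
      have "w \<notin> spectrum a" using that z e by (force simp: K_def)
      then show ?thesis using disc_calculus_eq_0_near_resolvent by metis
    qed
    then obtain d where d: "\<And>w. w \<in> K \<Longrightarrow> 0 < d w"
      "\<And>w g. w \<in> K \<Longrightarrow> continuous_on (cball 0 (2 * S)) g \<Longrightarrow> (\<And>z. d w \<le> dist w z \<Longrightarrow> g z = 0) \<Longrightarrow>
        disc_calculus g = 0" by metis
    obtain W where W: "W \<subseteq> K" "finite W" "K \<subseteq> (\<Union>w\<in>W. ball w (d w))"
    proof (rule compactE_image[OF K, of K "\<lambda>w. ball w (d w)"])
      show "K \<subseteq> (\<Union>w\<in>K. ball w (d w))" using d(1) by force
    qed auto
    define \<theta> where "\<theta> z = (\<Sum>w\<in>W. max 0 (d w - dist w z))" for z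
    have c\<theta>: "continuous_on A \<theta>" for A unfolding \<theta>_def by (intro continuous_intros)
    have \<theta>0: "0 \<le> \<theta> z" for z unfolding \<theta>_def by (intro sum_nonneg) simp
    have \<theta>pos: "0 < \<theta> z" if "z \<in> K" for z
    proof -
      have "z \<in> (\<Union>w\<in>W. ball w (d w))" using W(3) that by blast
      then obtain w where "w \<in> W" "dist w z < d w" by auto
      then show ?thesis unfolding \<theta>_def using W by (intro sum_pos2[of _ w]) auto
    qed
    have D\<theta>: "disc_calculus (\<lambda>z. complex_of_real (\<theta> z)) = 0"
    proof -
      have "disc_calculus (\<lambda>z. complex_of_real (\<Sum>w\<in>V. max 0 (d w - dist w z))) = 0" if "V \<subseteq> W" for V
        using finite_subset[OF that W(2)] that
      proof (induction V)
        case empty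
        show ?case using disc_calculus_scaleC[of "\<lambda>_. 1" 0] by simp
      next
        case (insert w V)
        have "disc_calculus (\<lambda>z. complex_of_real (max 0 (d w - dist w z))) = 0"
          by (rule d(2)[of w]) (use insert W in \<open>auto intro!: continuous_intros\<close>)
        then show ?case using insert
          by (simp add: disc_calculus_add continuous_intros)
      qed
      then show ?thesis unfolding \<theta>_def by blast
    qed
    obtain c where c: "0 < c" "\<And>z. z \<in> K \<Longrightarrow> c \<le> \<theta> z"
    proof (cases "K = {}")
      case False
      then obtain z0 where "z0 \<in> K" "\<And>z. z \<in> K \<Longrightarrow> \<theta> z0 \<le> \<theta> z"
        using continuous_attains_inf[OF K _ c\<theta>] by blast
      then show ?thesis using that[of "\<theta> z0"] \<theta>pos by blast
    qed (use that[of 1] in auto)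
    define q where "q z = g z * of_real (1 / max c (\<theta> z))" for z
    have q: "continuous_on (cball 0 (2 * S)) q"
      unfolding q_def using c(1) by (intro continuous_intros g c\<theta>) (auto simp: max_def)
    have qt: "continuous_on (cball 0 (2 * S)) (\<lambda>z. q z * complex_of_real (\<theta> z))"
      by (intro continuous_intros q c\<theta>)
    have g': "continuous_on (cball 0 (2 * S)) (\<lambda>z. g z - q z * complex_of_real (\<theta> z))"
      by (intro continuous_intros g qt)
    have "disc_calculus g = disc_calculus (\<lambda>z. g z - q z * complex_of_real (\<theta> z))
        + disc_calculus (\<lambda>z. q z * complex_of_real (\<theta> z))"
      using disc_calculus_add[OF g' qt] by simp
    also have "disc_calculus (\<lambda>z. q z * complex_of_real (\<theta> z)) = 0"
      using disc_calculus_mult[OF q continuous_on_of_real[OF c\<theta>]] D\<theta> by simp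
    finally have "disc_calculus g = disc_calculus (\<lambda>z. g z - q z * complex_of_real (\<theta> z))" by simp
    moreover have "norm (disc_calculus (\<lambda>z. g z - q z * complex_of_real (\<theta> z))) \<le> e"
    proof (rule norm_disc_calculus_le[OF g'])
      fix z :: complex assume z: "z \<in> cball 0 (2 * S)"
      have "g z - q z * complex_of_real (\<theta> z) = g z * of_real (1 - \<theta> z / max c (\<theta> z))"
        by (simp add: q_def algebra_simps)
      then have eq: "cmod (g z - q z * complex_of_real (\<theta> z)) = cmod (g z) * \<bar>1 - \<theta> z / max c (\<theta> z)\<bar>"
        by (simp only: norm_mult norm_of_real)
      show "cmod (g z - q z * complex_of_real (\<theta> z)) \<le> e"
      proof (cases "z \<in> K")
        case True
        then have "max c (\<theta> z) = \<theta> z" "\<theta> z \<noteq> 0" using c by force+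
        then show ?thesis unfolding eq using e by simp
      next
        case False
        then have "cmod (g z) \<le> e" using z by (auto simp: K_def)
        moreover have "0 \<le> \<theta> z / max c (\<theta> z)" "\<theta> z / max c (\<theta> z) \<le> 1"
          using c \<theta>0[of z] by (auto simp: divide_le_eq max_def)
        ultimately show ?thesis unfolding eq using e mult_mono[of "cmod (g z)" e "\<bar>1 - \<theta> z / max c (\<theta> z)\<bar>" 1]
          by auto
      qed
    qed
    ultimately show ?thesis by simp
  qed
  then have "norm (disc_calculus g) \<le> 0" by (rule field_le_epsilon[of _ 0, simplified])
  then show ?thesis by simp
qed

lemma disc_calculus_cong:
  assumes g: "continuous_on (cball 0 (2 * S)) g" and h: "continuous_on (cball 0 (2 * S)) h"
    and "\<And>z. z \<in> spectrum a \<Longrightarrow> g z = h z"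
  shows "disc_calculus g = disc_calculus h"
proof -
  have "disc_calculus (\<lambda>z. g z + (-1) * h z) = 0"
    by (rule disc_calculus_eq_0) (use assms in \<open>auto intro!: continuous_intros\<close>)
  moreover have "disc_calculus (\<lambda>z. g z + (-1) * h z) = disc_calculus g + (-1) *\<^sub>C disc_calculus h"
    by (subst disc_calculus_add disc_calculus_scaleC; (intro continuous_intros g h)?)+ simp
  ultimately show ?thesis by (simp add: scaleC_minus_left)
qed

text \<open>A function on the spectrum is extended to the plane by Tietze's theorem; the choice of the
  extension is immaterial because the disc calculus only sees the values on the spectrum.\<close>

lemma ex_functional_calculus: "\<exists>\<Phi>. is_functional_calculus a \<Phi>"
proof -
  have "\<exists>g'. continuous_on UNIV g' \<and> (\<forall>z\<in>spectrum a. g' z = g z)"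
    if "continuous_on (spectrum a) g" for g :: "complex \<Rightarrow> complex"
    using Tietze_unbounded[OF that, of UNIV] closed_spectrum by (metis closed_closedin subtopology_UNIV)
  then obtain ext :: "(complex \<Rightarrow> complex) \<Rightarrow> complex \<Rightarrow> complex" where ext: "\<And>g. continuous_on (spectrum a) g \<Longrightarrow> continuous_on UNIV (ext g)"
    "\<And>g z. continuous_on (spectrum a) g \<Longrightarrow> z \<in> spectrum a \<Longrightarrow> ext g z = g z" by metis
  have ext': "continuous_on (cball 0 (2 * S)) (ext g)" if "continuous_on (spectrum a) g" for g
    using continuous_on_subset[OF ext(1)[OF that]] by blast
  have ext_eq: "disc_calculus (ext g) = disc_calculus G"
    if "continuous_on (spectrum a) g" "continuous_on (cball 0 (2 * S)) G" "\<And>z. z \<in> spectrum a \<Longrightarrow> G z = g z" for g G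
    by (rule disc_calculus_cong) (use ext' ext(2) that in auto)
  have "is_functional_calculus a (\<lambda>g. disc_calculus (ext g))"
    unfolding is_functional_calculus_def
  proof (intro conjI allI impI)
    fix g h :: "complex \<Rightarrow> complex"
    assume gh: "continuous_on (spectrum a) g" "continuous_on (spectrum a) h"
    have s: "continuous_on (spectrum a) (\<lambda>z. g z + h z)" "continuous_on (spectrum a) (\<lambda>z. g z * h z)"
      by (intro continuous_intros gh)+
    show "disc_calculus (ext (\<lambda>z. g z + h z)) = disc_calculus (ext g) + disc_calculus (ext h)"
      using ext_eq[OF s(1), of "\<lambda>z. ext g z + ext h z"]
        disc_calculus_add[OF ext'[OF gh(1)] ext'[OF gh(2)]]
      by (simp add: continuous_on_add ext' ext(2) gh)
    show "disc_calculus (ext (\<lambda>z. g z * h z)) = disc_calculus (ext g) * disc_calculus (ext h)"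
      using ext_eq[OF s(2), of "\<lambda>z. ext g z * ext h z"]
        disc_calculus_mult[OF ext'[OF gh(1)] ext'[OF gh(2)]]
      by (simp add: continuous_on_mult ext' ext(2) gh)
    assume "\<forall>z\<in>spectrum a. g z = h z"
    then show "disc_calculus (ext g) = disc_calculus (ext h)"
      using gh by (intro ext_eq ext') (simp_all add: ext(2))
  next
    fix c and g :: "complex \<Rightarrow> complex" assume g: "continuous_on (spectrum a) g"
    then have s: "continuous_on (spectrum a) (\<lambda>z. c * g z)" by (intro continuous_intros)
    show "disc_calculus (ext (\<lambda>z. c * g z)) = c *\<^sub>C disc_calculus (ext g)"
      using ext_eq[OF s, of "\<lambda>z. c * ext g z"] disc_calculus_scaleC[OF ext'[OF g], of c]
      by (simp add: continuous_on_mult continuous_on_const ext' ext(2) g)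
  next
    fix g :: "complex \<Rightarrow> complex" assume g: "continuous_on (spectrum a) g"
    then have s: "continuous_on (spectrum a) (\<lambda>z. cnj (g z))" by (intro continuous_intros)
    show "disc_calculus (ext (\<lambda>z. cnj (g z))) = star (disc_calculus (ext g))"
      using ext_eq[OF s, of "\<lambda>z. cnj (ext g z)"] disc_calculus_cnj[OF ext'[OF g]]
      by (simp add: continuous_on_cnj ext' ext(2) g)
  next
    show "disc_calculus (ext (\<lambda>z. 1)) = 1"
      using ext_eq[of "\<lambda>z. 1" "\<lambda>z. 1"] by (simp add: disc_calculus_one)
    show "disc_calculus (ext (\<lambda>z. z)) = a"
      using ext_eq[of "\<lambda>z. z" "\<lambda>z. z"] by (simp add: disc_calculus_id)
  qed
  then show ?thesis by blast
qed

end

section \<open>Properties of the functional calculus\<close>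

locale functional_calculus =
  fixes a :: "'a::unital_cstar_algebra" and \<Phi> :: "(complex \<Rightarrow> complex) \<Rightarrow> 'a"
  assumes calculus: "is_functional_calculus a \<Phi>"
begin

lemma \<Phi>_add: "continuous_on (spectrum a) g \<Longrightarrow> continuous_on (spectrum a) h \<Longrightarrow> \<Phi> (\<lambda>z. g z + h z) = \<Phi> g + \<Phi> h"
  and \<Phi>_mult: "continuous_on (spectrum a) g \<Longrightarrow> continuous_on (spectrum a) h \<Longrightarrow> \<Phi> (\<lambda>z. g z * h z) = \<Phi> g * \<Phi> h"
  and \<Phi>_scale: "continuous_on (spectrum a) g \<Longrightarrow> \<Phi> (\<lambda>z. c * g z) = c *\<^sub>C \<Phi> g"
  and \<Phi>_cnj: "continuous_on (spectrum a) g \<Longrightarrow> \<Phi> (\<lambda>z. cnj (g z)) = star (\<Phi> g)"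
  and \<Phi>_one: "\<Phi> (\<lambda>z. 1) = 1" and \<Phi>_id: "\<Phi> (\<lambda>z. z) = a"
  and \<Phi>_cong: "continuous_on (spectrum a) g \<Longrightarrow> continuous_on (spectrum a) h \<Longrightarrow>
    (\<And>z. z \<in> spectrum a \<Longrightarrow> g z = h z) \<Longrightarrow> \<Phi> g = \<Phi> h"
  using calculus unfolding is_functional_calculus_def by blast+

lemma \<Phi>_const: "\<Phi> (\<lambda>z. c) = c *\<^sub>C 1"
  using \<Phi>_scale[of "\<lambda>_. 1" c] by (simp add: \<Phi>_one)

lemma \<Phi>_diff:
  assumes "continuous_on (spectrum a) g" "continuous_on (spectrum a) h"
  shows "\<Phi> (\<lambda>z. g z - h z) = \<Phi> g - \<Phi> h"
  using \<Phi>_add[OF assms(1), of "\<lambda>z. -1 * h z"] \<Phi>_scale[OF assms(2), of "-1"]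
    continuous_on_minus[OF assms(2)] by (simp add: scaleC_minus_left)

lemma \<Phi>_sum:
  assumes "\<And>i. i \<in> I \<Longrightarrow> continuous_on (spectrum a) (g i)"
  shows "\<Phi> (\<lambda>z. \<Sum>i\<in>I. g i z) = (\<Sum>i\<in>I. \<Phi> (g i))"
  using assms
proof (induction I rule: infinite_finite_induct)
  case (insert i I)
  then show ?case by (simp add: \<Phi>_add continuous_on_sum)
qed (simp_all add: \<Phi>_const)

text \<open>With \<open>k = sqrt (M\<^sup>2 - \<bar>g\<bar>\<^sup>2)\<close> and \<open>m = \<bar>g\<bar>\<close> one has \<open>M\<^sup>2 - \<Phi>(m)\<^sup>2 = \<Phi>(k)\<^sup>2\<close>, a square, hence
  positive; and \<open>\<Phi>(m)\<^sup>2 = star (\<Phi> g) * \<Phi> g\<close> has norm \<open>(norm (\<Phi> g))\<^sup>2\<close>.\<close>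

lemma norm_\<Phi>_le:
  assumes g: "continuous_on (spectrum a) g" and M: "0 \<le> M" "\<And>z. z \<in> spectrum a \<Longrightarrow> cmod (g z) \<le> M"
  shows "norm (\<Phi> g) \<le> M"
proof -
  define k where "k z = complex_of_real (sqrt (M\<^sup>2 - (cmod (g z))\<^sup>2))" for z
  define m where "m z = complex_of_real (cmod (g z))" for z
  have k: "continuous_on (spectrum a) k" and m: "continuous_on (spectrum a) m"
    unfolding k_def m_def by (intro continuous_intros g)+
  have cnj: "(\<lambda>z. cnj (k z)) = k" "(\<lambda>z. cnj (m z)) = m" by (simp_all add: k_def m_def fun_eq_iff)
  have sk: "star (\<Phi> k) = \<Phi> k" using \<Phi>_cnj[OF k] unfolding cnj by simp
  have sm: "star (\<Phi> m) = \<Phi> m" using \<Phi>_cnj[OF m] unfolding cnj by simp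
  have "\<Phi> (\<lambda>z. cnj (g z) * g z) = star (\<Phi> g) * \<Phi> g"
    using g by (simp add: \<Phi>_mult \<Phi>_cnj continuous_on_cnj)
  moreover have "(\<lambda>z. cnj (g z) * g z) = (\<lambda>z. m z * m z)"
    unfolding m_def by (simp add: mult.commute[of "cnj _"] complex_norm_square[symmetric] power2_eq_square)
  ultimately have gg: "star (\<Phi> g) * \<Phi> g = \<Phi> m * \<Phi> m"
    using \<Phi>_mult[OF m m] by simp
  have "\<Phi> (\<lambda>z. k z * k z + m z * m z) = \<Phi> (\<lambda>z. complex_of_real (M\<^sup>2))"
  proof (rule \<Phi>_cong)
    fix z assume "z \<in> spectrum a"
    then have "(cmod (g z))\<^sup>2 \<le> M\<^sup>2" using M by (simp add: power_mono)
    then have "sqrt (M\<^sup>2 - (cmod (g z))\<^sup>2) * sqrt (M\<^sup>2 - (cmod (g z))\<^sup>2) + cmod (g z) * cmod (g z) = M\<^sup>2"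
      by (simp add: power2_eq_square)
    then show "k z * k z + m z * m z = complex_of_real (M\<^sup>2)"
      unfolding k_def m_def by (simp only: of_real_mult[symmetric] of_real_add[symmetric])
  qed (intro continuous_intros k m)+
  then have "\<Phi> k * \<Phi> k + \<Phi> m * \<Phi> m = M\<^sup>2 *\<^sub>R 1"
    using k m by (simp add: \<Phi>_add \<Phi>_mult continuous_on_mult \<Phi>_const scaleC_of_real del: of_real_power)
  then have eq: "M\<^sup>2 *\<^sub>R 1 - \<Phi> m * \<Phi> m = \<Phi> k * \<Phi> k" by (metis add_diff_cancel_right')
  have one: "positive_element (1::'a)" using positive_square[of "1::'a"] by simp
  have "norm (\<Phi> m * \<Phi> m) \<le> M\<^sup>2"
  proof (rule norm_le_if_positive)
    show "positive_element (M\<^sup>2 *\<^sub>R 1 - \<Phi> m * \<Phi> m)" unfolding eq by (rule positive_square[OF sk])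
    show "positive_element (M\<^sup>2 *\<^sub>R 1 + \<Phi> m * \<Phi> m)"
      by (intro positive_add positive_scaleR one positive_square sm) simp
  qed simp
  then have "(norm (\<Phi> g))\<^sup>2 \<le> M\<^sup>2" by (simp flip: gg cstar_identity)
  then show ?thesis using M by (simp add: power2_le_iff_abs_le)
qed

lemma continuous_on_bern: "continuous_on A (\<lambda>z::complex. bern S z s)"
proof (induction s)
  case (Cons l s)
  then show ?case
    by (simp add: weight_def scaleC_complex_def star_complex_def) (intro continuous_intros)
qed simp

lemma \<Phi>_bern: "\<Phi> (\<lambda>z. bern S z s) = bern S a s"
proof (induction s)
  case (Cons l s)
  have w: "(\<lambda>z::complex. weight S z l) = (\<lambda>z. of_real (1/4) + of_real (1 / (8 * S)) * (cnj (\<i> ^ l) * z + \<i> ^ l * cnj z))"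
    by (simp add: weight_def scaleC_complex_def star_complex_def scaleR_conv_of_real)
  have c: "continuous_on (spectrum a) (\<lambda>z::complex. weight S z l)"
    unfolding w by (intro continuous_intros)
  have "\<Phi> (\<lambda>z::complex. weight S z l) = of_real (1/4) *\<^sub>C 1 +
      of_real (1 / (8 * S)) *\<^sub>C (cnj (\<i> ^ l) *\<^sub>C a + \<i> ^ l *\<^sub>C star a)"
    unfolding w using \<Phi>_cnj[of "\<lambda>z. z"]
    by (subst \<Phi>_add \<Phi>_scale \<Phi>_const; (intro continuous_intros)?)+ (simp add: \<Phi>_id)
  then have "\<Phi> (\<lambda>z::complex. weight S z l) = weight S a l"
    unfolding scaleC_of_real weight_def .
  then show ?case using Cons \<Phi>_mult[OF c continuous_on_bern] by simp
qed (simp add: \<Phi>_one)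

lemma \<Phi>_bern_sum:
  "\<Phi> (\<lambda>z. \<Sum>s\<in>I. r s * bern S z s) = (\<Sum>s\<in>I. r s *\<^sub>C bern S a s)"
  by (subst \<Phi>_sum) (auto simp: \<Phi>_scale continuous_on_bern \<Phi>_bern intro!: continuous_intros continuous_on_bern)

text \<open>The calculus is expanding as well as contractive. If \<open>norm (\<Phi> g) < \<bar>g w\<bar>\<close>, then a bump \<open>h\<close>
  at \<open>w\<close> is a multiple of \<open>g\<close> with \<open>norm (\<Phi> h) < 1\<close>, so \<open>1 - \<Phi> h\<close> is invertible; but
  \<open>1 - h\<close> is divisible by \<open>z - w\<close>.\<close>

lemma norm_\<Phi>_ge:
  assumes g: "continuous_on (spectrum a) g" and l: "w \<in> spectrum a"
  shows "cmod (g w) \<le> norm (\<Phi> g)"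
proof (rule ccontr)
  assume "\<not> ?thesis"
  then obtain c where c: "norm (\<Phi> g) < c" "c < cmod (g w)" using dense not_le by metis
  have c0: "0 < c" using c(1) norm_ge_zero[of "\<Phi> g"] by linarith
  obtain e where e: "0 < e" "\<And>z. z \<in> spectrum a \<Longrightarrow> dist z w < e \<Longrightarrow> dist (g z) (g w) < cmod (g w) - c"
    using g l c unfolding continuous_on_iff by (metis diff_gt_0_iff_gt)
  have big: "c \<le> cmod (g z)" if "z \<in> spectrum a" "dist z w < e" for z
    using e(2)[OF that] norm_triangle_ineq2[of "g w" "g z"] by (simp add: dist_norm norm_minus_commute)
  define d where "d = e / 2"
  have d: "0 < d" using e by (simp add: d_def)
  \<comment> \<open>\<open>h\<close> is \<open>1\<close> within distance \<open>d\<close> of \<open>w\<close> and \<open>0\<close> beyond \<open>2 d = e\<close>. The maxima make \<open>q\<close> and \<open>k\<close>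
    continuous and are attained by the second argument wherever the first factor is nonzero, so that
    \<open>q = h / g\<close> and \<open>k = (1 - h) / (z - w)\<close>, extended by \<open>0\<close>.\<close>
  define h where "h z = complex_of_real (min 1 (max 0 (2 - dist z w / d)))" for z
  define q where "q z = h z * (cnj (g z) * complex_of_real (1 / max (c\<^sup>2) ((cmod (g z))\<^sup>2)))" for z
  define k where "k z = (1 - h z) * (cnj (z - w) * complex_of_real (1 / max (d\<^sup>2) ((cmod (z - w))\<^sup>2)))" for z
  have ch: "continuous_on (spectrum a) h" unfolding h_def using d by (intro continuous_intros) auto
  have nz: "max (c\<^sup>2) x \<noteq> 0" "max (d\<^sup>2) x \<noteq> 0" for x using c0 d by (auto simp: max_def)
  have cq: "continuous_on (spectrum a) q" unfolding q_def by (intro continuous_intros ch g) (simp add: nz)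
  have ck: "continuous_on (spectrum a) k" unfolding k_def by (intro continuous_intros ch) (simp add: nz)
  have "norm (\<Phi> q) \<le> 1 / c"
  proof (rule norm_\<Phi>_le[OF cq])
    fix z
    have "cmod (h z) \<le> 1" by (simp add: h_def)
    moreover have "cmod (g z) * (1 / max (c\<^sup>2) ((cmod (g z))\<^sup>2)) \<le> 1 / c"
    proof -
      have "cmod (g z) * c \<le> max (c\<^sup>2) ((cmod (g z))\<^sup>2)"
      proof (cases "cmod (g z) \<le> c")
        case True
        then show ?thesis using c0 by (intro max.coboundedI1) (simp add: power2_eq_square)
      next
        case False
        then show ?thesis using c0
          by (intro max.coboundedI2) (simp add: power2_eq_square mult_left_mono)
      qed
      then show ?thesis using c0 nz(1)[of "(cmod (g z))\<^sup>2"] by (simp add: field_simps less_max_iff_disj)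
    qed
    ultimately have "cmod (h z) * (cmod (g z) * (1 / max (c\<^sup>2) ((cmod (g z))\<^sup>2))) \<le> 1 * (1 / c)"
      by (intro mult_mono) (auto simp: le_max_iff_disj)
    then show "cmod (q z) \<le> 1 / c"
      unfolding q_def norm_mult norm_of_real by (simp add: abs_of_nonneg le_max_iff_disj)
  qed (use c0 in simp)
  have "\<Phi> h = \<Phi> (\<lambda>z. q z * g z)"
  proof (rule \<Phi>_cong[OF ch])
    fix z assume z: "z \<in> spectrum a"
    show "h z = q z * g z"
    proof (cases "dist z w < e")
      case True
      have "max (c\<^sup>2) ((cmod (g z))\<^sup>2) = (cmod (g z))\<^sup>2" using big[OF z True] c0 by (simp add: power_mono)
      moreover have "cnj (g z) * g z = complex_of_real ((cmod (g z))\<^sup>2)"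
        unfolding complex_norm_square by (simp add: mult.commute)
      moreover have "cmod (g z) \<noteq> 0" using big[OF z True] c0 by linarith
      ultimately show ?thesis unfolding q_def
        by (simp add: mult.assoc mult.left_commute[of _ "cnj _"] power2_eq_square)
    next
      case False
      then have "2 \<le> dist z w / d" using d by (simp add: d_def field_simps)
      then have "h z = 0" by (simp add: h_def)
      then show ?thesis by (simp add: q_def)
    qed
  qed (intro continuous_intros cq g)
  then have "norm (\<Phi> h) \<le> norm (\<Phi> q) * norm (\<Phi> g)"
    using norm_mult_ineq[of "\<Phi> q" "\<Phi> g"] by (simp add: \<Phi>_mult cq g)
  also have "\<dots> \<le> 1 / c * norm (\<Phi> g)" using \<open>norm (\<Phi> q) \<le> 1 / c\<close> by (intro mult_right_mono) auto
  also have "\<dots> < 1" using c c0 by (simp add: divide_less_eq)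
  finally obtain y where y: "(1 - \<Phi> h) * y = 1" "y * (1 - \<Phi> h) = 1"
    using invertible_one_minus by (auto simp: invertible_element_def)
  have zl: "continuous_on (spectrum a) (\<lambda>z. z - w)" by (intro continuous_intros)
  have kz: "k z * (z - w) = 1 - h z" for z
  proof (cases "d \<le> dist z w")
    case True
    then have "max (d\<^sup>2) ((cmod (z - w))\<^sup>2) = (cmod (z - w))\<^sup>2" "cmod (z - w) \<noteq> 0"
      using d by (auto simp: dist_norm power_mono)
    moreover have "cnj (z - w) * (z - w) = complex_of_real ((cmod (z - w))\<^sup>2)"
      unfolding complex_norm_square by (simp add: mult.commute)
    ultimately show ?thesis unfolding k_def
      by (simp add: mult.assoc mult.left_commute[of _ "cnj _ - _"] power2_eq_square del: complex_cnj_diff)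
  next
    case False
    then have "1 \<le> 2 - dist z w / d" using d by (simp add: field_simps)
    then have "h z = 1" by (simp add: h_def)
    then show ?thesis by (simp add: k_def)
  qed
  have "\<Phi> (\<lambda>z. 1 - h z) = 1 - \<Phi> h" using ch by (simp add: \<Phi>_diff \<Phi>_one)
  moreover have zl': "\<Phi> (\<lambda>z. z - w) = a - w *\<^sub>C 1" by (simp add: \<Phi>_diff \<Phi>_id \<Phi>_const)
  ultimately have k1: "\<Phi> k * (a - w *\<^sub>C 1) = 1 - \<Phi> h" "(a - w *\<^sub>C 1) * \<Phi> k = 1 - \<Phi> h"
    using \<Phi>_mult[OF ck zl] \<Phi>_mult[OF zl ck] by (simp_all add: kz mult.commute[of "_ - w"])
  have left: "(y * \<Phi> k) * (a - w *\<^sub>C 1) = 1" by (simp add: mult.assoc k1 y)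
  have right: "(a - w *\<^sub>C 1) * (\<Phi> k * y) = 1" by (simp add: mult.assoc[symmetric] k1 y)
  have "y * \<Phi> k = \<Phi> k * y" using left right by (metis mult.assoc mult_1_left mult_1_right)
  then have "invertible_element (a - w *\<^sub>C 1)"
    using left right unfolding invertible_element_def by metis
  then show False using l by (simp add: spectrum_def)
qed

end

text \<open>Both calculi are contractive and agree on the Bernstein polynomials of a continuous extension of
  \<open>f\<close>, which converge to \<open>f\<close> uniformly on the spectrum.\<close>

lemma functional_calculus_unique:
  assumes \<Phi>: "is_functional_calculus a \<Phi>" and \<Psi>: "is_functional_calculus a \<Psi>"
    and f: "continuous_on (spectrum a) f"
  shows "\<Phi> f = \<Psi> f"
proof -
  interpret p: functional_calculus a \<Phi> by unfold_locales (rule \<Phi>)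
  interpret q: functional_calculus a \<Psi> by unfold_locales (rule \<Psi>)
  define S where "S = norm a + 1"
  have S: "0 < S" "norm a \<le> S" unfolding S_def by (auto simp: add_nonneg_pos)
  obtain g where g: "continuous_on UNIV g" "\<And>z. z \<in> spectrum a \<Longrightarrow> g z = f z"
    using Tietze_unbounded[OF f, of UNIV] closed_spectrum by (metis closed_closedin subtopology_UNIV)
  have "norm (\<Phi> f - \<Psi> f) \<le> 0 + e" if "0 < e" for e :: real
  proof -
    have e4: "0 < e / 4" using that by simp
    obtain r where r: "0 \<le> r" "\<And>u v. u \<in> cball 0 (2 * S) \<Longrightarrow> v \<in> cball 0 (2 * S) \<Longrightarrow>
        cmod (g u - g v) \<le> e / 4 + r * (cmod (u - v))\<^sup>2"
      using uniformly_continuous_quadratic_modulus[OF compact_cball continuous_on_subset[OF g(1) subset_UNIV] e4]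
      by metis
    obtain n where n: "real n > 16 * r * S\<^sup>2 / e" using reals_Archimedean2 by blast
    moreover have "0 \<le> 16 * r * S\<^sup>2 / e" using r(1) that by simp
    ultimately have n0: "n > 0" by (metis gr0I le_less_trans less_irrefl of_nat_0)
    define B where "B z = (\<Sum>s\<in>words n. g (position S s) * bern S z s)" for z
    have cB: "continuous_on (spectrum a) B" unfolding B_def
      by (intro continuous_intros p.continuous_on_bern)
    have approx: "cmod (f z - B z) \<le> e / 2" if z: "z \<in> spectrum a" for z
    proof -
      have zS: "cmod z \<le> S" using spectrum_subset_cball[of a] z S by auto
      have b: "bern S z s = complex_of_real (bern_num S z s)" for s
        using S by (simp add: bern_num_complex)
      have one: "(\<Sum>s\<in>words n. bern_num S z s) = 1" using S by (simp add: sum_bern_num)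
      have "f z - B z = (\<Sum>s\<in>words n. (g z - g (position S s)) * bern_num S z s)"
        using one g(2)[OF z]
        by (simp add: B_def b left_diff_distrib sum_subtractf flip: sum_distrib_left of_real_sum)
      also have "cmod \<dots> \<le> (\<Sum>s\<in>words n. (e / 4 + r * (cmod (z - position S s))\<^sup>2) * bern_num S z s)"
        using zS S position_in_cball[of S]
        by (intro sum_norm_le) (auto simp: norm_mult bern_num_nonneg intro!: mult_right_mono r(2) simp del: mem_cball)
      also have "\<dots> = e / 4 * (\<Sum>s\<in>words n. bern_num S z s) +
          r * (\<Sum>s\<in>words n. (cmod (z - position S s))\<^sup>2 * bern_num S z s)"
        unfolding distrib_right sum.distrib sum_distrib_left by (simp only: mult.assoc)
      also have "\<dots> = e / 4 + r * ((4 * S\<^sup>2 - (cmod z)\<^sup>2) / n)"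
        using one S n0 sum_dist_bern_num[of S n z] by simp
      also have "\<dots> \<le> e / 4 + r * (4 * S\<^sup>2 / n)"
        using r by (intro add_left_mono mult_left_mono divide_right_mono) auto
      also have "r * (4 * S\<^sup>2 / n) \<le> e / 4" using n n0 that \<open>0 < e\<close> by (simp add: field_simps)
      finally show ?thesis by simp
    qed
    have "norm (\<Phi> f - \<Phi> B) \<le> e / 2"
      unfolding p.\<Phi>_diff[OF f cB, symmetric]
      by (rule p.norm_\<Phi>_le) (use approx that in \<open>auto intro: continuous_intros f cB\<close>)
    moreover have "norm (\<Psi> f - \<Psi> B) \<le> e / 2"
      unfolding q.\<Phi>_diff[OF f cB, symmetric]
      by (rule q.norm_\<Phi>_le) (use approx that in \<open>auto intro: continuous_intros f cB\<close>)
    moreover have "\<Phi> B = \<Psi> B"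
      unfolding B_def by (simp add: p.\<Phi>_bern_sum q.\<Phi>_bern_sum)
    ultimately show ?thesis
      using norm_triangle_ineq4[of "\<Phi> f - \<Phi> B" "\<Psi> f - \<Psi> B"] by simp
  qed
  then have "norm (\<Phi> f - \<Psi> f) \<le> 0" by (rule field_le_epsilon)
  then show ?thesis by simp
qed

lemma cfc_eq:
  assumes "is_functional_calculus a \<Phi>" "continuous_on (spectrum a) f"
  shows "cfc a f = \<Phi> f"
  unfolding cfc_def
proof (rule the_equality)
  show "\<exists>\<Psi>. is_functional_calculus a \<Psi> \<and> \<Phi> f = \<Psi> f" using assms(1) by blast
  show "y = \<Phi> f" if "\<exists>\<Psi>. is_functional_calculus a \<Psi> \<and> y = \<Psi> f" for y
    using functional_calculus_unique[OF _ assms(1,2)] that by blast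
qed

lemma functional_calculus_exists:
  assumes "normal_element a"
  shows "\<exists>\<Phi>. is_functional_calculus a \<Phi>"
proof -
  interpret normal_in_ball a "norm a + 1"
    using assms by unfold_locales (auto simp: normal_element_def)
  show ?thesis by (rule ex_functional_calculus)
qed

section \<open>A calculus of computable functions\<close>

subsection \<open>Basic algorithms\<close>

definition recursive1 :: "(nat \<Rightarrow> nat) \<Rightarrow> bool" where
  "recursive1 f \<longleftrightarrow> (\<exists>P. \<forall>x. run_plain P [x] = Some (f x))"

definition recursive2 :: "(nat \<Rightarrow> nat \<Rightarrow> nat) \<Rightarrow> bool" where
  "recursive2 f \<longleftrightarrow> (\<exists>P. \<forall>x y. run_plain P [x, y] = Some (f x y))"

lemma recursive1_comp: "recursive1 f \<Longrightarrow> recursive1 g \<Longrightarrow> recursive1 (\<lambda>x. f (g x))"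
  unfolding recursive1_def
proof safe
  fix P Q assume "\<forall>x. run_plain P [x] = Some (f x)" "\<forall>x. run_plain Q [x] = Some (g x)"
  then show "\<exists>P. \<forall>x. run_plain P [x] = Some (f (g x))"
    by (intro exI[of _ "Comp P [Q]"]) simp
qed

lemma recursive1_comp2: "recursive2 f \<Longrightarrow> recursive1 g \<Longrightarrow> recursive1 h \<Longrightarrow> recursive1 (\<lambda>x. f (g x) (h x))"
  unfolding recursive1_def recursive2_def
proof safe
  fix P Q R assume "\<forall>x y. run_plain P [x, y] = Some (f x y)"
    "\<forall>x. run_plain Q [x] = Some (g x)" "\<forall>x. run_plain R [x] = Some (h x)"
  then show "\<exists>P. \<forall>x. run_plain P [x] = Some (f (g x) (h x))"
    by (intro exI[of _ "Comp P [Q, R]"]) simp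
qed

lemma recursive2_comp: "recursive1 f \<Longrightarrow> recursive2 g \<Longrightarrow> recursive2 (\<lambda>x y. f (g x y))"
  unfolding recursive1_def recursive2_def
proof safe
  fix P Q assume "\<forall>x. run_plain P [x] = Some (f x)" "\<forall>x y. run_plain Q [x, y] = Some (g x y)"
  then show "\<exists>P. \<forall>x y. run_plain P [x, y] = Some (f (g x y))"
    by (intro exI[of _ "Comp P [Q]"]) simp
qed

lemma recursive2_comp2: "recursive2 f \<Longrightarrow> recursive2 g \<Longrightarrow> recursive2 h \<Longrightarrow> recursive2 (\<lambda>x y. f (g x y) (h x y))"
  unfolding recursive2_def
proof safe
  fix P Q R assume "\<forall>x y. run_plain P [x, y] = Some (f x y)"
    "\<forall>x y. run_plain Q [x, y] = Some (g x y)" "\<forall>x y. run_plain R [x, y] = Some (h x y)"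
  then show "\<exists>P. \<forall>x y. run_plain P [x, y] = Some (f (g x y) (h x y))"
    by (intro exI[of _ "Comp P [Q, R]"]) simp
qed

lemma recursive1_id: "recursive1 (\<lambda>x. x)"
  unfolding recursive1_def by (intro exI[of _ "Proj 0"]) simp

lemma recursive2_proj: "recursive2 (\<lambda>x y. x)" "recursive2 (\<lambda>x y. y)"
  unfolding recursive2_def by (rule exI[of _ "Proj 0"], simp, rule exI[of _ "Proj 1"], simp)

lemma recursive1_Suc: "recursive1 Suc"
  unfolding recursive1_def by (intro exI[of _ Succ]) simp

lemma recursive1_const: "recursive1 (\<lambda>x. c)"
proof (induction c)
  case 0
  show ?case unfolding recursive1_def by (intro exI[of _ Zero]) simp
next
  case (Suc c)
  then show ?case using recursive1_comp[OF recursive1_Suc] by blast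
qed

lemma recursive2_add: "recursive2 (+)"
proof -
  have "rec_nat (Some y) (\<lambda>m r. Option.bind r (\<lambda>z. Some (Suc z))) n = Some (n + y)" for n y :: nat
    by (induction n) auto
  then show ?thesis unfolding recursive2_def
    by (intro exI[of _ "PrimRec (Proj 0) (Comp Succ [Proj 1])"]) simp
qed

lemma recursive1_pred: "recursive1 (\<lambda>x. x - 1)"
proof -
  have "rec_nat (Some 0) (\<lambda>m r. Option.bind r (\<lambda>z. Some m)) n = Some (n - 1)" for n :: nat
    by (induction n) auto
  then show ?thesis unfolding recursive1_def
    by (intro exI[of _ "PrimRec Zero (Proj 0)"]) simp
qed

lemma recursive2_diff: "recursive2 (-)"
proof -
  obtain P where P: "\<And>x. run_plain P [x] = Some (x - 1)" using recursive1_pred unfolding recursive1_def by auto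
  have "rec_nat (Some y) (\<lambda>m r. Option.bind r (\<lambda>z. Some (z - 1))) n = Some (y - n)" for n y :: nat
    by (induction n) auto
  then have "recursive2 (\<lambda>n y. y - n)" unfolding recursive2_def
    by (intro exI[of _ "PrimRec (Proj 0) (Comp P [Proj 1])"]) (simp add: P)
  from recursive2_comp2[OF this recursive2_proj(2) recursive2_proj(1)] show ?thesis .
qed

lemma recursive2_mult: "recursive2 (*)"
proof -
  obtain P where P: "\<And>x y. run_plain P [x, y] = Some (x + y)" using recursive2_add unfolding recursive2_def by auto
  have "rec_nat (Some 0) (\<lambda>m r. Option.bind r (\<lambda>z. Some (z + y))) n = Some (n * y)" for n y :: nat
    by (induction n) auto
  then show ?thesis unfolding recursive2_def
    by (intro exI[of _ "PrimRec Zero (Comp P [Proj 1, Proj 2])"]) (simp add: P)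
qed

lemma recursive1_triangle: "recursive1 triangle"
proof -
  obtain P where P: "\<And>x y. run_plain P [x, y] = Some (x + y)" using recursive2_add unfolding recursive2_def by auto
  have "rec_nat (Some 0) (\<lambda>m r. Option.bind r (\<lambda>z. Some (z + Suc m))) n = Some (triangle n)" for n :: nat
    by (induction n) auto
  then show ?thesis unfolding recursive1_def
    by (intro exI[of _ "PrimRec Zero (Comp P [Proj 1, Comp Succ [Proj 0]])"]) (simp add: P)
qed

lemma recursive2_pair: "recursive2 (\<lambda>x y. prod_encode (x, y))"
  unfolding prod_encode_def prod.case
  by (intro recursive2_comp2[OF recursive2_add] recursive2_comp[OF recursive1_triangle] recursive2_add recursive2_proj)

lemma triangle_mono: "m \<le> n \<Longrightarrow> triangle m \<le> triangle n"
  by (induction n) (auto simp: le_Suc_eq)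

text \<open>The pairing function enumerates the diagonals \<open>x + y = s\<close> one after the other, diagonal \<open>s\<close>
  starting at \<open>triangle s\<close>. Searching for the diagonal of \<open>n\<close> inverts it.\<close>

lemma least_triangle: "(LEAST s. n < triangle (Suc s)) = fst (prod_decode n) + snd (prod_decode n)"
proof -
  obtain a b where ab: "prod_decode n = (a, b)" by fastforce
  then have n: "n = triangle (a + b) + a"
    using prod_decode_inverse[of n] by (simp add: prod_encode_def del: prod_decode_inverse)
  show ?thesis
  proof (rule Least_equality)
    show "n < triangle (Suc (fst (prod_decode n) + snd (prod_decode n)))"
      unfolding ab fst_conv snd_conv using n by simp
    fix s assume "n < triangle (Suc s)"
    then have "triangle (a + b) < triangle (Suc s)" using n by linarith
    then have "\<not> Suc s \<le> a + b" using triangle_mono not_le by blast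
    then show "fst (prod_decode n) + snd (prod_decode n) \<le> s" by (simp add: ab)
  qed
qed

lemma recursive1_unpair: "recursive1 (\<lambda>n. fst (prod_decode n))" "recursive1 (\<lambda>n. snd (prod_decode n))"
proof -
  have "recursive2 (\<lambda>s n. Suc n - triangle (Suc s))"
    by (intro recursive2_comp2[OF recursive2_diff] recursive2_comp[OF recursive1_triangle] recursive2_comp[OF recursive1_Suc] recursive2_proj)
  then obtain P where P: "\<And>s n. run_plain P [s, n] = Some (Suc n - triangle (Suc s))"
    unfolding recursive2_def by auto
  have "\<exists>s. n < triangle (Suc s)" for n
    by (rule exI[of _ n]) simp
  then have "run_plain (Mu P) [n] = Some (LEAST s. n < triangle (Suc s))" for n
    by (auto simp: P Suc_le_eq simp del: triangle_Suc)
  then have r: "recursive1 (\<lambda>n. fst (prod_decode n) + snd (prod_decode n))"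
    unfolding recursive1_def least_triangle by blast
  have d: "n - triangle (fst (prod_decode n) + snd (prod_decode n)) = fst (prod_decode n)" for n
    using prod_decode_inverse[of n]
    by (cases "prod_decode n") (simp add: prod_encode_def del: prod_decode_inverse)
  show f: "recursive1 (\<lambda>n. fst (prod_decode n))"
    using recursive1_comp2[OF recursive2_diff recursive1_id recursive1_comp[OF recursive1_triangle r]] unfolding d .
  show "recursive1 (\<lambda>n. snd (prod_decode n))"
    using recursive1_comp2[OF recursive2_diff r f] by simp
qed

subsection \<open>Coded types\<close>

text \<open>An injective coding makes sense of computability for functions on a type. An algorithm for such a
  function may behave arbitrarily, and in particular diverge, on numbers that are not codes.\<close>

class coded =
  fixes enc :: "'a \<Rightarrow> nat"
  assumes enc_inject: "enc x = enc y \<Longrightarrow> x = y"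

lemma enc_eq_iff [simp]: "enc x = enc y \<longleftrightarrow> x = (y::'a::coded)"
  using enc_inject by blast

instantiation nat :: coded
begin
definition "enc_nat = (\<lambda>n::nat. n)"
instance by standard (simp add: enc_nat_def)
end

instantiation bool :: coded
begin
definition "enc_bool b = (if b then 1 else 0 :: nat)"
instance by standard (simp add: enc_bool_def split: if_splits)
end

instantiation prod :: (coded, coded) coded
begin
definition "enc_prod p = prod_encode (enc (fst p), enc (snd p))"
instance by standard (auto simp: enc_prod_def prod_eq_iff)
end

instantiation option :: (coded) coded
begin
definition "enc_option t = (case t of None \<Rightarrow> 0 | Some x \<Rightarrow> Suc (enc x))"
instance by standard (auto simp: enc_option_def split: option.splits)
end

instantiation sum :: (coded, coded) coded
begin
definition "enc_sum t = sum_encode (map_sum enc enc t)"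
instance
  by standard (auto simp: enc_sum_def sum_encode_eq map_sum_def split: sum.splits)
end

instantiation list :: (coded) coded
begin
definition "enc_list xs = list_encode (map enc xs)"
instance
  by standard (auto simp: enc_list_def list_encode_eq inj_def dest!: map_injective[rotated])
end

instantiation int :: coded
begin
definition "enc_int = int_encode"
instance by standard (simp add: enc_int_def int_encode_eq)
end

text \<open>A rational number has many codes as a fraction; the least one serves as its code.\<close>

instantiation rat :: coded
begin
definition "enc_rat r = (LEAST n. nat_to_rat_surj n = r)"
instance
proof
  have "nat_to_rat_surj (enc r) = r" for r :: rat
    unfolding enc_rat_def by (rule LeastI_ex) (metis surj_nat_to_rat_surj surjD)
  then show "enc x = enc y \<Longrightarrow> x = y" for x y :: rat by metis
qed
end

lemma nat_to_rat_surj_enc [simp]: "nat_to_rat_surj (enc r) = r"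
  unfolding enc_rat_def by (rule LeastI_ex) (metis surj_nat_to_rat_surj surjD)

lemma enc_nat [simp]: "enc (n::nat) = n"
  by (simp add: enc_nat_def)

lemma enc_Pair: "enc (x, y) = prod_encode (enc x, enc y)"
  by (simp add: enc_prod_def)

lemma enc_None [simp]: "enc None = 0" and enc_Some [simp]: "enc (Some x) = Suc (enc x)"
  by (simp_all add: enc_option_def)

lemma enc_Nil [simp]: "enc [] = 0" and enc_Cons: "enc (x # xs) = Suc (prod_encode (enc x, enc xs))"
  by (simp_all add: enc_list_def)

lemma enc_True [simp]: "enc True = 1" and enc_False [simp]: "enc False = 0"
  by (simp_all add: enc_bool_def)

definition computable :: "('a::coded \<Rightarrow> 'b::coded) \<Rightarrow> bool" where
  "computable f \<longleftrightarrow> (\<exists>P. \<forall>x. run_plain P [enc x] = Some (enc (f x)))"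

named_theorems computable_intros

lemma computable_id [computable_intros]: "computable (\<lambda>x. x)"
  unfolding computable_def by (intro exI[of _ "Proj 0"]) simp

lemma computable_comp: "computable f \<Longrightarrow> computable g \<Longrightarrow> computable (\<lambda>x. f (g x))"
  unfolding computable_def
proof safe
  fix P Q assume "\<forall>x. run_plain P [enc x] = Some (enc (f x))" "\<forall>x. run_plain Q [enc x] = Some (enc (g x))"
  then show "\<exists>P. \<forall>x. run_plain P [enc x] = Some (enc (f (g x)))"
    by (intro exI[of _ "Comp P [Q]"]) simp
qed

text \<open>Functions that agree on codes are computed by the same algorithm.\<close>

lemma computable_recode:
  assumes "computable g" "\<And>x. enc (f x) = enc (g x)"
  shows "computable f"
  using assms unfolding computable_def by simp

lemma recursive1_imp_computable: "recursive1 F \<Longrightarrow> (\<And>x. enc (f x) = F (enc x)) \<Longrightarrow> computable f"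
  unfolding recursive1_def computable_def by auto

lemma recursive2_imp_computable:
  assumes "recursive2 F" "computable f" "computable g" "\<And>x. enc (h x) = F (enc (f x)) (enc (g x))"
  shows "computable h"
proof -
  obtain P Q R where "\<And>x y. run_plain P [x, y] = Some (F x y)"
    "\<And>x. run_plain Q [enc x] = Some (enc (f x))" "\<And>x. run_plain R [enc x] = Some (enc (g x))"
    using assms(1-3) unfolding recursive2_def computable_def by metis
  then show ?thesis using assms(4) unfolding computable_def
    by (intro exI[of _ "Comp P [Q, R]"]) simp
qed

lemma computable_const [computable_intros]: "computable (\<lambda>x. c)"
  by (rule recursive1_imp_computable[OF recursive1_const]) simp

lemma computable_Pair [computable_intros]:
  "computable f \<Longrightarrow> computable g \<Longrightarrow> computable (\<lambda>x. (f x, g x))"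
  by (rule recursive2_imp_computable[OF recursive2_pair]) (simp_all add: enc_Pair)

text \<open>These rules let an argument function \<open>f\<close>, known to be computable on pairs or triples, be
  applied to computable expressions.\<close>

lemma computable_comp2:
  "computable (\<lambda>p. f (fst p) (snd p)) \<Longrightarrow> computable g \<Longrightarrow> computable h \<Longrightarrow>
    computable (\<lambda>x. f (g x) (h x))"
  using computable_comp[of "\<lambda>p. f (fst p) (snd p)", OF _ computable_Pair] by simp

lemma computable_comp3:
  "computable (\<lambda>p. f (fst p) (fst (snd p)) (snd (snd p))) \<Longrightarrow> computable g \<Longrightarrow>
    computable h \<Longrightarrow> computable k \<Longrightarrow> computable (\<lambda>x. f (g x) (h x) (k x))"
  using computable_comp[of "\<lambda>p. f (fst p) (fst (snd p)) (snd (snd p))",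
      OF _ computable_Pair[OF _ computable_Pair]] by simp

lemma computable_fst [computable_intros]: "computable f \<Longrightarrow> computable (\<lambda>x. fst (f x))"
  by (rule computable_comp[of fst], rule recursive1_imp_computable[OF recursive1_unpair(1)]) (simp_all add: enc_prod_def)

lemma computable_snd [computable_intros]: "computable f \<Longrightarrow> computable (\<lambda>x. snd (f x))"
  by (rule computable_comp[of snd], rule recursive1_imp_computable[OF recursive1_unpair(2)]) (simp_all add: enc_prod_def)

lemma computable_enc [computable_intros]: "computable f \<Longrightarrow> computable (\<lambda>x. enc (f x))"
  by (erule computable_recode) simp

lemma computable_Suc [computable_intros]: "computable f \<Longrightarrow> computable (\<lambda>x. Suc (f x))"
  by (rule computable_comp[of Suc], rule recursive1_imp_computable[OF recursive1_Suc]) simp_all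

lemma computable_nat_add [computable_intros]:
  "computable f \<Longrightarrow> computable g \<Longrightarrow> computable (\<lambda>x. f x + g x :: nat)"
  by (rule recursive2_imp_computable[OF recursive2_add, of f g]) simp_all

lemma computable_nat_diff [computable_intros]:
  "computable f \<Longrightarrow> computable g \<Longrightarrow> computable (\<lambda>x. f x - g x :: nat)"
  by (rule recursive2_imp_computable[OF recursive2_diff, of f g]) simp_all

lemma computable_nat_mult [computable_intros]:
  "computable f \<Longrightarrow> computable g \<Longrightarrow> computable (\<lambda>x. f x * g x :: nat)"
  by (rule recursive2_imp_computable[OF recursive2_mult, of f g]) simp_all

lemma computable_nat_le [computable_intros]:
  assumes "computable f" "computable g"
  shows "computable (\<lambda>x. f x \<le> (g x :: nat))"
  by (rule computable_recode[of "\<lambda>x. 1 - (f x - g x)"])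
    (intro computable_intros assms, simp add: enc_bool_def)

lemma computable_nat_less [computable_intros]:
  assumes "computable f" "computable g"
  shows "computable (\<lambda>x. f x < (g x :: nat))"
  unfolding less_eq_Suc_le by (intro computable_intros assms)

lemma computable_nat_eq: 
  assumes "computable f" "computable g"
  shows "computable (\<lambda>x. f x = (g x :: nat))"
  by (rule computable_recode[of "\<lambda>x. 1 - ((f x - g x) + (g x - f x))"])
    (intro computable_intros assms, simp add: enc_bool_def)

lemma computable_eq [computable_intros]:
  fixes f g :: "'a::coded \<Rightarrow> 'b::coded"
  assumes "computable f" "computable g"
  shows "computable (\<lambda>x. f x = g x)"
  using computable_nat_eq[OF computable_enc computable_enc, OF assms] by simp

lemma computable_not [computable_intros]: "computable p \<Longrightarrow> computable (\<lambda>x. \<not> p x)"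
  by (rule computable_recode[of "\<lambda>x. 1 - enc (p x)"])
    (intro computable_intros, simp_all add: enc_bool_def)

lemma computable_conj [computable_intros]:
  "computable p \<Longrightarrow> computable q \<Longrightarrow> computable (\<lambda>x. p x \<and> q x)"
  by (rule computable_recode[of "\<lambda>x. enc (p x) * enc (q x)"])
    (intro computable_intros, simp_all add: enc_bool_def)

lemma computable_disj [computable_intros]:
  assumes "computable p" "computable q" shows "computable (\<lambda>x. p x \<or> q x)"
proof -
  have "computable (\<lambda>x. \<not> (\<not> p x \<and> \<not> q x))" by (intro computable_intros assms)
  then show ?thesis by simp
qed

subsection \<open>Recursion, case distinction and search\<close>

lemma computable_rec_nat [computable_intros]:
  fixes b :: "'a::coded \<Rightarrow> nat \<Rightarrow> 'b::coded \<Rightarrow> 'b"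
  assumes "computable a" "computable (\<lambda>p. b (fst p) (fst (snd p)) (snd (snd p)))" "computable n"
  shows "computable (\<lambda>x. rec_nat (a x) (b x) (n x))"
proof -
  obtain A B N T where A: "\<And>x. run_plain A [enc x] = Some (enc (a x))"
    and B: "\<And>p. run_plain B [enc p] = Some (enc (b (fst p) (fst (snd p)) (snd (snd p))))"
    and N: "\<And>x. run_plain N [enc x] = Some (enc (n x))"
    and T: "\<And>x y. run_plain T [x, y] = Some (prod_encode (x, y))"
    using assms recursive2_pair unfolding computable_def recursive2_def by metis
  have B': "run_plain B [prod_encode (enc x, prod_encode (m, enc r))] = Some (enc (b x m r))" for x m r
    using B[of "(x, m, r)"] by (simp add: enc_Pair)
  let ?G = "Comp B [Comp T [Proj 2, Comp T [Proj 0, Proj 1]]]"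
  have G: "run_plain ?G [m, enc r, enc x] = Some (enc (b x m r))" for m r x
    by (simp add: T B')
  have "run_plain (PrimRec A ?G) [k, enc x] = Some (enc (rec_nat (a x) (b x) k))" for k x
    by (induction k) (simp_all add: A T B')
  then have "run_plain (Comp (PrimRec A ?G) [N, Proj 0]) [enc x] = Some (enc (rec_nat (a x) (b x) (n x)))" for x
    by (simp add: N del: run.simps(6))
  then show ?thesis unfolding computable_def by blast
qed

text \<open>The branch for \<open>Some\<close> is only run on the code of a value: the primitive recursion on the
  \<open>0\<close>/\<open>1\<close>-valued indicator takes its step, which runs that branch, only if the indicator is \<open>1\<close>.\<close>

lemma computable_case_option [computable_intros]:
  fixes t :: "'a::coded \<Rightarrow> 'c::coded option" and g :: "'a \<Rightarrow> 'c \<Rightarrow> 'b::coded"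
  assumes "computable t" "computable f" "computable (\<lambda>p. g (fst p) (snd p))"
  shows "computable (\<lambda>x. case t x of None \<Rightarrow> f x | Some y \<Rightarrow> g x y)"
proof -
  have "recursive1 (\<lambda>x. 1 - (1 - x))" by (intro recursive1_comp2[OF recursive2_diff] recursive1_const recursive1_id)
  then obtain T F G P Q D where T: "\<And>x. run_plain T [enc x] = Some (enc (t x))"
    and F: "\<And>x. run_plain F [enc x] = Some (enc (f x))"
    and G: "\<And>p. run_plain G [enc p] = Some (enc (g (fst p) (snd p)))"
    and P: "\<And>x y. run_plain P [x, y] = Some (prod_encode (x, y))"
    and Q: "\<And>x. run_plain Q [x] = Some (1 - (1 - x))"
    and D: "\<And>x. run_plain D [x] = Some (x - 1)"
    using assms recursive2_pair recursive1_pred unfolding computable_def recursive2_def recursive1_def by metis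
  have G': "run_plain G [prod_encode (enc x, enc y)] = Some (enc (g x y))" for x y
    using G[of "(x, y)"] by (simp add: enc_Pair)
  let ?R = "PrimRec (Comp F [Proj 1]) (Comp G [Comp P [Proj 3, Comp D [Proj 2]]])"
  have "run_plain (Comp ?R [Comp Q [T], T, Proj 0]) [enc x] =
      Some (enc (case t x of None \<Rightarrow> f x | Some y \<Rightarrow> g x y))" for x
    by (cases "t x") (simp_all add: T Q F P D G')
  then show ?thesis unfolding computable_def by blast
qed

lemma computable_If [computable_intros]:
  assumes "computable b" "computable f" "computable g"
  shows "computable (\<lambda>x. if b x then f x else g x)"
proof -
  have "computable (\<lambda>x. if b x then Some (0::nat) else None)"
    by (rule computable_recode[OF assms(1)]) simp
  then have "computable (\<lambda>x. case (if b x then Some (0::nat) else None) of None \<Rightarrow> g x | Some y \<Rightarrow> f x)"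
    by (intro computable_intros assms computable_comp[OF assms(2)])
  also have "(\<lambda>x. case (if b x then Some (0::nat) else None) of None \<Rightarrow> g x | Some y \<Rightarrow> f x) =
      (\<lambda>x. if b x then f x else g x)" by auto
  finally show ?thesis .
qed

lemma computable_Some [computable_intros]: "computable f \<Longrightarrow> computable (\<lambda>x. Some (f x))"
  by (rule computable_recode[of "\<lambda>x. Suc (enc (f x))"]) (intro computable_intros, simp_all)

lemma computable_Cons [computable_intros]:
  "computable f \<Longrightarrow> computable g \<Longrightarrow> computable (\<lambda>x. f x # g x)"
  by (rule computable_recode[of "\<lambda>x. Some (f x, g x)"])
    (intro computable_intros, simp_all add: enc_Cons enc_Pair)

lemma computable_case_list [computable_intros]:
  fixes l :: "'a::coded \<Rightarrow> 'c::coded list" and g :: "'a \<Rightarrow> 'c \<Rightarrow> 'c list \<Rightarrow> 'b::coded"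
  assumes "computable l" "computable f" "computable (\<lambda>p. g (fst p) (fst (snd p)) (snd (snd p)))"
  shows "computable (\<lambda>x. case l x of [] \<Rightarrow> f x | y # ys \<Rightarrow> g x y ys)"
proof -
  let ?t = "\<lambda>x. case l x of [] \<Rightarrow> None | y # ys \<Rightarrow> Some (y, ys)"
  have "computable ?t"
    by (rule computable_recode[OF assms(1)]) (simp add: enc_Cons enc_Pair split: list.split)
  then have "computable (\<lambda>x. case ?t x of None \<Rightarrow> f x | Some q \<Rightarrow> g x (fst q) (snd q))"
    by (rule computable_case_option[OF _ assms(2,3)])
  also have "(\<lambda>x. case ?t x of None \<Rightarrow> f x | Some q \<Rightarrow> g x (fst q) (snd q)) =
      (\<lambda>x. case l x of [] \<Rightarrow> f x | y # ys \<Rightarrow> g x y ys)"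
    by (auto split: list.split)
  finally show ?thesis .
qed

lemma computable_Least [computable_intros]:
  fixes p :: "'a::coded \<Rightarrow> nat \<Rightarrow> bool"
  assumes "computable (\<lambda>q. p (fst q) (snd q))" "\<And>x. \<exists>n. p x n"
  shows "computable (\<lambda>x. LEAST n. p x n)"
proof -
  have "computable (\<lambda>q. \<not> p (fst q) (snd q))" by (intro computable_intros assms)
  then obtain P T where P: "\<And>q. run_plain P [enc q] = Some (enc (\<not> p (fst q) (snd q)))"
    and T: "\<And>x y. run_plain T [x, y] = Some (prod_encode (x, y))"
    using recursive2_pair unfolding computable_def recursive2_def by metis
  have P': "run_plain P [prod_encode (enc x, n)] = Some (if p x n then 0 else 1)" for x n
    using P[of "(x, n)"] by (simp add: enc_Pair enc_bool_def)
  have "run_plain (Mu (Comp P [Comp T [Proj 1, Proj 0]])) [enc x] = Some (enc (LEAST n. p x n))" for x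
    using assms(2)[of x] by (simp add: T P')
  then show ?thesis unfolding computable_def by blast
qed

text \<open>An algorithm that halts on all the arguments it is given may be used as a total function.\<close>

lemma computable_run1:
  assumes "computable g" "\<And>x. run_plain P [g x] \<noteq> None"
  shows "computable (\<lambda>x. the (run_plain P [g x]))"
proof -
  obtain Q where "\<And>x. run_plain Q [enc x] = Some (g x)" using assms(1) unfolding computable_def by auto
  then have "run_plain (Comp P [Q]) [enc x] = Some (enc (the (run_plain P [g x])))" for x
    using assms(2)[of x] by auto
  then show ?thesis unfolding computable_def by blast
qed

lemma computable_run2:
  assumes "computable g" "computable h" "\<And>x. run_plain P [g x, h x] \<noteq> None"
  shows "computable (\<lambda>x. the (run_plain P [g x, h x]))"
proof -
  obtain Q R where "\<And>x. run_plain Q [enc x] = Some (g x)" "\<And>x. run_plain R [enc x] = Some (h x)"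
    using assms(1,2) unfolding computable_def by auto
  then have "run_plain (Comp P [Q, R]) [enc x] = Some (enc (the (run_plain P [g x, h x])))" for x
    using assms(3)[of x] by auto
  then show ?thesis unfolding computable_def by blast
qed

subsection \<open>Lists\<close>

lemma length_le_enc: "length xs \<le> enc (xs :: 'a::coded list)"
proof (induction xs)
  case (Cons x xs)
  then show ?case using le_prod_encode_2[of "enc xs" "enc x"] by (simp add: enc_Cons)
qed simp

text \<open>The code of a list bounds its length, so it can serve as the number of iterations.\<close>

lemma computable_fold [computable_intros]:
  fixes f :: "'a::coded \<Rightarrow> 'c::coded \<Rightarrow> 'b::coded \<Rightarrow> 'b"
  assumes "computable (\<lambda>p. f (fst p) (fst (snd p)) (snd (snd p)))" "computable l" "computable i"
  shows "computable (\<lambda>x. fold (f x) (l x) (i x))"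
proof -
  define step where "step x st = (case fst st of [] \<Rightarrow> st | y # ys \<Rightarrow> (ys, f x y (snd st)))" for x st
  have step: "rec_nat (xs, s) (\<lambda>_. step x) k = ([], fold (f x) xs s)" if "length xs \<le> k" for x xs s k
  proof -
    have "rec_nat st (\<lambda>_. step x) k = (step x ^^ k) st" for st by (induction k) auto
    moreover have "(step x ^^ k) (xs, s) = ([], fold (f x) xs s)" using that
    proof (induction xs arbitrary: k s)
      case Nil
      then show ?case by (induction k) (auto simp: step_def)
    next
      case (Cons y ys)
      then obtain k' where k: "k = Suc k'" "length ys \<le> k'" by (cases k) auto
      have "step x (y # ys, s) = (ys, f x y s)" by (simp add: step_def)
      then show ?case using Cons.IH[OF k(2)] by (simp add: k(1) funpow_Suc_right del: funpow.simps)
    qed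
    ultimately show ?thesis by simp
  qed
  have "computable (\<lambda>x. snd (rec_nat (l x, i x) (\<lambda>_. step x) (enc (l x))))"
    unfolding step_def by (intro computable_intros assms computable_comp3[OF assms(1)])
  then show ?thesis by (simp add: step length_le_enc)
qed

lemma computable_rev [computable_intros]: "computable l \<Longrightarrow> computable (\<lambda>x. rev (l x))"
  unfolding rev_conv_fold by (intro computable_intros)

lemma computable_append [computable_intros]:
  assumes "computable l" "computable m" shows "computable (\<lambda>x. l x @ m x)"
proof -
  have "l x @ m x = fold (#) (rev (l x)) (m x)" for x
    unfolding foldr_conv_fold[symmetric] by (induction ("l x")) auto
  then show ?thesis by (simp only:) (intro computable_intros assms)
qed

lemma computable_map [computable_intros]:
  fixes f :: "'a::coded \<Rightarrow> 'c::coded \<Rightarrow> 'b::coded"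
  assumes "computable (\<lambda>p. f (fst p) (snd p))" "computable l"
  shows "computable (\<lambda>x. map (f x) (l x))"
proof -
  have "map (f x) ys = rev (fold (\<lambda>y s. f x y # s) ys [])" for x ys
  proof -
    have "fold (\<lambda>y s. f x y # s) ys s = rev (map (f x) ys) @ s" for s by (induction ys arbitrary: s) auto
    then show ?thesis by simp
  qed
  then show ?thesis using assms by (simp only:) (intro computable_intros assms computable_comp2[OF assms(1)])
qed

lemma computable_concat [computable_intros]:
  fixes l :: "'a::coded \<Rightarrow> 'c::coded list list"
  assumes "computable l" shows "computable (\<lambda>x. concat (l x))"
proof -
  have "fold (\<lambda>y s. s @ y) ys s = s @ concat ys" for ys and s :: "'c list" by (induction ys arbitrary: s) auto
  then have "concat ys = fold (\<lambda>y s. s @ y) ys []" for ys :: "'c list list" by simp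
  then show ?thesis by (simp only:) (intro computable_intros assms)
qed

lemma computable_length [computable_intros]:
  fixes l :: "'a::coded \<Rightarrow> 'c::coded list"
  assumes "computable l" shows "computable (\<lambda>x. length (l x))"
proof -
  have "fold (\<lambda>y s. Suc s) ys s = s + length ys" for ys :: "'c list" and s by (induction ys arbitrary: s) auto
  then have "length ys = fold (\<lambda>y s. Suc s) ys 0" for ys :: "'c list" by simp
  then show ?thesis by (simp only:) (intro computable_intros assms)
qed

lemma computable_list_all [computable_intros]:
  fixes p :: "'a::coded \<Rightarrow> 'c::coded \<Rightarrow> bool"
  assumes "computable (\<lambda>q. p (fst q) (snd q))" "computable l"
  shows "computable (\<lambda>x. list_all (p x) (l x))"
proof -
  have "fold (\<lambda>y s. s \<and> p x y) ys s = (s \<and> list_all (p x) ys)" for x ys s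
    by (induction ys arbitrary: s) auto
  then have "list_all (p x) ys = fold (\<lambda>y s. s \<and> p x y) ys True" for x ys by simp
  then show ?thesis by (simp only:) (intro computable_intros assms computable_comp2[OF assms(1)])
qed

lemma computable_find [computable_intros]:
  fixes p :: "'a::coded \<Rightarrow> 'c::coded \<Rightarrow> bool"
  assumes "computable (\<lambda>q. p (fst q) (snd q))" "computable l"
  shows "computable (\<lambda>x. List.find (p x) (l x))"
proof -
  define h where "h x y s = (case s of None \<Rightarrow> if p x y then Some y else None | Some z \<Rightarrow> Some z)" for x y s
  have "fold (h x) ys s = (case s of None \<Rightarrow> List.find (p x) ys | Some z \<Rightarrow> Some z)" for x ys s
    by (induction ys arbitrary: s) (auto simp: h_def split: option.split)
  then have "List.find (p x) ys = fold (h x) ys None" for x ys by simp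
  then show ?thesis unfolding h_def by (simp only:) (intro computable_intros assms computable_comp2[OF assms(1)])
qed

lemma computable_drop [computable_intros]:
  fixes l :: "'a::coded \<Rightarrow> 'c::coded list"
  assumes "computable n" "computable l" shows "computable (\<lambda>x. drop (n x) (l x))"
proof -
  have "drop k ys = rec_nat ys (\<lambda>_ l. case l of [] \<Rightarrow> [] | z # zs \<Rightarrow> zs) k" for k and ys :: "'c list"
  proof (induction k)
    case (Suc k)
    have "drop (Suc k) ys = tl (drop k ys)" by (simp add: drop_Suc tl_drop)
    then show ?case by (simp add: Suc[symmetric] split: list.split)
  qed simp
  then show ?thesis by (simp only:) (intro computable_intros assms)
qed

lemma computable_upt [computable_intros]:
  assumes "computable n" shows "computable (\<lambda>x. [0..<n x])"
proof -
  have "[0..<k] = rec_nat [] (\<lambda>m l. l @ [m]) k" for k by (induction k) auto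
  then show ?thesis by (simp only:) (intro computable_intros assms)
qed

lemma computable_n_lists [computable_intros]:
  fixes l :: "'a::coded \<Rightarrow> 'c::coded list"
  assumes "computable n" "computable l" shows "computable (\<lambda>x. List.n_lists (n x) (l x))"
proof -
  have "List.n_lists k ys = rec_nat [[]] (\<lambda>_ l. concat (map (\<lambda>zs. map (\<lambda>z. z # zs) ys) l)) k"
    for k and ys :: "'c list" by (induction k) auto
  then show ?thesis
    by (simp only:) (intro computable_intros assms computable_comp[OF assms(2)])
qed

subsection \<open>Numbers\<close>

lemma computable_div_2:
  assumes f: "computable f" shows "computable (\<lambda>x. f x div (2::nat))"
proof -
  have "n div 2 = (LEAST m. n < 2 * m + 2)" for n :: nat
    by (rule Least_equality[symmetric]) linarith+
  then have "computable (\<lambda>n::nat. n div 2)"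
    by (simp only:) (intro computable_intros, presburger)
  from computable_comp[OF this f] show ?thesis .
qed

lemma computable_case_sum [computable_intros]:
  fixes t :: "'a::coded \<Rightarrow> nat + nat" and f g :: "'a \<Rightarrow> nat \<Rightarrow> 'b::coded"
  assumes "computable t" "computable (\<lambda>p. f (fst p) (snd p))" "computable (\<lambda>p. g (fst p) (snd p))"
  shows "computable (\<lambda>x. case t x of Inl y \<Rightarrow> f x y | Inr z \<Rightarrow> g x z)"
proof -
  have "computable (\<lambda>x. if enc (t x) = 2 * (enc (t x) div 2) then f x (enc (t x) div 2) else g x (enc (t x) div 2))"
    by (intro computable_intros computable_div_2 assms
      computable_comp2[OF assms(2)] computable_comp2[OF assms(3)])
  moreover have "(if enc s = 2 * (enc s div 2) then f x (enc s div 2) else g x (enc s div 2)) =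
      (case s of Inl y \<Rightarrow> f x y | Inr z \<Rightarrow> g x z)" for x s
  proof (cases s)
    case (Inr n)
    have "Suc (2 * n) \<noteq> 2 * n" "Suc (2 * n) div 2 = n" by simp_all
    then show ?thesis by (simp add: Inr enc_sum_def sum_encode_def)
  qed (simp add: enc_sum_def sum_encode_def)
  ultimately show ?thesis by simp
qed

lemma computable_Inl [computable_intros]: "computable f \<Longrightarrow> computable (\<lambda>x. Inl (f x) :: nat + nat)"
  by (rule computable_recode[of "\<lambda>x. 2 * f x"])
    (intro computable_intros, simp_all add: enc_sum_def sum_encode_def)

lemma computable_Inr [computable_intros]: "computable f \<Longrightarrow> computable (\<lambda>x. Inr (f x) :: nat + nat)"
  by (rule computable_recode[of "\<lambda>x. Suc (2 * f x)"])
    (intro computable_intros, simp_all add: enc_sum_def sum_encode_def)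

lemma computable_nat_int_parts [computable_intros]:
  assumes "computable f"
  shows "computable (\<lambda>x. nat (f x))" "computable (\<lambda>x. nat (- f x))"
proof -
  let ?s = "\<lambda>x. if 0 \<le> f x then Inl (nat (f x)) else Inr (nat (- f x - 1))"
  have s: "computable ?s"
    by (rule computable_recode[OF assms]) (simp add: enc_int_def int_encode_def enc_sum_def)
  have "computable (\<lambda>x. case ?s x of Inl n \<Rightarrow> n | Inr m \<Rightarrow> 0)" by (intro computable_intros s)
  moreover have "(\<lambda>x. case ?s x of Inl n \<Rightarrow> n | Inr m \<Rightarrow> 0) = (\<lambda>x. nat (f x))" by auto
  ultimately show "computable (\<lambda>x. nat (f x))" by simp
  have "computable (\<lambda>x. case ?s x of Inl n \<Rightarrow> 0 | Inr m \<Rightarrow> Suc m)" by (intro computable_intros s)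
  moreover have "(\<lambda>x. case ?s x of Inl n \<Rightarrow> 0 | Inr m \<Rightarrow> Suc m) = (\<lambda>x. nat (- f x))"
    by (auto simp: fun_eq_iff)
  ultimately show "computable (\<lambda>x. nat (- f x))" by simp
qed

lemma computable_int_minus_int:
  assumes "computable f" "computable g"
  shows "computable (\<lambda>x. int (f x) - int (g x))"
  by (rule computable_recode[of "\<lambda>x. if g x \<le> f x then Inl (f x - g x) else Inr (g x - f x - 1)"])
    (intro computable_intros assms, auto simp: enc_int_def int_encode_def enc_sum_def nat_diff_distrib')

lemma computable_of_nat_int [computable_intros]: "computable f \<Longrightarrow> computable (\<lambda>x. int (f x))"
  using computable_int_minus_int[of f "\<lambda>_. 0"] by (simp add: computable_const)

lemma computable_int_add [computable_intros]:
  assumes "computable f" "computable g" shows "computable (\<lambda>x. f x + g x :: int)"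
proof -
  have "f x + g x = int (nat (f x) + nat (g x)) - int (nat (- f x) + nat (- g x))" for x by simp
  then show ?thesis by (simp only:) (intro computable_int_minus_int computable_intros assms)
qed

lemma computable_int_diff [computable_intros]:
  assumes "computable f" "computable g" shows "computable (\<lambda>x. f x - g x :: int)"
proof -
  have "f x - g x = int (nat (f x) + nat (- g x)) - int (nat (- f x) + nat (g x))" for x by simp
  then show ?thesis by (simp only:) (intro computable_int_minus_int computable_intros assms)
qed

lemma computable_int_mult [computable_intros]:
  assumes "computable f" "computable g" shows "computable (\<lambda>x. f x * g x :: int)"
proof -
  have "f x * g x = int (nat (f x) * nat (g x) + nat (- f x) * nat (- g x))
      - int (nat (f x) * nat (- g x) + nat (- f x) * nat (g x))" for x
    by (cases "0 \<le> f x"; cases "0 \<le> g x") (auto simp: nat_mult_distrib algebra_simps)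
  then show ?thesis by (simp only:) (intro computable_int_minus_int computable_intros assms)
qed

lemma computable_int_le [computable_intros]:
  assumes "computable f" "computable g" shows "computable (\<lambda>x. f x \<le> (g x :: int))"
proof -
  have "computable (\<lambda>x. nat (f x - g x) = 0)" by (intro computable_intros assms)
  then show ?thesis by simp
qed

lemma computable_prod_decode [computable_intros]: "computable f \<Longrightarrow> computable (\<lambda>x. prod_decode (f x))"
  by (erule computable_recode) (simp add: enc_prod_def)

lemma computable_list_decode [computable_intros]: "computable f \<Longrightarrow> computable (\<lambda>x. list_decode (f x))"
  by (erule computable_recode) (simp add: enc_list_def enc_nat_def)

lemma computable_int_decode [computable_intros]: "computable f \<Longrightarrow> computable (\<lambda>x. int_decode (f x))"
  by (erule computable_recode) (simp add: enc_int_def)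

lemma computable_sum_decode [computable_intros]: "computable f \<Longrightarrow> computable (\<lambda>x. sum_decode (f x))"
  by (erule computable_recode) (simp add: enc_sum_def enc_nat_def sum.map_ident)

text \<open>Equality of rational numbers given by codes is decidable, with \<open>Fract a 0 = 0\<close> as a separate case.
  This makes the least code of a rational number computable from any code.\<close>

lemma nat_to_rat_surj_eq_iff:
  "nat_to_rat_surj m = nat_to_rat_surj n \<longleftrightarrow>
    (let a = int_decode (fst (prod_decode m)); b = int_decode (snd (prod_decode m));
         c = int_decode (fst (prod_decode n)); d = int_decode (snd (prod_decode n))
     in if b = 0 \<or> d = 0 then (a = 0 \<or> b = 0) \<and> (c = 0 \<or> d = 0) else a * d = c * b)"
proof -
  have z: "Fract a 0 = 0" "Fract 0 b = 0" for a b :: int by (simp_all add: rat_number_collapse)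
  have z': "Fract a b = 0 \<longleftrightarrow> a = 0 \<or> b = 0" for a b :: int
  proof (cases "b = 0")
    case False
    have "Fract a b = Fract 0 1 \<longleftrightarrow> a = 0" using eq_rat(1)[OF False, of 1 a 0] by simp
    then show ?thesis using False unfolding Zero_rat_def by blast
  qed (simp add: z)
  have "Fract a b = Fract c d \<longleftrightarrow> (if b = 0 \<or> d = 0 then (a = 0 \<or> b = 0) \<and> (c = 0 \<or> d = 0) else a * d = c * b)"
    for a b c d :: int
  proof (cases "b = 0 \<or> d = 0")
    case True
    then show ?thesis by (metis z')
  next
    case False
    then show ?thesis by (simp add: eq_rat(1))
  qed
  then show ?thesis
    by (simp only: nat_to_rat_surj_def Let_def case_prod_unfold)
qed

lemma computable_nat_to_rat_surj [computable_intros]: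
  assumes "computable f" shows "computable (\<lambda>x. nat_to_rat_surj (f x))"
proof -
  have "computable (\<lambda>n. LEAST m. nat_to_rat_surj m = nat_to_rat_surj n)"
  proof (rule computable_Least)
    show "computable (\<lambda>q. nat_to_rat_surj (snd q) = nat_to_rat_surj (fst q))"
      unfolding nat_to_rat_surj_eq_iff Let_def by (intro computable_intros)
  qed blast
  then have "computable nat_to_rat_surj"
    by (rule computable_recode) (simp add: enc_rat_def)
  from computable_comp[OF this assms] show ?thesis .
qed

lemma computable_Fract [computable_intros]:
  assumes "computable f" "computable g" shows "computable (\<lambda>x. Fract (f x) (g x))"
proof -
  have "Fract a b = nat_to_rat_surj (enc (a, b))" for a b
    by (simp add: nat_to_rat_surj_def enc_Pair enc_int_def)
  then show ?thesis by (simp only:) (intro computable_intros assms)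
qed

text \<open>Numerator and denominator according to the code. Some codes have denominator \<open>0\<close>, which
  represents the number \<open>0\<close>; replacing it by \<open>0/1\<close> makes the usual formulas for fractions valid.\<close>

definition fraction :: "rat \<Rightarrow> int \<times> int" where
  "fraction r = (let a = int_decode (fst (prod_decode (enc r))); b = int_decode (snd (prod_decode (enc r)))
     in if b = 0 then (0, 1) else (a, b))"

lemma Fract_fraction: "Fract (fst (fraction r)) (snd (fraction r)) = r" "snd (fraction r) \<noteq> 0"
proof -
  have "nat_to_rat_surj (enc r) = r" by simp
  then show "Fract (fst (fraction r)) (snd (fraction r)) = r"
    unfolding nat_to_rat_surj_def fraction_def Let_def case_prod_unfold
    by (auto simp: rat_number_collapse)
  show "snd (fraction r) \<noteq> 0" by (auto simp: fraction_def Let_def)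
qed

lemma computable_fraction [computable_intros]: "computable f \<Longrightarrow> computable (\<lambda>x. fraction (f x))"
  unfolding fraction_def Let_def by (intro computable_intros)

lemma computable_rat_add [computable_intros]:
  assumes "computable f" "computable g" shows "computable (\<lambda>x. f x + g x :: rat)"
proof -
  have "r + s = Fract (fst (fraction r) * snd (fraction s) + fst (fraction s) * snd (fraction r))
      (snd (fraction r) * snd (fraction s))" for r s
    using Fract_fraction[of r] Fract_fraction[of s] by (metis add_rat)
  then show ?thesis by (simp only:) (intro computable_intros assms)
qed

lemma computable_rat_mult [computable_intros]:
  assumes "computable f" "computable g" shows "computable (\<lambda>x. f x * g x :: rat)"
proof -
  have "r * s = Fract (fst (fraction r) * fst (fraction s)) (snd (fraction r) * snd (fraction s))" for r s
    using Fract_fraction[of r] Fract_fraction[of s] by (metis mult_rat)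
  then show ?thesis by (simp only:) (intro computable_intros assms)
qed

lemma computable_rat_minus [computable_intros]:
  assumes "computable f" shows "computable (\<lambda>x. - f x :: rat)"
proof -
  have "computable (\<lambda>x. (-1) * f x)" by (intro computable_intros assms)
  then show ?thesis by simp
qed

lemma computable_rat_diff [computable_intros]:
  assumes "computable f" "computable g" shows "computable (\<lambda>x. f x - g x :: rat)"
  unfolding diff_conv_add_uminus by (intro computable_intros assms)

lemma computable_rat_inverse [computable_intros]:
  assumes "computable f" shows "computable (\<lambda>x. inverse (f x) :: rat)"
proof -
  have "inverse r = Fract (snd (fraction r)) (fst (fraction r))" for r
    using Fract_fraction[of r] by (metis inverse_rat)
  then show ?thesis by (simp only:) (intro computable_intros assms)
qed

lemma computable_rat_divide [computable_intros]:
  assumes "computable f" "computable g" shows "computable (\<lambda>x. f x / g x :: rat)"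
  unfolding divide_inverse by (intro computable_intros assms)

lemma computable_rat_le [computable_intros]:
  assumes "computable f" "computable g" shows "computable (\<lambda>x. f x \<le> (g x :: rat))"
proof -
  have "r \<le> s \<longleftrightarrow> (fst (fraction r) * snd (fraction s)) * (snd (fraction r) * snd (fraction s))
     \<le> (fst (fraction s) * snd (fraction r)) * (snd (fraction r) * snd (fraction s))" for r s
    using le_rat[OF Fract_fraction(2)[of r] Fract_fraction(2)[of s],
        of "fst (fraction r)" "fst (fraction s)"]
    unfolding Fract_fraction(1) .
  then show ?thesis by (simp only:) (intro computable_intros assms)
qed

lemma computable_rat_less [computable_intros]:
  assumes "computable f" "computable g" shows "computable (\<lambda>x. f x < (g x :: rat))"
  unfolding not_le[symmetric] by (intro computable_intros assms)

lemma computable_rat_abs [computable_intros]: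
  assumes "computable f" shows "computable (\<lambda>x. \<bar>f x :: rat\<bar>)"
  unfolding abs_if by (intro computable_intros assms)

lemma computable_rat_of_nat [computable_intros]:
  assumes "computable f" shows "computable (\<lambda>x. of_nat (f x) :: rat)"
  unfolding of_nat_rat by (intro computable_intros assms)

lemma computable_nat_power [computable_intros]:
  assumes "computable f" "computable n" shows "computable (\<lambda>x. f x ^ n x :: nat)"
proof -
  have "y ^ k = rec_nat 1 (\<lambda>_ r. y * r) k" for y k :: nat by (induction k) auto
  then show ?thesis by (simp only:) (intro computable_intros assms computable_comp[OF assms(1)])
qed

lemma computable_rat_power [computable_intros]:
  assumes "computable f" "computable n" shows "computable (\<lambda>x. f x ^ n x :: rat)"
proof -
  have "y ^ k = rec_nat 1 (\<lambda>_ r. y * r) k" for y :: rat and k by (induction k) auto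
  then show ?thesis by (simp only:) (intro computable_intros assms computable_comp[OF assms(1)])
qed

section \<open>Computations with a finite part of the oracle\<close>

text \<open>The list \<open>\<sigma>\<close> replaces the oracle, and its length also bounds every search. So bounded runs always
  stop and can be tried for one list after the other. The result \<open>None\<close> means that \<open>\<sigma>\<close> was too short
  or that there is no value.\<close>

primrec brun :: "algorithm \<Rightarrow> nat list \<Rightarrow> nat list \<Rightarrow> nat option" where
  "brun Zero = (\<lambda>\<sigma> xs. Some 0)"
| "brun Succ = (\<lambda>\<sigma> xs. case xs of [] \<Rightarrow> None | x # _ \<Rightarrow> Some (Suc x))"
| "brun (Proj i) = (\<lambda>\<sigma> xs. if i < length xs then Some (xs ! i) else None)"
| "brun Oracle = (\<lambda>\<sigma> xs. case xs of [] \<Rightarrow> None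
     | x # _ \<Rightarrow> if x < length \<sigma> then Some (\<sigma> ! x) else None)"
| "brun (Comp f gs) = (\<lambda>\<sigma> xs.
     Option.bind (those (map (\<lambda>r. r \<sigma> xs) (map brun gs))) (brun f \<sigma>))"
| "brun (PrimRec f g) = (\<lambda>\<sigma> xs. case xs of [] \<Rightarrow> None
     | n # ys \<Rightarrow> rec_nat (brun f \<sigma> ys)
         (\<lambda>m r. Option.bind r (\<lambda>y. brun g \<sigma> (m # y # ys))) n)"
| "brun (Mu f) = (\<lambda>\<sigma> xs.
     Option.bind (List.find (\<lambda>i. brun f \<sigma> (i # xs) = None \<or> brun f \<sigma> (i # xs) = Some 0) [0..<length \<sigma>])
       (\<lambda>i. if brun f \<sigma> (i # xs) = Some 0 then Some i else None))"

lemma find_upt_Some: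
  "List.find p [0..<n] = Some i \<Longrightarrow> i < n \<and> p i \<and> (\<forall>j<i. \<not> p j)"
  by (auto simp: find_Some_iff)

lemma those_map_Some_mono:
  assumes "those (map f gs) = Some ys" "\<And>g y. g \<in> set gs \<Longrightarrow> f g = Some y \<Longrightarrow> h g = Some y"
  shows "those (map h gs) = Some ys"
  using assms by (induction gs arbitrary: ys) (auto split: option.splits)

lemma brun_imp_run:
  assumes "\<And>i. i < length \<sigma> \<Longrightarrow> q i = \<sigma> ! i"
  shows "brun P \<sigma> xs = Some y \<Longrightarrow> run P q xs = Some y"
proof (induction P arbitrary: xs y)
  case Oracle
  then show ?case by (auto simp: assms split: list.splits if_splits)
next
  case (Comp f gs)
  then obtain ys where ys: "those (map (\<lambda>g. brun g \<sigma> xs) gs) = Some ys" "brun f \<sigma> ys = Some y"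
    by (auto simp: Option.bind_eq_Some_conv comp_def)
  have "those (map (\<lambda>g. run g q xs) gs) = Some ys"
    by (rule those_map_Some_mono[OF ys(1)]) (use Comp.IH(2) in blast)
  then show ?case using Comp.IH(1)[OF ys(2)] by (simp add: comp_def)
next
  case (PrimRec f g)
  then obtain n ys where xs: "xs = n # ys" by (auto split: list.splits)
  have "rec_nat (brun f \<sigma> ys) (\<lambda>m r. Option.bind r (\<lambda>y. brun g \<sigma> (m # y # ys))) n = Some y \<Longrightarrow>
    rec_nat (run f q ys) (\<lambda>m r. Option.bind r (\<lambda>y. run g q (m # y # ys))) n = Some y"
    by (induction n arbitrary: y) (auto simp: Option.bind_eq_Some_conv PrimRec.IH)
  then show ?case using PrimRec.prems by (simp add: xs)
next
  case (Mu f)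
  then obtain find: "List.find (\<lambda>i. brun f \<sigma> (i # xs) = None \<or> brun f \<sigma> (i # xs) = Some 0) [0..<length \<sigma>] = Some y"
    and y: "brun f \<sigma> (y # xs) = Some 0"
    by (auto simp: Option.bind_eq_Some_conv split: if_splits)
  have less: "brun f \<sigma> (j # xs) \<noteq> None \<and> brun f \<sigma> (j # xs) \<noteq> Some 0" if "j < y" for j
    using find_upt_Some[OF find] that by auto
  have less': "run f q (j # xs) \<noteq> None \<and> run f q (j # xs) \<noteq> Some 0" if "j < y" for j
    using less[OF that] Mu.IH[of "j # xs"] by fastforce
  have y': "run f q (y # xs) = Some 0" by (rule Mu.IH[OF y])
  have "(LEAST n. run f q (n # xs) = Some 0) = y"
  proof (rule Least_equality[where P = "\<lambda>n. run f q (n # xs) = Some 0"])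
    show "run f q (y # xs) = Some 0" by (rule y')
    show "y \<le> j" if "run f q (j # xs) = Some 0" for j using less'[of j] that not_le by blast
  qed
  then show ?case using y' less' by auto
qed (auto split: list.splits if_splits)

lemma those_eq_Some_imp:
  "those (map f gs) = Some ys \<Longrightarrow> g \<in> set gs \<Longrightarrow> \<exists>y. f g = Some y"
  by (induction gs arbitrary: ys) (auto split: option.splits)

text \<open>The use principle: a halting computation only consults finitely many values of the oracle.\<close>

lemma run_imp_eventually_brun:
  "run P q xs = Some y \<Longrightarrow> eventually (\<lambda>n. brun P (map q [0..<n]) xs = Some y) sequentially"
proof (induction P arbitrary: xs y)
  case Oracle
  then obtain x ys where xs: "xs = x # ys" "y = q x" by (auto split: list.splits)
  show ?case using eventually_gt_at_top[of x] by eventually_elim (simp add: xs)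
next
  case (Comp f gs)
  then obtain ys where ys: "those (map (\<lambda>g. run g q xs) gs) = Some ys" "run f q ys = Some y"
    by (auto simp: Option.bind_eq_Some_conv comp_def)
  have "\<forall>g\<in>set gs. eventually (\<lambda>n. \<forall>z. run g q xs = Some z \<longrightarrow> brun g (map q [0..<n]) xs = Some z) sequentially"
  proof
    fix g assume g: "g \<in> set gs"
    then obtain z where z: "run g q xs = Some z" using those_eq_Some_imp[OF ys(1)] by blast
    from Comp.IH(2)[OF g this]
    show "eventually (\<lambda>n. \<forall>z. run g q xs = Some z \<longrightarrow> brun g (map q [0..<n]) xs = Some z) sequentially"
      by eventually_elim (simp add: z)
  qed
  then have "eventually (\<lambda>n. \<forall>g\<in>set gs. \<forall>z. run g q xs = Some z \<longrightarrow> brun g (map q [0..<n]) xs = Some z) sequentially"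
    by (intro eventually_ball_finite) auto
  with Comp.IH(1)[OF ys(2)] show ?case
  proof eventually_elim
    case (elim n)
    have "those (map (\<lambda>g. brun g (map q [0..<n]) xs) gs) = Some ys"
      by (rule those_map_Some_mono[OF ys(1)]) (use elim in blast)
    then show ?case using elim by (simp add: comp_def)
  qed
next
  case (PrimRec f g)
  then obtain n ys where xs: "xs = n # ys" by (auto split: list.splits)
  have "rec_nat (run f q ys) (\<lambda>m r. Option.bind r (\<lambda>y. run g q (m # y # ys))) n = Some y \<Longrightarrow>
    eventually (\<lambda>k. rec_nat (brun f (map q [0..<k]) ys)
      (\<lambda>m r. Option.bind r (\<lambda>y. brun g (map q [0..<k]) (m # y # ys))) n = Some y) sequentially" for y
  proof (induction n arbitrary: y)
    case 0
    then show ?case using PrimRec.IH(1) by simp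
  next
    case (Suc n)
    then obtain z where z: "rec_nat (run f q ys) (\<lambda>m r. Option.bind r (\<lambda>y. run g q (m # y # ys))) n = Some z"
      "run g q (n # z # ys) = Some y" by (auto simp: Option.bind_eq_Some_conv)
    from Suc.IH[OF z(1)] PrimRec.IH(2)[OF z(2)] show ?case
      by eventually_elim simp
  qed
  then show ?case using PrimRec.prems by (simp add: xs)
next
  case (Mu f)
  then have ex: "\<exists>n. run f q (n # xs) = Some 0 \<and> (\<forall>m<n. run f q (m # xs) \<noteq> None)"
    and y: "y = (LEAST n. run f q (n # xs) = Some 0)" by (auto split: if_splits)
  have y0: "run f q (y # xs) = Some 0"
    unfolding y using ex LeastI_ex[of "\<lambda>n. run f q (n # xs) = Some 0"] by blast
  have less: "\<exists>z. run f q (j # xs) = Some z \<and> z \<noteq> 0" if "j < y" for j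
  proof -
    obtain n where n: "run f q (n # xs) = Some 0" "\<forall>m<n. run f q (m # xs) \<noteq> None" using ex by blast
    have "y \<le> n" unfolding y using n(1) by (rule Least_le[of "\<lambda>n. run f q (n # xs) = Some 0"])
    then have "run f q (j # xs) \<noteq> None" using n that by simp
    moreover have "run f q (j # xs) \<noteq> Some 0"
      using that unfolding y by (rule not_less_Least[of j "\<lambda>n. run f q (n # xs) = Some 0"])
    ultimately show ?thesis by auto
  qed
  have "\<forall>j\<in>{..<y}. eventually (\<lambda>n. \<exists>z. brun f (map q [0..<n]) (j # xs) = Some z \<and> z \<noteq> 0) sequentially"
  proof
    fix j assume "j \<in> {..<y}"
    then obtain z where z: "run f q (j # xs) = Some z" "z \<noteq> 0" using less by auto
    from Mu.IH[OF z(1)]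
    show "eventually (\<lambda>n. \<exists>z. brun f (map q [0..<n]) (j # xs) = Some z \<and> z \<noteq> 0) sequentially"
      by eventually_elim (use z(2) in blast)
  qed
  then have "eventually (\<lambda>n. \<forall>j\<in>{..<y}. \<exists>z. brun f (map q [0..<n]) (j # xs) = Some z \<and> z \<noteq> 0) sequentially"
    by (intro eventually_ball_finite) auto
  with Mu.IH[OF y0] eventually_gt_at_top[of y] show ?case
  proof eventually_elim
    case (elim n)
    let ?p = "\<lambda>i. brun f (map q [0..<n]) (i # xs) = None \<or> brun f (map q [0..<n]) (i # xs) = Some 0"
    have "List.find ?p [0..<n] = Some y"
      unfolding find_Some_iff using elim by (intro exI[of _ y]) (auto, force)
    then show ?case using elim by simp
  qed
qed (auto split: list.splits if_splits intro!: always_eventually)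

lemma computable_bind [computable_intros]:
  fixes t :: "'a::coded \<Rightarrow> 'c::coded option" and g :: "'a \<Rightarrow> 'c \<Rightarrow> 'b::coded option"
  assumes "computable t" "computable (\<lambda>p. g (fst p) (snd p))"
  shows "computable (\<lambda>x. Option.bind (t x) (g x))"
proof -
  have "Option.bind o' h = (case o' of None \<Rightarrow> None | Some y \<Rightarrow> h y)" for o' and h :: "'c \<Rightarrow> 'b option"
    by (cases o') auto
  then show ?thesis using assms by (simp only:) (intro computable_intros)
qed

lemma computable_brun_uncurried:
  "computable (\<lambda>z. brun P (fst z) (snd z))"
proof (induction P)
  case Zero
  show ?case by (simp, intro computable_intros)
next
  case Succ
  show ?case by (simp, intro computable_intros)
next
  case (Proj i)
  have "(if i < length xs then Some (xs ! i) else None) = (case drop i xs of [] \<Rightarrow> None | y # ys \<Rightarrow> Some y)"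
    for xs :: "nat list" by (auto simp: Cons_nth_drop_Suc[symmetric])
  then show ?case by (simp only: brun.simps) (intro computable_intros)
next
  case Oracle
  have "(if i < length xs then Some (xs ! i) else None) = (case drop i xs of [] \<Rightarrow> None | y # ys \<Rightarrow> Some y)"
    for xs :: "nat list" and i by (auto simp: Cons_nth_drop_Suc[symmetric])
  then show ?case by (simp only: brun.simps) (intro computable_intros)
next
  case (Comp f gs)
  have "computable (\<lambda>z. those (map (\<lambda>g. brun g (fst z) (snd z)) gs))" using Comp(2)
  proof (induction gs)
    case (Cons g gs)
    have g: "computable (\<lambda>z. brun g (fst z) (snd z))" using Cons.prems by simp
    have "those (map (\<lambda>g. brun g (fst z) (snd z)) (g # gs)) =
        Option.bind (brun g (fst z) (snd z)) (\<lambda>y.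
          Option.bind (those (map (\<lambda>g. brun g (fst z) (snd z)) gs)) (\<lambda>ys. Some (y # ys)))" for z
      by (cases "those (map (\<lambda>g. brun g (fst z) (snd z)) gs)") (auto split: option.split)
    moreover have "computable (\<lambda>z. Option.bind (brun g (fst z) (snd z)) (\<lambda>y.
          Option.bind (those (map (\<lambda>g. brun g (fst z) (snd z)) gs)) (\<lambda>ys. Some (y # ys))))"
      by (intro computable_intros g computable_comp[OF Cons.IH, of fst]) (use Cons.prems in auto)
    ultimately show ?case by simp
  qed (simp, intro computable_intros)
  then have "computable (\<lambda>z. Option.bind (those (map (\<lambda>g. brun g (fst z) (snd z)) gs)) (brun f (fst z)))"
    by (intro computable_intros computable_comp2[OF Comp(1)])
  then show ?case by (simp add: comp_def)
next
  case (PrimRec f g)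
  show ?case by (simp only: brun.simps) (intro computable_intros computable_comp2[OF PrimRec(1)] computable_comp2[OF PrimRec(2)])
next
  case (Mu f)
  show ?case by (simp only: brun.simps) (intro computable_intros computable_comp2[OF Mu])
qed

lemma computable_brun [computable_intros]:
  "computable F \<Longrightarrow> computable G \<Longrightarrow> computable (\<lambda>x. brun P (F x) (G x))"
  by (rule computable_comp2[OF computable_brun_uncurried])

section \<open>Computing with codes of generated points\<close>

text \<open>Representing polynomials by types whose codes are among the codes of generated points turns
  operations on codes into ordinary list functions. A word is split into its first letter and the rest,
  as in its code.\<close>

type_synonym gauss = "rat \<times> rat"
type_synonym star_term = "gauss \<times> (nat + nat) \<times> (nat + nat) list"

definition gval :: "gauss \<Rightarrow> complex" where
  "gval c = Complex (of_rat (fst c)) (of_rat (snd c))"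

definition tval :: "star_term \<Rightarrow> complex \<times> (nat + nat) list" where
  "tval t = (gval (fst t), fst (snd t) # snd (snd t))"

text \<open>Decoding of arbitrary codes, whose coefficients need not be the least codes of rational numbers.\<close>

definition dec_gauss :: "nat \<Rightarrow> gauss" where
  "dec_gauss n = (nat_to_rat_surj (fst (prod_decode n)), nat_to_rat_surj (snd (prod_decode n)))"

definition dec_term :: "nat \<Rightarrow> star_term" where
  "dec_term n = (dec_gauss (fst (prod_decode n)),
     sum_decode (fst (prod_decode (snd (prod_decode n)))),
     map sum_decode (list_decode (snd (prod_decode (snd (prod_decode n))))))"

definition dec_poly :: "nat \<Rightarrow> star_term list" where
  "dec_poly e = map dec_term (list_decode e)"

lemma computable_dec_gauss [computable_intros]: "computable f \<Longrightarrow> computable (\<lambda>x. dec_gauss (f x))"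
  unfolding dec_gauss_def by (intro computable_intros)

lemma computable_dec_poly [computable_intros]: "computable f \<Longrightarrow> computable (\<lambda>x. dec_poly (f x))"
  unfolding dec_poly_def dec_term_def by (intro computable_intros)

lemma decode_gaussian_eq_gval: "decode_gaussian n = gval (dec_gauss n)"
  by (simp add: decode_gaussian_def gval_def dec_gauss_def case_prod_unfold)

lemma decode_poly_eq_dec_poly: "decode_poly e = map tval (dec_poly e)"
  by (simp add: decode_poly_def dec_poly_def decode_term_def decode_word_def tval_def dec_term_def
      case_prod_unfold decode_gaussian_eq_gval)

lemma dec_gauss_enc [simp]: "dec_gauss (enc c) = c"
  by (simp add: dec_gauss_def enc_prod_def)

lemma dec_poly_enc [simp]: "dec_poly (enc p) = p"
proof -
  have s: "sum_decode (enc x) = x" for x :: "nat + nat"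
    by (simp add: enc_sum_def enc_nat_def sum.map_ident)
  have "dec_term (enc t) = t" for t
  proof -
    obtain c x xs where "t = (c, x, xs)" by (cases t)
    then show ?thesis by (simp add: dec_term_def enc_Pair enc_list_def s comp_def)
  qed
  then show ?thesis by (simp add: dec_poly_def enc_list_def comp_def)
qed

lemma gval_Pair:
  "gval (a, b) = Complex (of_rat a) (of_rat b)"
  by (simp add: gval_def)

definition gmul :: "gauss \<Rightarrow> gauss \<Rightarrow> gauss" where
  "gmul c d = (fst c * fst d - snd c * snd d, fst c * snd d + snd c * fst d)"

lemma gval_gmul: "gval (gmul c d) = gval c * gval d"
  by (simp add: gval_def gmul_def of_rat_diff of_rat_add of_rat_mult complex_eq_iff)

definition pscale :: "gauss \<Rightarrow> star_term list \<Rightarrow> star_term list" where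
  "pscale c p = map (\<lambda>t. (gmul c (fst t), snd t)) p"

definition tmul :: "star_term \<Rightarrow> star_term \<Rightarrow> star_term" where
  "tmul t u = (gmul (fst t) (fst u), fst (snd t), snd (snd t) @ fst (snd u) # snd (snd u))"

definition pmul :: "star_term list \<Rightarrow> star_term list \<Rightarrow> star_term list" where
  "pmul p q = concat (map (\<lambda>t. map (tmul t) q) p)"

definition adjoint_letter :: "nat + nat \<Rightarrow> nat + nat" where
  "adjoint_letter x = (case x of Inl i \<Rightarrow> Inr i | Inr i \<Rightarrow> Inl i)"

definition tstar :: "star_term \<Rightarrow> star_term" where
  "tstar t = ((fst (fst t), - snd (fst t)),
     (case rev (map adjoint_letter (fst (snd t) # snd (snd t))) of [] \<Rightarrow> snd t | y # ys \<Rightarrow> (y, ys)))"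

lemma computable_gmul [computable_intros]:
  "computable f \<Longrightarrow> computable g \<Longrightarrow> computable (\<lambda>x. gmul (f x) (g x))"
  unfolding gmul_def by (intro computable_intros)

lemma computable_pscale [computable_intros]:
  assumes "computable f" "computable g" shows "computable (\<lambda>x. pscale (f x) (g x))"
proof -
  have "computable (\<lambda>z. pscale (fst z) (snd z))"
    unfolding pscale_def by (intro computable_intros)
  from computable_comp2[OF this assms] show ?thesis .
qed

lemma computable_pmul [computable_intros]:
  assumes "computable f" "computable g" shows "computable (\<lambda>x. pmul (f x) (g x))"
proof -
  have "computable (\<lambda>z. pmul (fst z) (snd z))"
    unfolding pmul_def tmul_def by (intro computable_intros)
  from computable_comp2[OF this assms] show ?thesis .
qed

lemma computable_map_tstar [computable_intros]:
  "computable f \<Longrightarrow> computable (\<lambda>x. map tstar (f x))"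
  unfolding tstar_def adjoint_letter_def by (intro computable_intros)

subsection \<open>Values\<close>

definition valid :: "'a::unital_cstar_algebra presentation \<Rightarrow> star_term list \<Rightarrow> bool" where
  "valid A p \<longleftrightarrow> (\<forall>t\<in>set p. \<forall>x\<in>set (snd (tval t)). enat (letter_index x) < num A)"

definition word_value :: "'a::unital_cstar_algebra presentation \<Rightarrow> (nat + nat) list \<Rightarrow> 'a" where
  "word_value A w = prod_list (map (letter_value (point A)) w)"

definition value_of :: "'a::unital_cstar_algebra presentation \<Rightarrow> star_term list \<Rightarrow> 'a" where
  "value_of A p = (\<Sum>t\<leftarrow>p. gval (fst t) *\<^sub>C word_value A (fst (snd t) # snd (snd t)))"

text \<open>With \<open>dec_poly_enc\<close>, this makes \<open>enc p\<close> a code of \<open>value_of A p\<close> for every valid \<open>p\<close>.\<close>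

lemma is_code_of_iff: "is_code_of A e \<rho> \<longleftrightarrow> valid A (dec_poly e) \<and> \<rho> = value_of A (dec_poly e)"
  unfolding is_code_of_def decode_poly_eq_dec_poly valid_def poly_indices_def poly_value_def value_of_def
    word_value_def
  by (auto simp: tval_def case_prod_unfold comp_def)

lemma valid_append [simp]: "valid A (p @ q) \<longleftrightarrow> valid A p \<and> valid A q"
  by (auto simp: valid_def)

lemma valid_Nil [simp]: "valid A []"
  by (simp add: valid_def)

lemma valid_concat: "(\<And>p. p \<in> set ps \<Longrightarrow> valid A p) \<Longrightarrow> valid A (concat ps)"
  by (auto simp: valid_def)

lemma valid_pscale [simp]: "valid A p \<Longrightarrow> valid A (pscale c p)"
  by (auto simp: valid_def pscale_def tval_def)

lemma valid_pmul [simp]: "valid A p \<Longrightarrow> valid A q \<Longrightarrow> valid A (pmul p q)"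
  by (fastforce simp: valid_def pmul_def tmul_def tval_def)

lemma tstar_word: "snd (tval (tstar t)) = rev (map adjoint_letter (snd (tval t)))"
  by (auto simp: tstar_def tval_def split: list.splits)

lemma valid_tstar [simp]: "valid A p \<Longrightarrow> valid A (map tstar p)"
proof -
  have "letter_index (adjoint_letter x) = letter_index x" for x
    by (cases x) (simp_all add: adjoint_letter_def)
  then show "valid A p \<Longrightarrow> valid A (map tstar p)"
    by (auto simp: valid_def tstar_word)
qed

lemma value_Nil [simp]: "value_of A [] = 0"
  by (simp add: value_of_def)

lemma value_append [simp]: "value_of A (p @ q) = value_of A p + value_of A q"
  by (simp add: value_of_def)

lemma value_concat: "value_of A (concat ps) = (\<Sum>p\<leftarrow>ps. value_of A p)"
  by (induction ps) simp_all

lemma value_pscale [simp]: "value_of A (pscale c p) = gval c *\<^sub>C value_of A p"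
  by (induction p) (simp_all add: value_of_def pscale_def gval_gmul scaleC_scaleC scaleC_add_right)

lemma value_pmul [simp]: "value_of A (pmul p q) = value_of A p * value_of A q"
proof (induction p)
  case (Cons t p)
  have "value_of A (map (tmul t) q) = (gval (fst t) *\<^sub>C word_value A (fst (snd t) # snd (snd t))) * value_of A q"
    by (induction q) (simp_all add: value_of_def tmul_def gval_gmul word_value_def scaleC_scaleC
        mult_scaleC_left mult_scaleC_right distrib_left mult.assoc mult.commute[of "gval (fst t)"])
  then show ?case using Cons by (simp add: pmul_def) (simp add: value_of_def distrib_right)
qed (simp add: pmul_def)

lemma value_tstar [simp]: "value_of A (map tstar p) = star (value_of A p)"
proof (induction p)
  case (Cons t p)
  have l: "star (letter_value (point A) x) = letter_value (point A) (adjoint_letter x)" for x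
    by (cases x) (simp_all add: adjoint_letter_def star_star)
  have w: "star (word_value A w) = word_value A (rev (map adjoint_letter w))" for w
    by (induction w) (simp_all add: word_value_def star_mult l)
  have "gval (fst (tstar t)) = cnj (gval (fst t))"
    by (simp add: tstar_def gval_def complex_eq_iff of_rat_minus)
  then show ?case using Cons w[of "snd (tval t)"] tstar_word[of t]
    by (simp add: value_of_def star_add star_scaleC tval_def)
qed simp

subsection \<open>Computable points\<close>

definition approximates :: "'a::unital_cstar_algebra presentation \<Rightarrow> (nat \<Rightarrow> star_term list) \<Rightarrow> 'a \<Rightarrow> bool" where
  "approximates A E x \<longleftrightarrow> computable E \<and> (\<forall>k. valid A (E k) \<and> norm (x - value_of A (E k)) \<le> (1/2) ^ k)"

lemma computable_point_imp_approximates: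
  assumes "computable_point A x"
  obtains E where "approximates A E x"
proof -
  obtain P where P: "\<And>k. \<exists>e \<rho>. run_plain P [k] = Some e \<and> is_code_of A e \<rho> \<and> norm (x - \<rho>) < (1/2) ^ k"
    using assms unfolding computable_point_def by blast
  have "computable (\<lambda>k::nat. the (run_plain P [k]))"
  proof (rule computable_run1[OF computable_id])
    show "run_plain P [k] \<noteq> None" for k using P[of k] by auto
  qed
  then have "approximates A (\<lambda>k. dec_poly (the (run_plain P [k]))) x"
    unfolding approximates_def
  proof (intro conjI allI computable_intros)
    fix k
    show "valid A (dec_poly (the (run_plain P [k])))"
      and "norm (x - value_of A (dec_poly (the (run_plain P [k])))) \<le> (1/2) ^ k"
      using P[of k] by (auto simp: is_code_of_iff)
  qed
  then show thesis by (rule that)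
qed

lemma computable_pointI:
  assumes "computable p" "\<And>k. valid A (p k)" "\<And>k. norm (x - value_of A (p k)) < (1/2) ^ k"
  shows "computable_point A x"
proof -
  obtain P where "\<And>k. run_plain P [k] = Some (enc (p k))"
    using assms(1) unfolding computable_def by auto
  then show ?thesis using assms(2,3)
    unfolding computable_point_def by (intro exI[of _ P]) (auto simp: is_code_of_iff)
qed

lemma approximates_add:
  assumes "approximates A E x" "approximates A G y"
  shows "approximates A (\<lambda>k. E (Suc k) @ G (Suc k)) (x + y)"
proof -
  have c: "computable (\<lambda>k. E (Suc k))" "computable (\<lambda>k. G (Suc k))"
    using assms unfolding approximates_def
    using computable_comp[of E Suc, OF _ computable_Suc[OF computable_id]]
      computable_comp[of G Suc, OF _ computable_Suc[OF computable_id]] by auto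
  have "norm (x + y - (value_of A (E (Suc k)) + value_of A (G (Suc k)))) \<le> (1/2) ^ k" for k
  proof -
    have "norm ((x - value_of A (E (Suc k))) + (y - value_of A (G (Suc k)))) \<le> (1/2) ^ Suc k + (1/2) ^ Suc k"
      using assms unfolding approximates_def by (intro norm_triangle_mono) blast+
    then show ?thesis by (simp add: algebra_simps)
  qed
  then show ?thesis using assms c unfolding approximates_def by (auto intro: computable_intros)
qed

text \<open>The precision is raised by a fixed number \<open>j\<close> of bits with \<open>\<bar>c\<bar> \<le> 2\<^sup>j\<close>.\<close>

lemma approximates_scale:
  assumes "approximates A E x"
  obtains G where "approximates A G (gval c *\<^sub>C x)"
proof -
  obtain j :: nat where "cmod (gval c) < real j" using reals_Archimedean2 by blast
  also have "real j \<le> 2 ^ j" using less_exp[of j] by (metis less_imp_le of_nat_le_iff of_nat_numeral of_nat_power)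
  finally have j: "cmod (gval c) \<le> 2 ^ j" by simp
  have "computable (\<lambda>k. E (k + j))"
    using assms unfolding approximates_def
    by (auto intro!: computable_comp[of E "\<lambda>k. k + j"] computable_intros)
  moreover have "norm (gval c *\<^sub>C x - gval c *\<^sub>C value_of A (E (k + j))) \<le> (1/2) ^ k" for k
  proof -
    have "norm (gval c *\<^sub>C (x - value_of A (E (k + j)))) \<le> 2 ^ j * (1/2) ^ (k + j)"
      unfolding norm_scaleC using assms j unfolding approximates_def by (intro mult_mono) auto
    also have "\<dots> = (1/2) ^ k" by (simp add: power_add field_simps flip: power_mult_distrib)
    finally show ?thesis by (simp add: scaleC_diff_right)
  qed
  ultimately have "approximates A (\<lambda>k. pscale c (E (k + j))) (gval c *\<^sub>C x)"
    using assms unfolding approximates_def by (auto intro: computable_intros)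
  then show thesis by (rule that)
qed

lemma approximates_star:
  assumes "approximates A E x"
  shows "approximates A (\<lambda>k. map tstar (E k)) (star x)"
  using assms unfolding approximates_def
  by (auto intro: computable_intros simp flip: star_diff)

lemma ex_gval_i_power: "\<exists>c. gval c = \<i> ^ l"
proof (induction l)
  case 0
  show ?case by (intro exI[of _ "(1, 0)"]) (simp add: gval_def complex_eq_iff)
next
  case (Suc l)
  then obtain c where "gval c = \<i> ^ l" by blast
  then have "gval (gmul (0, 1) c) = \<i> ^ Suc l"
    by (simp add: gval_gmul gval_Pair complex_eq_iff)
  then show ?case by blast
qed

lemma gval_of_rat: "gval (r, 0) = complex_of_real (of_rat r)"
  by (simp add: gval_def complex_eq_iff)

lemma gval_cnj: "gval (fst c, - snd c) = cnj (gval c)"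
  by (simp add: gval_def complex_eq_iff of_rat_minus)

lemma ex_approximates_weight:
  assumes "approximates A U 1" "approximates A E a"
  obtains G where "approximates A G (weight (real S) a l)"
proof -
  obtain c where c: "gval c = \<i> ^ l" using ex_gval_i_power by blast
  obtain G1 where G1: "approximates A G1 (gval (1/4, 0) *\<^sub>C 1)"
    using approximates_scale[OF assms(1)] by blast
  obtain G2 where G2: "approximates A G2 (gval (gmul (1 / (8 * of_nat S), 0) (fst c, - snd c)) *\<^sub>C a)"
    using approximates_scale[OF assms(2)] by blast
  obtain G3 where G3: "approximates A G3 (gval (gmul (1 / (8 * of_nat S), 0) c) *\<^sub>C star a)"
    using approximates_scale[OF approximates_star[OF assms(2)]] by blast
  have r: "gval (1/4, 0) = complex_of_real (1/4)" "gval (1 / (8 * of_nat S), 0) = complex_of_real (1 / (8 * real S))"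
    by (simp_all add: gval_of_rat of_rat_divide of_rat_mult)
  have eq: "weight (real S) a l = gval (1/4, 0) *\<^sub>C 1 +
      (gval (gmul (1 / (8 * of_nat S), 0) (fst c, - snd c)) *\<^sub>C a + gval (gmul (1 / (8 * of_nat S), 0) c) *\<^sub>C star a)"
    unfolding gval_gmul r gval_cnj c weight_def scaleR_conv_scaleC scaleC_add_right scaleC_scaleC ..
  show thesis by (rule that, unfold eq, rule approximates_add[OF G1 approximates_add[OF G2 G3]])
qed

text \<open>As there are only four letters, the letter can be made an input of the algorithm by case
  distinction.\<close>

lemma ex_approximates_weights:
  assumes "approximates A U 1" "approximates A E (a::'a::unital_cstar_algebra)"
  obtains G where "computable (\<lambda>z. G (fst z) (snd z))"
    "\<And>k l. valid A (G k l)"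
    "\<And>k l. l < 4 \<Longrightarrow> norm (weight (real S) a l - value_of A (G k l)) \<le> (1/2) ^ k"
proof -
  obtain H where H: "\<And>l. approximates A (H l) (weight (real S) a l)"
  proof -
    have "\<exists>G. approximates A G (weight (real S) a l)" for l
      using ex_approximates_weight[OF assms] by metis
    then show ?thesis using that by metis
  qed
  have cH: "computable (\<lambda>z. H l (fst z))" for l
    using H[of l] computable_comp[of "H l", OF _ computable_fst[OF computable_id]]
    unfolding approximates_def by blast
  define G where "G k l = (if l = 0 then H 0 k else if l = 1 then H 1 k else if l = 2 then H 2 k else H 3 k)"
    for k and l :: nat
  show thesis
  proof
    show "computable (\<lambda>z. G (fst z) (snd z))"
      unfolding G_def by (intro computable_intros cH)
    show "valid A (G k l)" for k l using H unfolding G_def approximates_def by simp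
    fix k l :: nat assume "l < 4"
    then consider "l = 0" | "l = 1" | "l = 2" | "l = 3" by linarith
    then show "norm (weight (real S) a l - value_of A (G k l)) \<le> (1/2) ^ k"
      using H[of l] unfolding approximates_def by cases (simp_all add: G_def)
  qed
qed

text \<open>Products of approximate weights; the approximate unit at the end stands for the empty product,
  since polynomials have no constant term.\<close>

definition bern_poly :: "(nat \<Rightarrow> nat \<Rightarrow> star_term list) \<Rightarrow> (nat \<Rightarrow> star_term list) \<Rightarrow> nat \<Rightarrow> nat list \<Rightarrow> star_term list" where
  "bern_poly G U k s = fold (\<lambda>l q. pmul (G k l) q) (rev s) (U k)"

lemma bern_poly_simps [simp]:
  "bern_poly G U k [] = U k" "bern_poly G U k (l # s) = pmul (G k l) (bern_poly G U k s)"
  by (simp_all add: bern_poly_def)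

lemma computable_bern_poly:
  assumes "computable (\<lambda>z. G (fst z) (snd z))" "computable U" "computable f" "computable g"
  shows "computable (\<lambda>x. bern_poly G U (f x) (g x))"
proof -
  have "computable (\<lambda>z. bern_poly G U (fst z) (snd z))"
    unfolding bern_poly_def
    by (intro computable_intros computable_comp2[OF assms(1)] computable_comp[OF assms(2)])
  from computable_comp2[OF this assms(3,4)] show ?thesis .
qed

lemma valid_bern_poly:
  "(\<And>l. valid A (G k l)) \<Longrightarrow> valid A (U k) \<Longrightarrow> valid A (bern_poly G U k s)"
  by (induction s) simp_all

lemma norm_weight_le:
  assumes "norm (a::'a::unital_cstar_algebra) \<le> S" "0 < S"
  shows "norm (weight S a l) \<le> 1"
proof -
  have "norm (cnj (\<i> ^ l) *\<^sub>C a + \<i> ^ l *\<^sub>C star a) \<le> norm a + norm a"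
    by (rule order_trans[OF norm_triangle_ineq]) (simp add: norm_scaleC norm_power)
  then have "norm ((1 / (8 * S)) *\<^sub>R (cnj (\<i> ^ l) *\<^sub>C a + \<i> ^ l *\<^sub>C star a)) \<le> 1/4"
    unfolding norm_scaleR using assms by (simp add: divide_le_eq)
  moreover have "norm ((1/4) *\<^sub>R (1::'a)) \<le> 1/4" using norm_one_le[where 'a='a] by simp
  ultimately have "norm (weight S a l) \<le> 1/4 + 1/4"
    unfolding weight_def by (intro norm_triangle_mono)
  then show ?thesis by simp
qed

lemma norm_bern_le:
  assumes "norm (a::'a::unital_cstar_algebra) \<le> S" "0 < S"
  shows "norm (bern S a s) \<le> 1"
proof (induction s)
  case (Cons l s)
  have "norm (bern S a (l # s)) \<le> norm (weight S a l) * norm (bern S a s)"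
    using norm_mult_ineq by simp
  also have "\<dots> \<le> 1 * 1" by (intro mult_mono Cons norm_weight_le assms) auto
  finally show ?case by simp
qed (simp add: norm_one_le)

text \<open>One more factor at most doubles the error and adds \<open>e\<close>, because the exact weights have norm at
  most \<open>1\<close> and the approximate ones at most \<open>2\<close>.\<close>

lemma norm_bern_poly_diff_le:
  assumes "norm (a::'a::unital_cstar_algebra) \<le> S" "0 < S" "set s \<subseteq> {..<4}"
    and G: "\<And>l. l < 4 \<Longrightarrow> norm (weight S a l - value_of A (G k l)) \<le> e"
    and U: "norm (1 - value_of A (U k)) \<le> e" and "e \<le> 1"
  shows "norm (bern S a s - value_of A (bern_poly G U k s)) \<le> (2 ^ Suc (length s) - 1) * e"
  using assms(3)
proof (induction s)
  case (Cons l s)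
  have e: "0 \<le> e" using order_trans[OF norm_ge_zero U] .
  let ?w = "weight S a l" and ?v = "value_of A (G k l)" and ?q = "value_of A (bern_poly G U k s)"
  have l: "norm (?w - ?v) \<le> e" using G Cons.prems by auto
  have v: "norm ?v \<le> 2"
    using l norm_triangle_ineq3[of ?v ?w] norm_weight_le[OF assms(1,2), of l] \<open>e \<le> 1\<close>
    by (simp add: norm_minus_commute)
  have "bern S a (l # s) - value_of A (bern_poly G U k (l # s)) = (?w - ?v) * bern S a s + ?v * (bern S a s - ?q)"
    by (simp add: algebra_simps)
  also have "norm \<dots> \<le> norm (?w - ?v) * norm (bern S a s) + norm ?v * norm (bern S a s - ?q)"
    by (intro norm_triangle_mono norm_mult_ineq)
  also have "\<dots> \<le> e * 1 + 2 * ((2 ^ Suc (length s) - 1) * e)"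
  proof (intro add_mono mult_mono)
    show "norm (bern S a s - ?q) \<le> (2 ^ Suc (length s) - 1) * e"
      using Cons by simp
  qed (use l v e norm_bern_le[OF assms(1,2)] in simp_all)
  also have "\<dots> = (2 ^ Suc (length (l # s)) - 1) * e" by (simp add: algebra_simps)
  finally show ?case .
qed (use U in simp)

section \<open>Finite information about a computable function\<close>

definition computes_on :: "algorithm \<Rightarrow> complex set \<Rightarrow> (complex \<Rightarrow> complex) \<Rightarrow> bool" where
  "computes_on P K f \<longleftrightarrow> (\<forall>z\<in>K. \<forall>q. (\<forall>k. cmod (z - decode_gaussian (q k)) < (1/2) ^ k) \<longrightarrow>
     (\<forall>k. \<exists>r. run P q [k] = Some r \<and> cmod (f z - decode_gaussian r) < (1/2) ^ k))"

text \<open>A name that converges twice as fast as required in the stronger norm \<open>\<bar>Re\<bar> + \<bar>Im\<bar>\<close>, so that each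
  initial part of it is also part of a name of every nearby point.\<close>

lemma ex_gaussian_name:
  "\<exists>q. \<forall>k::nat. \<bar>Re (z - decode_gaussian (q k))\<bar> + \<bar>Im (z - decode_gaussian (q k))\<bar> < (1/2) ^ Suc k"
proof -
  have "\<exists>n. \<bar>Re (z - decode_gaussian n)\<bar> + \<bar>Im (z - decode_gaussian n)\<bar> < (1/2) ^ Suc k" for k :: nat
  proof -
    have near: "\<exists>r::rat. \<bar>x - of_rat r\<bar> < (1/2) ^ Suc (Suc k)" for x :: real
    proof -
      obtain r :: rat where "x - (1/2) ^ Suc (Suc k) < of_rat r" "of_rat r < x + (1/2) ^ Suc (Suc k)"
        using of_rat_dense[of "x - (1/2) ^ Suc (Suc k)" "x + (1/2) ^ Suc (Suc k)"] by auto
      then show ?thesis by (intro exI[of _ r]) linarith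
    qed
    obtain r s where "\<bar>Re z - of_rat r\<bar> < (1/2) ^ Suc (Suc k)" "\<bar>Im z - of_rat s\<bar> < (1/2) ^ Suc (Suc k)"
      using near by metis
    then show ?thesis
      by (intro exI[of _ "enc (r, s)"]) (simp add: decode_gaussian_eq_gval gval_def)
  qed
  then show ?thesis by metis
qed

text \<open>The list \<open>\<sigma>\<close> extends to a name of every point that it approximates, and the unbounded run on that
  name has the same result.\<close>

lemma brun_sound:
  assumes P: "computes_on P K f"
    and z: "z \<in> K" "\<And>j. j < length \<sigma> \<Longrightarrow> cmod (z - decode_gaussian (\<sigma> ! j)) < (1/2) ^ j"
    and r: "brun P \<sigma> [k] = Some r"
  shows "cmod (f z - decode_gaussian r) < (1/2) ^ k"
proof -
  obtain q0 where q0: "\<And>j::nat. \<bar>Re (z - decode_gaussian (q0 j))\<bar> + \<bar>Im (z - decode_gaussian (q0 j))\<bar> < (1/2) ^ Suc j"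
    using ex_gaussian_name[of z] by blast
  define q where "q j = (if j < length \<sigma> then \<sigma> ! j else q0 j)" for j
  have "cmod (z - decode_gaussian (q j)) < (1/2) ^ j" for j
  proof (cases "j < length \<sigma>")
    case False
    have "cmod (z - decode_gaussian (q0 j)) < (1/2) ^ Suc j"
      using q0[of j] cmod_le by (rule le_less_trans[rotated])
    also have "\<dots> \<le> (1/2) ^ j" by simp
    finally show ?thesis using False by (simp add: q_def)
  qed (use z in \<open>simp add: q_def\<close>)
  then obtain r' where "run P q [k] = Some r'" "cmod (f z - decode_gaussian r') < (1/2) ^ k"
    using P z(1) unfolding computes_on_def by blast
  moreover have "run P q [k] = Some r"
    by (rule brun_imp_run[OF _ r]) (simp add: q_def)
  ultimately show ?thesis by simp
qed

lemma brun_complete: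
  assumes P: "computes_on P K f"
    and z: "z \<in> K"
  obtains \<sigma> r where "brun P \<sigma> [k] = Some r"
    "\<And>j. j < length \<sigma> \<Longrightarrow> \<bar>Re (z - decode_gaussian (\<sigma> ! j))\<bar> + \<bar>Im (z - decode_gaussian (\<sigma> ! j))\<bar> < (1/2) ^ Suc j"
proof -
  obtain q where q: "\<And>j::nat. \<bar>Re (z - decode_gaussian (q j))\<bar> + \<bar>Im (z - decode_gaussian (q j))\<bar> < (1/2) ^ Suc j"
    using ex_gaussian_name[of z] by blast
  have "cmod (z - decode_gaussian (q j)) < (1/2) ^ j" for j
  proof -
    have "cmod (z - decode_gaussian (q j)) < (1/2) ^ Suc j"
      using q[of j] cmod_le by (rule le_less_trans[rotated])
    also have "\<dots> \<le> (1/2) ^ j" by simp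
    finally show ?thesis .
  qed
  then obtain r where "run P q [k] = Some r" using P z unfolding computes_on_def by blast
  from run_imp_eventually_brun[OF this] obtain n where "brun P (map q [0..<n]) [k] = Some r"
    unfolding eventually_sequentially by blast
  then show thesis by (rule that) (use q in simp)
qed

text \<open>A finite part of a name of \<open>z\<close> is also part of a name of every nearby \<open>w\<close>, so that one result
  approximates both \<open>f z\<close> and \<open>f w\<close>.\<close>

lemma computable_function_on_imp_continuous_on:
  assumes "computable_function_on K f"
  shows "continuous_on K f"
proof -
  obtain P where P: "computes_on P K f"
    using assms unfolding computable_function_on_def computes_on_def by blast
  show ?thesis unfolding continuous_on_iff
  proof (intro ballI allI impI)
    fix z and e :: real assume z: "z \<in> K" and e: "0 < e"
    obtain k where k: "(1/2) ^ k < e / 2" using real_arch_pow_inv[of "e/2" "1/2"] e by auto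
    obtain \<sigma> r where \<sigma>: "brun P \<sigma> [k] = Some r"
      "\<And>j. j < length \<sigma> \<Longrightarrow> \<bar>Re (z - decode_gaussian (\<sigma> ! j))\<bar> + \<bar>Im (z - decode_gaussian (\<sigma> ! j))\<bar> < (1/2) ^ Suc j"
      using brun_complete[OF P z] by blast
    have near: "cmod (f w - decode_gaussian r) < (1/2) ^ k" if w: "w \<in> K" "dist w z < (1/2) ^ Suc (length \<sigma>)" for w
    proof (rule brun_sound[OF P w(1) _ \<sigma>(1)])
      fix j assume j: "j < length \<sigma>"
      have "(1/2::real) ^ Suc (length \<sigma>) \<le> (1/2) ^ Suc j" using j by (intro power_decreasing) auto
      moreover have "cmod (z - decode_gaussian (\<sigma> ! j)) < (1/2) ^ Suc j"
        using \<sigma>(2)[OF j] cmod_le by (rule le_less_trans[rotated])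
      moreover have "cmod (w - decode_gaussian (\<sigma> ! j)) \<le> cmod (w - z) + cmod (z - decode_gaussian (\<sigma> ! j))"
        using norm_triangle_ineq[of "w - z" "z - decode_gaussian (\<sigma> ! j)"] by simp
      ultimately have "cmod (w - decode_gaussian (\<sigma> ! j)) < (1/2) ^ Suc j + (1/2) ^ Suc j"
        using w(2) unfolding dist_norm by linarith
      then show "cmod (w - decode_gaussian (\<sigma> ! j)) < (1/2) ^ j" by simp
    qed
    have "dist (f w) (f z) < e" if w: "w \<in> K" "dist w z < (1/2) ^ Suc (length \<sigma>)" for w
      using near[OF w] near[OF z] k
        norm_triangle_ineq4[of "f w - decode_gaussian r" "f z - decode_gaussian r"]
      by (simp add: dist_norm)
    then show "\<exists>d>0. \<forall>w\<in>K. dist w z < d \<longrightarrow> dist (f w) (f z) < e"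
      by (intro exI[of _ "(1/2) ^ Suc (length \<sigma>)"]) auto
  qed
qed

section \<open>The algorithm\<close>

text \<open>Computability of a point is a nonuniform notion, so fixed data may be built into the algorithm:
  the bounds \<open>S\<close> of the element and \<open>F\<close> of the function, the algorithms \<open>P\<close> for \<open>f\<close> and \<open>N\<close> for norms,
  and approximations \<open>G\<close> of the four weights of \<open>a\<close> and \<open>U\<close> of the unit. In the definitions below,
  \<open>k\<close> is the output precision and \<open>m\<close> the stage of the search.\<close>

locale calculus_algorithm = functional_calculus a \<Phi>
  for a :: "'a::unital_cstar_algebra" and \<Phi> :: "(complex \<Rightarrow> complex) \<Rightarrow> 'a" +
  fixes A :: "'a presentation" and f :: "complex \<Rightarrow> complex" and S F :: nat and P N :: algorithm
    and G :: "nat \<Rightarrow> nat \<Rightarrow> star_term list" and U :: "nat \<Rightarrow> star_term list"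
  assumes norm_a: "norm a \<le> real S" and S_pos: "0 < S"
    and cont_f: "continuous_on (spectrum a) f"
    and f_le: "\<And>z. z \<in> spectrum a \<Longrightarrow> cmod (f z) \<le> real F"
    and P: "computes_on P (spectrum a) f"
    and N: "\<And>e \<rho> k. is_code_of A e \<rho> \<Longrightarrow> \<exists>q. run_plain N [e, k] = Some q \<and>
      \<bar>norm \<rho> - of_rat (nat_to_rat_surj q)\<bar> < (1/2) ^ k"
    and G: "computable (\<lambda>z. G (fst z) (snd z))" "\<And>k l. valid A (G k l)"
      "\<And>k l. l < 4 \<Longrightarrow> norm (weight (real S) a l - value_of A (G k l)) \<le> (1/2) ^ k"
    and U: "computable U" "\<And>k. valid A (U k)" "\<And>k. norm (1 - value_of A (U k)) \<le> (1/2) ^ k"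
begin

text \<open>At stage \<open>m\<close>, points at distance less than \<open>2\<^sup>-\<^sup>m\<close> count as near. By Chebyshev's inequality, the far
  words then have total probability at most \<open>4 S\<^sup>2 4\<^sup>m / n\<close>, which for this length \<open>n\<close> is
  \<open>2\<^sup>-\<^sup>m / (4 F + 4)\<close>.\<close>

definition word_length :: "nat \<Rightarrow> nat" where
  "word_length m = 4 * S * S * (4 * F + 4) * 8 ^ m"

definition vertex_gauss :: "nat \<Rightarrow> gauss" where
  "vertex_gauss l = (let s = 2 * of_nat S in
     if l = 0 then (s, 0) else if l = 1 then (0, s) else if l = 2 then (- s, 0) else (0, - s))"

definition displacement_gauss :: "nat list \<Rightarrow> gauss" where
  "displacement_gauss s = fold (\<lambda>l c. (fst c + fst (vertex_gauss l), snd c + snd (vertex_gauss l))) s (0, 0)"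

definition position_gauss :: "nat list \<Rightarrow> gauss" where
  "position_gauss s = (fst (displacement_gauss s) / of_nat (length s), snd (displacement_gauss s) / of_nat (length s))"

definition dist1 :: "gauss \<Rightarrow> gauss \<Rightarrow> rat" where
  "dist1 c d = \<bar>fst c - fst d\<bar> + \<bar>snd c - snd d\<bar>"

text \<open>The margin \<open>2\<^sup>-\<^sup>m\<close> makes \<open>\<sigma>\<close> the beginning of a name not only of \<open>w\<close> but of every point near
  \<open>w\<close>. All cases in the list are of the form \<open>x # _\<close>, since \<open>j < length \<sigma>\<close>.\<close>

definition compatible :: "nat \<Rightarrow> gauss \<Rightarrow> nat list \<Rightarrow> bool" where
  "compatible m w \<sigma> \<longleftrightarrow> list_all (\<lambda>j. case drop j \<sigma> of [] \<Rightarrow> True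
     | x # _ \<Rightarrow> dist1 w (dec_gauss x) + (1/2) ^ m \<le> (1/2) ^ j) [0..<length \<sigma>]"

text \<open>The bound on the result is needed for words far from the spectrum, at which the result is
  unrelated to \<open>f\<close>.\<close>

definition certifies :: "nat \<Rightarrow> nat \<Rightarrow> gauss \<Rightarrow> nat \<Rightarrow> bool" where
  "certifies k m w c \<longleftrightarrow> compatible m w (list_decode c) \<and>
     (case brun P (list_decode c) [k + 3] of None \<Rightarrow> False
      | Some r \<Rightarrow> \<bar>fst (dec_gauss r)\<bar> \<le> of_nat (F + 1) \<and> \<bar>snd (dec_gauss r)\<bar> \<le> of_nat (F + 1))"

definition piece :: "nat \<Rightarrow> nat \<Rightarrow> gauss \<Rightarrow> nat option" where
  "piece k m w = (case List.find (certifies k m w) [0..<m] of None \<Rightarrow> None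
     | Some c \<Rightarrow> brun P (list_decode c) [k + 3])"

text \<open>The uncovered words may have total weight \<open>5 * 2\<^sup>-\<^sup>a\<close> where \<open>a\<close> is the accuracy; as the values of
  \<open>f\<close> on them are lost, this must be at most \<open>2\<^sup>-\<^sup>(\<^sup>k\<^sup>+\<^sup>3\<^sup>)\<close> after multiplication by \<open>F\<close>. The exponent
  \<open>5 F\<close> suffices because \<open>5 F \<le> 2\<^sup>5\<^sup>F\<close>.\<close>

definition accuracy :: "nat \<Rightarrow> nat" where
  "accuracy k = k + 3 + 5 * F"

text \<open>Precision of the approximate weights. With words of length \<open>n\<close>, a product of approximate weights
  multiplies the error by at most \<open>2\<^sup>n\<^sup>+\<^sup>1\<close>, a coefficient by at most \<open>2 F + 2 \<le> 2\<^sup>2\<^sup>F\<^sup>+\<^sup>2\<close>, and there are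
  \<open>4\<^sup>n\<close> words.\<close>

definition precision :: "nat \<Rightarrow> nat \<Rightarrow> nat" where
  "precision k m = 3 * word_length m + 1 + (2 * F + 2) + accuracy k"

definition output_poly :: "nat \<Rightarrow> nat \<Rightarrow> star_term list" where
  "output_poly k m = concat (map (\<lambda>s. case piece k m (position_gauss s) of None \<Rightarrow> []
     | Some r \<Rightarrow> pscale (dec_gauss r) (bern_poly G U (precision k m) s)) (List.n_lists (word_length m) [0, 1, 2, 3]))"

definition uncovered_poly :: "nat \<Rightarrow> nat \<Rightarrow> star_term list" where
  "uncovered_poly k m = concat (map (\<lambda>s. case piece k m (position_gauss s) of None \<Rightarrow>
     bern_poly G U (precision k m) s | Some r \<Rightarrow> []) (List.n_lists (word_length m) [0, 1, 2, 3]))"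

text \<open>The factor \<open>3\<close> allows for two errors \<open>2\<^sup>-\<^sup>a\<close>, of the approximate weights and of the computed norm:
  true norms up to \<open>2\<^sup>-\<^sup>a\<close> are always accepted, and accepted true norms are at most \<open>5 * 2\<^sup>-\<^sup>a\<close>.\<close>

definition accepted :: "nat \<Rightarrow> nat \<Rightarrow> bool" where
  "accepted k m \<longleftrightarrow> k + 3 \<le> m \<and>
     nat_to_rat_surj (the (run_plain N [enc (uncovered_poly k m), accuracy k])) < 3 * (1/2) ^ accuracy k"

subsection \<open>Computability of the ingredients\<close>

lemma computable_certifies [computable_intros]:
  assumes "computable k" "computable m" "computable w" "computable c"
  shows "computable (\<lambda>x. certifies (k x) (m x) (w x) (c x))"
proof -
  have "computable (\<lambda>z. certifies (fst z) (fst (snd z)) (fst (snd (snd z))) (snd (snd (snd z))))"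
    unfolding certifies_def compatible_def dist1_def by (intro computable_intros)
  from computable_comp[OF this computable_Pair[OF assms(1) computable_Pair[OF assms(2)
    computable_Pair[OF assms(3,4)]]]] show ?thesis by simp
qed

lemma computable_piece [computable_intros]:
  assumes "computable k" "computable m" "computable w"
  shows "computable (\<lambda>x. piece (k x) (m x) (w x))"
proof -
  have "computable (\<lambda>z. piece (fst z) (fst (snd z)) (snd (snd z)))"
    unfolding piece_def by (intro computable_intros)
  from computable_comp3[OF this assms] show ?thesis .
qed

lemma computable_position_gauss [computable_intros]:
  assumes "computable s" shows "computable (\<lambda>x. position_gauss (s x))"
proof -
  have "computable (\<lambda>s. position_gauss s)"
    unfolding position_gauss_def displacement_gauss_def vertex_gauss_def Let_def
    by (intro computable_intros)
  from computable_comp[OF this assms] show ?thesis .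
qed

lemma computable_output_poly: "computable (\<lambda>z. output_poly (fst z) (snd z))"
  and computable_uncovered_poly: "computable (\<lambda>z. uncovered_poly (fst z) (snd z))"
  unfolding output_poly_def uncovered_poly_def precision_def accuracy_def word_length_def
  by (intro computable_intros computable_bern_poly[OF G(1) U(1)])+

lemma valid_output_poly: "valid A (output_poly k m)"
  and valid_uncovered_poly: "valid A (uncovered_poly k m)"
  unfolding output_poly_def uncovered_poly_def
  by (rule valid_concat, use G(2) U(2) in \<open>auto simp: valid_bern_poly split: option.splits\<close>)+

lemma run_N:
  "\<exists>q. run_plain N [enc (uncovered_poly k m), j] = Some q \<and>
    \<bar>norm (value_of A (uncovered_poly k m)) - of_rat (nat_to_rat_surj q)\<bar> < (1/2) ^ j"
  by (rule N) (simp add: is_code_of_iff valid_uncovered_poly)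

lemma computable_accepted: "computable (\<lambda>z. accepted (fst z) (snd z))"
proof -
  have "computable (\<lambda>z. the (run_plain N [enc (uncovered_poly (fst z) (snd z)), accuracy (fst z)]))"
  proof (rule computable_run2)
    show "computable (\<lambda>z. enc (uncovered_poly (fst z) (snd z)))"
      by (intro computable_intros computable_uncovered_poly)
    show "computable (\<lambda>z. accuracy (fst z))"
      unfolding accuracy_def by (intro computable_intros)
    show "run_plain N [enc (uncovered_poly (fst z) (snd z)), accuracy (fst z)] \<noteq> None" for z
      using run_N[of "fst z" "snd z" "accuracy (fst z)"] by auto
  qed
  then show ?thesis
    unfolding accepted_def accuracy_def by (intro computable_intros)
qed

subsection \<open>Pieces\<close>

lemma gval_position_gauss:
  assumes "s \<in> words n"
  shows "gval (position_gauss s) = position (real S) s"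
proof -
  have v: "gval (vertex_gauss l) = vertex (real S) l" if l: "l < 4" for l
  proof -
    consider "l = 0" | "l = 1" | "l = 2" | "l = 3" using l by linarith
    then show ?thesis
      by cases (simp_all add: vertex_gauss_def vertex_def gval_def complex_eq_iff of_rat_mult of_rat_minus
          i_cubed Let_def)
  qed
  have "gval (fold (\<lambda>l c. (fst c + fst (vertex_gauss l), snd c + snd (vertex_gauss l))) s c) =
      gval c + displacement (real S) s" for c
    using assms unfolding words_def
  proof (induction s arbitrary: c n)
    case (Cons l s)
    have "gval (fst c + fst (vertex_gauss l), snd c + snd (vertex_gauss l)) = gval c + gval (vertex_gauss l)"
      by (simp add: gval_def complex_eq_iff of_rat_add)
    then show ?case using Cons v[of l] by (simp add: displacement_def)
  qed (simp add: displacement_def)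
  moreover have "gval (0, 0) = 0" by (simp add: gval_def complex_eq_iff)
  ultimately have t: "gval (displacement_gauss s) = displacement (real S) s"
    unfolding displacement_gauss_def by simp
  have "gval (position_gauss s) = gval (displacement_gauss s) / of_nat (length s)"
    by (simp add: position_gauss_def gval_def complex_eq_iff of_rat_divide Re_divide_of_nat Im_divide_of_nat)
  then show ?thesis by (simp add: t position_def)
qed

lemma of_rat_dist1: "of_rat (dist1 c d) = \<bar>Re (gval c - gval d)\<bar> + \<bar>Im (gval c - gval d)\<bar>"
  by (simp add: dist1_def gval_def of_rat_add flip: of_rat_diff)

lemma abs_of_rat_le_iff: "\<bar>of_rat x :: real\<bar> \<le> real n \<longleftrightarrow> \<bar>x\<bar> \<le> of_nat n"
proof -
  have "\<bar>of_rat x :: real\<bar> \<le> real n \<longleftrightarrow> of_rat \<bar>x\<bar> \<le> (of_rat (of_nat n) :: real)" by simp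
  then show ?thesis unfolding of_rat_less_eq .
qed

lemma of_rat_half_power: "(of_rat ((1/2) ^ m) :: real) = (1/2) ^ m"
  by (simp add: of_rat_power of_rat_divide)

lemma compatible_iff:
  "compatible m w \<sigma> \<longleftrightarrow> (\<forall>j<length \<sigma>. \<bar>Re (gval w - decode_gaussian (\<sigma> ! j))\<bar> +
     \<bar>Im (gval w - decode_gaussian (\<sigma> ! j))\<bar> + (1/2) ^ m \<le> (1/2) ^ j)"
proof -
  have "(case drop j \<sigma> of [] \<Rightarrow> True | x # _ \<Rightarrow> dist1 w (dec_gauss x) + (1/2) ^ m \<le> (1/2) ^ j) \<longleftrightarrow>
     \<bar>Re (gval w - decode_gaussian (\<sigma> ! j))\<bar> + \<bar>Im (gval w - decode_gaussian (\<sigma> ! j))\<bar> + (1/2) ^ m \<le> (1/2) ^ j"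
    if "j < length \<sigma>" for j
  proof -
    have "dist1 w (dec_gauss (\<sigma> ! j)) + (1/2) ^ m \<le> (1/2) ^ j \<longleftrightarrow>
       of_rat (dist1 w (dec_gauss (\<sigma> ! j)) + (1/2) ^ m) \<le> (of_rat ((1/2) ^ j) :: real)"
      by (simp only: of_rat_less_eq)
    then show ?thesis using that
      unfolding of_rat_add of_rat_half_power of_rat_dist1
      by (simp add: Cons_nth_drop_Suc[symmetric] decode_gaussian_eq_gval)
  qed
  then show ?thesis unfolding compatible_def list_all_iff by auto
qed

lemma piece_SomeD:
  assumes "piece k m w = Some r"
  obtains \<sigma> where "compatible m w \<sigma>" "brun P \<sigma> [k + 3] = Some r" "cmod (decode_gaussian r) \<le> 2 * F + 2"
proof -
  obtain c where c: "List.find (certifies k m w) [0..<m] = Some c" "brun P (list_decode c) [k + 3] = Some r"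
    using assms by (auto simp: piece_def split: option.splits)
  then have g: "certifies k m w c" using find_upt_Some by blast
  have "\<bar>fst (dec_gauss r)\<bar> \<le> of_nat (F + 1)" "\<bar>snd (dec_gauss r)\<bar> \<le> of_nat (F + 1)"
    using g c(2) unfolding certifies_def by auto
  from this[THEN abs_of_rat_le_iff[THEN iffD2]] have "cmod (decode_gaussian r) \<le> real (F + 1) + real (F + 1)"
    unfolding decode_gaussian_eq_gval gval_def
    by (intro order_trans[OF cmod_le] add_mono) (simp_all only: complex.sel)
  then show thesis using that[of "list_decode c"] g c(2) by (simp add: certifies_def)
qed

lemma piece_sound:
  assumes "piece k m w = Some r" "z \<in> spectrum a" "cmod (z - gval w) < (1/2) ^ m"
  shows "cmod (f z - decode_gaussian r) < (1/2) ^ (k + 3)"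
proof -
  obtain \<sigma> where \<sigma>: "compatible m w \<sigma>" "brun P \<sigma> [k + 3] = Some r" using piece_SomeD[OF assms(1)] .
  show ?thesis
  proof (rule brun_sound[OF P assms(2) _ \<sigma>(2)])
    fix j assume "j < length \<sigma>"
    then have "cmod (gval w - decode_gaussian (\<sigma> ! j)) + (1/2) ^ m \<le> (1/2) ^ j"
      using \<sigma>(1) cmod_le[of "gval w - decode_gaussian (\<sigma> ! j)"]
      unfolding compatible_iff by fastforce
    then show "cmod (z - decode_gaussian (\<sigma> ! j)) < (1/2) ^ j"
      using assms(3) norm_triangle_ineq[of "z - gval w" "gval w - decode_gaussian (\<sigma> ! j)"] by simp
  qed
qed

text \<open>A successful list for \<open>z\<close> also serves all \<open>w\<close> near \<open>z\<close>, as soon as \<open>m\<close> exceeds its code and the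
  margin \<open>2\<^sup>-\<^sup>m\<close> is small compared with the last tolerance.\<close>

lemma piece_complete:
  assumes z: "z \<in> spectrum a"
  obtains M d where "0 < d" "\<And>m w. M \<le> m \<Longrightarrow> cmod (z - gval w) < d \<Longrightarrow> piece k m w \<noteq> None"
proof -
  obtain \<sigma> r where \<sigma>: "brun P \<sigma> [k + 3] = Some r"
    "\<And>j. j < length \<sigma> \<Longrightarrow> \<bar>Re (z - decode_gaussian (\<sigma> ! j))\<bar> + \<bar>Im (z - decode_gaussian (\<sigma> ! j))\<bar> < (1/2) ^ Suc j"
    using brun_complete[OF P z] by blast
  let ?L = "length \<sigma>"
  have "cmod (f z - decode_gaussian r) < (1/2) ^ (k + 3)"
  proof (rule brun_sound[OF P z _ \<sigma>(1)])
    fix j assume "j < ?L"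
    have "cmod (z - decode_gaussian (\<sigma> ! j)) < (1/2) ^ Suc j"
      using \<sigma>(2)[OF \<open>j < ?L\<close>] cmod_le by (rule le_less_trans[rotated])
    also have "\<dots> \<le> (1/2) ^ j" by simp
    finally show "cmod (z - decode_gaussian (\<sigma> ! j)) < (1/2) ^ j" .
  qed
  also have "(1/2::real) ^ (k + 3) \<le> 1" by (rule power_le_one) auto
  finally have "cmod (decode_gaussian r) \<le> real F + 1"
    using f_le[OF z] norm_triangle_ineq3[of "decode_gaussian r" "f z"] by (simp add: norm_minus_commute)
  then have "cmod (decode_gaussian r) \<le> real (F + 1)" by simp
  then have "\<bar>of_rat (fst (dec_gauss r)) :: real\<bar> \<le> real (F + 1)" "\<bar>of_rat (snd (dec_gauss r)) :: real\<bar> \<le> real (F + 1)"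
    using abs_Re_le_cmod[of "decode_gaussian r"] abs_Im_le_cmod[of "decode_gaussian r"]
    unfolding decode_gaussian_eq_gval gval_def complex.sel by linarith+
  then have r: "\<bar>fst (dec_gauss r)\<bar> \<le> of_nat (F + 1)" "\<bar>snd (dec_gauss r)\<bar> \<le> of_nat (F + 1)"
    unfolding abs_of_rat_le_iff .
  show thesis
  proof (rule that[of "(1/2) ^ (?L + 2)" "max (Suc (list_encode \<sigma>)) (?L + 1)"])
    fix m w assume m: "max (Suc (list_encode \<sigma>)) (?L + 1) \<le> m" and w: "cmod (z - gval w) < (1/2) ^ (?L + 2)"
    have "compatible m w \<sigma>"
      unfolding compatible_iff
    proof (intro allI impI)
      fix j assume j: "j < ?L"
      let ?g = "decode_gaussian (\<sigma> ! j)"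
      have "\<bar>Re (gval w - ?g)\<bar> \<le> \<bar>Re (z - ?g)\<bar> + cmod (z - gval w)"
        "\<bar>Im (gval w - ?g)\<bar> \<le> \<bar>Im (z - ?g)\<bar> + cmod (z - gval w)"
        using abs_Re_le_cmod[of "z - gval w"] abs_Im_le_cmod[of "z - gval w"] by auto
      moreover have "(1/2::real) ^ m \<le> (1/2) ^ (?L + 1)" using m by (intro power_decreasing) auto
      moreover have "(1/2::real) ^ (?L + 1) \<le> (1/2) ^ (Suc j + 1)" using j by (intro power_decreasing) auto
      ultimately show "\<bar>Re (gval w - ?g)\<bar> + \<bar>Im (gval w - ?g)\<bar> + (1/2) ^ m \<le> (1/2) ^ j"
        using \<sigma>(2)[OF j] w by simp
    qed
    then have g: "certifies k m w (list_encode \<sigma>)" using \<sigma>(1) r by (simp add: certifies_def)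
    have "list_encode \<sigma> < m" using m by simp
    then have "List.find (certifies k m w) [0..<m] \<noteq> None"
      unfolding find_None_iff using g by auto
    then obtain c where c: "List.find (certifies k m w) [0..<m] = Some c" by blast
    then have "certifies k m w c" using find_upt_Some by blast
    then show "piece k m w \<noteq> None"
      unfolding piece_def c certifies_def by (auto split: option.splits)
  qed simp
qed

lemma piece_complete_uniform:
  obtains M d where "0 < d" "\<And>z m w. z \<in> spectrum a \<Longrightarrow> M \<le> m \<Longrightarrow> cmod (z - gval w) < d \<Longrightarrow> piece k m w \<noteq> None"
proof -
  have "\<exists>M d. 0 < d \<and> (\<forall>m w. M \<le> m \<longrightarrow> cmod (z - gval w) < d \<longrightarrow> piece k m w \<noteq> None)"
    if "z \<in> spectrum a" for z
    using piece_complete[OF that, of k] by metis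
  then obtain M d where Md: "\<And>z. z \<in> spectrum a \<Longrightarrow> 0 < d z"
    "\<And>z m w. z \<in> spectrum a \<Longrightarrow> M z \<le> m \<Longrightarrow> cmod (z - gval w) < d z \<Longrightarrow> piece k m w \<noteq> None" by metis
  obtain Z where Z: "Z \<subseteq> spectrum a" "finite Z" "spectrum a \<subseteq> (\<Union>z\<in>Z. ball z (d z / 2))"
  proof (rule compactE_image[OF compact_spectrum, of "spectrum a" "\<lambda>z. ball z (d z / 2)"])
    show "spectrum a \<subseteq> (\<Union>z\<in>spectrum a. ball z (d z / 2))" using Md(1) by force
  qed auto
  have fin: "finite (insert 1 ((\<lambda>z. d z / 2) ` Z))" using Z by simp
  show thesis
  proof (rule that[of "Min (insert 1 ((\<lambda>z. d z / 2) ` Z))" "Max (insert 0 (M ` Z))"])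
    show "0 < Min (insert 1 ((\<lambda>z. d z / 2) ` Z))" using Z Md(1) fin by (subst Min_gr_iff) auto
    fix z m w assume z: "z \<in> spectrum a" and m: "Max (insert 0 (M ` Z)) \<le> m"
      and w: "cmod (z - gval w) < Min (insert 1 ((\<lambda>z. d z / 2) ` Z))"
    obtain y where y: "y \<in> Z" "dist y z < d y / 2" using Z(3) z by fastforce
    have "M y \<le> m" using m Z(2) y(1) by (simp add: Max_le_iff)
    moreover have "cmod (z - gval w) < d y / 2" using w y(1) Z(2) by (simp add: Min_gr_iff)
    then have "cmod (y - gval w) < d y"
      using y(2) norm_triangle_ineq[of "y - z" "z - gval w"] by (simp add: dist_norm)
    ultimately show "piece k m w \<noteq> None" using Md(2) y(1) Z(1) by blast
  qed
qed

subsection \<open>Correctness\<close>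

definition covered_words :: "nat \<Rightarrow> nat \<Rightarrow> nat list set" where
  "covered_words k m = {s \<in> words (word_length m). piece k m (position_gauss s) \<noteq> None}"

definition coefficient :: "nat \<Rightarrow> nat \<Rightarrow> nat list \<Rightarrow> complex" where
  "coefficient k m s = decode_gaussian (the (piece k m (position_gauss s)))"

definition uncovered_words :: "nat \<Rightarrow> nat \<Rightarrow> nat list set" where
  "uncovered_words k m = words (word_length m) - covered_words k m"

lemma value_words:
  "value_of A (concat (map p (List.n_lists n [0, 1, 2, 3]))) = (\<Sum>s\<in>words n. value_of A (p s))"
proof -
  have "set (List.n_lists n [0, 1, 2, 3]) = words n"
  proof -
    have "{0, 1, 2, 3} = {..<4::nat}" by auto
    then show ?thesis by (auto simp: set_n_lists words_def)
  qed
  moreover have "distinct (List.n_lists n [0::nat, 1, 2, 3])" by (intro distinct_n_lists) simp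
  ultimately show ?thesis
    by (simp add: value_concat comp_def sum_list_distinct_conv_sum_set)
qed

lemma coefficient_le:
  assumes "s \<in> covered_words k m" shows "cmod (coefficient k m s) \<le> 2 * F + 2"
proof -
  obtain r where r: "piece k m (position_gauss s) = Some r" using assms by (auto simp: covered_words_def)
  then show ?thesis using piece_SomeD[OF r] by (metis coefficient_def option.sel)
qed

lemma card_words: "card (words n) = 4 ^ n"
  using card_lists_length_eq[of "{..<4::nat}" n] by (simp add: words_def)

lemma norm_sum_bern_poly_diff_le:
  assumes "I \<subseteq> words (word_length m)" "\<And>s. s \<in> I \<Longrightarrow> cmod (r s) \<le> 2 * F + 2"
  shows "norm ((\<Sum>s\<in>I. r s *\<^sub>C bern (real S) a s) -
    (\<Sum>s\<in>I. r s *\<^sub>C value_of A (bern_poly G U (precision k m) s))) \<le> (1/2) ^ accuracy k"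
proof -
  let ?n = "word_length m" and ?K = "precision k m"
  have one: "norm (r s *\<^sub>C (bern (real S) a s - value_of A (bern_poly G U ?K s))) \<le>
      2 ^ (2 * F + 2) * (2 ^ Suc ?n * (1/2) ^ ?K)" if s: "s \<in> I" for s
  proof -
    have "length s = ?n" "set s \<subseteq> {..<4}" using s assms(1) by (auto simp: words_def)
    then have "norm (bern (real S) a s - value_of A (bern_poly G U ?K s)) \<le> (2 ^ Suc ?n - 1) * (1/2) ^ ?K"
      using norm_bern_poly_diff_le[of a "real S" s A G ?K "(1/2) ^ ?K" U] norm_a S_pos G(3) U(3)
      by (simp add: power_le_one)
    also have "\<dots> \<le> 2 ^ Suc ?n * (1/2) ^ ?K" by (intro mult_right_mono) auto
    finally have b: "norm (bern (real S) a s - value_of A (bern_poly G U ?K s)) \<le> 2 ^ Suc ?n * (1/2) ^ ?K" .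
    have "real (2 * F + 2) \<le> real (2 ^ (2 * F + 2))" using less_exp[of "2 * F + 2"] by linarith
    then have "cmod (r s) \<le> 2 ^ (2 * F + 2)" using assms(2)[OF s] by simp
    then show ?thesis unfolding norm_scaleC using b by (intro mult_mono) auto
  qed
  have "(\<Sum>s\<in>I. r s *\<^sub>C bern (real S) a s) - (\<Sum>s\<in>I. r s *\<^sub>C value_of A (bern_poly G U ?K s))
      = (\<Sum>s\<in>I. r s *\<^sub>C (bern (real S) a s - value_of A (bern_poly G U ?K s)))"
    by (simp add: sum_subtractf scaleC_diff_right)
  also have "norm \<dots> \<le> of_nat (card I) * (2 ^ (2 * F + 2) * (2 ^ Suc ?n * (1/2) ^ ?K))"
    by (rule sum_norm_bound) (rule one)
  also have "\<dots> \<le> 4 ^ ?n * (2 ^ (2 * F + 2) * (2 ^ Suc ?n * (1/2) ^ ?K))"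
  proof (rule mult_right_mono)
    have "card I \<le> 4 ^ ?n" using card_mono[OF finite_words assms(1)] by (simp add: card_words)
    then show "real (card I) \<le> 4 ^ ?n" by (metis of_nat_le_iff of_nat_numeral of_nat_power)
  qed simp
  also have "\<dots> = (1/2) ^ accuracy k"
  proof -
    have "(4::real) ^ ?n = 2 ^ (2 * ?n)" by (simp add: power_mult)
    then have "4 ^ ?n * (2 ^ (2 * F + 2) * 2 ^ Suc ?n) = (2::real) ^ (2 * ?n + ((2 * F + 2) + Suc ?n))"
      by (simp only: power_add)
    also have "2 * ?n + ((2 * F + 2) + Suc ?n) = 3 * ?n + 1 + (2 * F + 2)" by simp
    finally have "4 ^ ?n * (2 ^ (2 * F + 2) * 2 ^ Suc ?n) = (2::real) ^ (3 * ?n + 1 + (2 * F + 2))" .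
    then have "4 ^ ?n * (2 ^ (2 * F + 2) * (2 ^ Suc ?n * (1/2) ^ ?K)) =
        (2::real) ^ (3 * ?n + 1 + (2 * F + 2)) * (1/2) ^ ?K" by (simp add: mult.assoc)
    also have "\<dots> = (2 * (1/2)) ^ (3 * ?n + 1 + (2 * F + 2)) * (1/2) ^ accuracy k"
      unfolding power_mult_distrib precision_def power_add[of "1/2" "3 * ?n + 1 + (2 * F + 2)"] by simp
    finally show ?thesis by simp
  qed
  finally show ?thesis .
qed

lemma output_poly_close:
  "norm ((\<Sum>s\<in>covered_words k m. coefficient k m s *\<^sub>C bern (real S) a s) - value_of A (output_poly k m)) \<le> (1/2) ^ accuracy k"
proof -
  have "value_of A (output_poly k m) =
      (\<Sum>s\<in>covered_words k m. coefficient k m s *\<^sub>C value_of A (bern_poly G U (precision k m) s))"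
    unfolding output_poly_def value_words
    by (rule sum.mono_neutral_cong_right)
      (auto simp: covered_words_def coefficient_def decode_gaussian_eq_gval split: option.splits)
  then show ?thesis
    using norm_sum_bern_poly_diff_le[of "covered_words k m" m "coefficient k m" k] coefficient_le
    by (simp add: covered_words_def)
qed

lemma uncovered_poly_close:
  "norm ((\<Sum>s\<in>uncovered_words k m. bern (real S) a s) - value_of A (uncovered_poly k m)) \<le> (1/2) ^ accuracy k"
proof -
  have "value_of A (uncovered_poly k m) =
      (\<Sum>s\<in>uncovered_words k m. value_of A (bern_poly G U (precision k m) s))"
    unfolding uncovered_poly_def value_words
    by (rule sum.mono_neutral_cong_right)
      (auto simp: uncovered_words_def covered_words_def split: option.splits)
  then show ?thesis
    using norm_sum_bern_poly_diff_le[of "uncovered_words k m" m "\<lambda>_. 1" k] by (simp add: uncovered_words_def)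
qed

lemma bern_real: "bern (real S) z s = complex_of_real (bern_num (real S) z s)"
  using S_pos by (simp add: bern_num_complex)

lemma \<Phi>_uncovered_words: "\<Phi> (\<lambda>z. complex_of_real (\<Sum>s\<in>uncovered_words k m. bern_num (real S) z s)) = (\<Sum>s\<in>uncovered_words k m. bern (real S) a s)"
  using \<Phi>_bern_sum[where I = "uncovered_words k m" and r = "\<lambda>_. 1" and S = "real S"] by (simp add: bern_real)

lemma continuous_uncovered_words: "continuous_on B (\<lambda>z. complex_of_real (\<Sum>s\<in>uncovered_words k m. bern_num (real S) z s))"
proof -
  have "(\<lambda>z. complex_of_real (\<Sum>s\<in>uncovered_words k m. bern_num (real S) z s)) = (\<lambda>z. \<Sum>s\<in>uncovered_words k m. bern (real S) z s)"
    by (simp add: bern_real)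
  then show ?thesis by (simp only:) (intro continuous_on_sum continuous_on_bern)
qed

lemma spectrum_cmod_le: "z \<in> spectrum a \<Longrightarrow> cmod z \<le> real S"
  using spectrum_subset_cball[of a] norm_a by auto

lemma word_length_pos: "0 < word_length m"
  using S_pos by (simp add: word_length_def)

lemma far_sum_le:
  assumes "z \<in> spectrum a" "0 < d" "I \<subseteq> words (word_length m)" "\<And>s. s \<in> I \<Longrightarrow> d \<le> cmod (z - position (real S) s)"
  shows "(\<Sum>s\<in>I. bern_num (real S) z s) \<le> 1 / ((4 * real F + 4) * 8 ^ m * d\<^sup>2)"
proof -
  have "(\<Sum>s\<in>I. bern_num (real S) z s) \<le> 4 * (real S)\<^sup>2 / (real (word_length m) * d\<^sup>2)"
    by (rule sum_far_bern_num) (use assms S_pos word_length_pos spectrum_cmod_le in auto)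
  also have "\<dots> = 1 / ((4 * real F + 4) * 8 ^ m * d\<^sup>2)"
  proof -
    have "real (word_length m) * d\<^sup>2 = (4 * (real S)\<^sup>2) * ((4 * real F + 4) * 8 ^ m * d\<^sup>2)"
      by (simp add: word_length_def power2_eq_square)
    then show ?thesis using S_pos by (simp only:) (rule nonzero_divide_mult_cancel_left, simp)
  qed
  finally show ?thesis .
qed

text \<open>For large \<open>m\<close> uncovered words keep a distance \<open>d\<close> from the whole spectrum, so their total weight on
  the spectrum, and with it the norm that is tested, becomes small.\<close>

lemma ex_accepted: "\<exists>m. accepted k m"
proof -
  obtain M d where Md: "0 < d"
    "\<And>z m w. z \<in> spectrum a \<Longrightarrow> M \<le> m \<Longrightarrow> cmod (z - gval w) < d \<Longrightarrow> piece k m w \<noteq> None"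
    using piece_complete_uniform[of k] by metis
  obtain j where j: "(1/8) ^ j < (1/2) ^ accuracy k * d\<^sup>2" using real_arch_pow_inv[of "(1/2) ^ accuracy k * d\<^sup>2" "1/8"] Md(1) by auto
  \<comment> \<open>Large enough for covering near the spectrum, for the Chebyshev bound and for acceptance.\<close>
  define m where "m = max (max M j) (k + 3)"
  have m: "M \<le> m" "k + 3 \<le> m" by (auto simp: m_def)
  have "(1/8::real) ^ m \<le> (1/8) ^ j" unfolding m_def by (intro power_decreasing) auto
  then have m8: "(1/8) ^ m < (1/2) ^ accuracy k * d\<^sup>2" using j by (rule le_less_trans)
  have "cmod (complex_of_real (\<Sum>s\<in>uncovered_words k m. bern_num (real S) z s)) \<le> (1/2) ^ accuracy k"
    if z: "z \<in> spectrum a" for z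
  proof -
    have "(\<Sum>s\<in>uncovered_words k m. bern_num (real S) z s) \<le> 1 / ((4 * real F + 4) * 8 ^ m * d\<^sup>2)"
    proof (rule far_sum_le[OF z Md(1)])
      fix s assume s: "s \<in> uncovered_words k m"
      then have "piece k m (position_gauss s) = None" "gval (position_gauss s) = position (real S) s"
        using gval_position_gauss[of s "word_length m"] by (simp_all add: uncovered_words_def covered_words_def)
      then show "d \<le> cmod (z - position (real S) s)"
        using Md(2)[OF z m(1), of "position_gauss s"] not_less by metis
    qed (auto simp: uncovered_words_def)
    also have "\<dots> = 1 / (4 * real F + 4) * ((1/8) ^ m / d\<^sup>2)"
      by (simp add: power_one_over)
    also have "\<dots> \<le> 1 * ((1/8) ^ m / d\<^sup>2)"
      by (intro mult_right_mono) (auto simp: divide_le_eq)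
    also have "\<dots> \<le> (1/2) ^ accuracy k" using m8 Md(1) by (simp add: divide_le_eq)
    finally show ?thesis
      using spectrum_cmod_le[OF z] by (simp add: sum_nonneg bern_num_nonneg del: of_real_sum)
  qed
  then have "norm (\<Sum>s\<in>uncovered_words k m. bern (real S) a s) \<le> (1/2) ^ accuracy k"
    unfolding \<Phi>_uncovered_words[symmetric] by (intro norm_\<Phi>_le continuous_uncovered_words) auto
  then have "norm (value_of A (uncovered_poly k m)) \<le> 2 * (1/2) ^ accuracy k"
    using uncovered_poly_close[of k m] norm_triangle_ineq3[of "value_of A (uncovered_poly k m)" "\<Sum>s\<in>uncovered_words k m. bern (real S) a s"]
    by (simp add: norm_minus_commute)
  moreover obtain q where q: "run_plain N [enc (uncovered_poly k m), accuracy k] = Some q"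
    "\<bar>norm (value_of A (uncovered_poly k m)) - of_rat (nat_to_rat_surj q)\<bar> < (1/2) ^ accuracy k"
    using run_N by blast
  ultimately have "(of_rat (nat_to_rat_surj q) :: real) < 3 * (1/2) ^ accuracy k" by linarith
  also have "3 * (1/2) ^ accuracy k = (of_rat (3 * (1/2) ^ accuracy k) :: real)"
    by (simp add: of_rat_mult of_rat_half_power)
  finally have "accepted k m" unfolding accepted_def of_rat_less using m(2) q(1) by simp
  then show ?thesis by blast
qed

text \<open>At a point of the spectrum, the error is split into near covered words, where the coefficient is
  close to \<open>f z\<close>, far covered words, which have little weight by Chebyshev's inequality, and uncovered
  words, whose weight is bounded by the tested norm. Each part is at most \<open>2\<^sup>-\<^sup>(\<^sup>k\<^sup>+\<^sup>3\<^sup>)\<close>.\<close>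

lemma accepted_close:
  assumes "accepted k m"
  shows "norm (\<Phi> f - value_of A (output_poly k m)) < (1/2) ^ k"
proof -
  let ?h = "(1/2::real) ^ (k + 3)"
  have m: "k + 3 \<le> m" using assms by (simp add: accepted_def)
  obtain q where q: "run_plain N [enc (uncovered_poly k m), accuracy k] = Some q"
    "\<bar>norm (value_of A (uncovered_poly k m)) - of_rat (nat_to_rat_surj q)\<bar> < (1/2) ^ accuracy k"
    using run_N by blast
  have "nat_to_rat_surj q < 3 * (1/2) ^ accuracy k" using assms q(1) by (simp add: accepted_def)
  then have "(of_rat (nat_to_rat_surj q) :: real) < of_rat (3 * (1/2) ^ accuracy k)"
    unfolding of_rat_less .
  then have "(of_rat (nat_to_rat_surj q) :: real) < 3 * (1/2) ^ accuracy k"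
    by (simp add: of_rat_mult of_rat_half_power)
  then have "norm (value_of A (uncovered_poly k m)) < 4 * (1/2) ^ accuracy k" using q(2) by linarith
  then have bad: "norm (\<Sum>s\<in>uncovered_words k m. bern (real S) a s) \<le> 5 * (1/2) ^ accuracy k"
    using uncovered_poly_close[of k m] norm_triangle_ineq2[of "\<Sum>s\<in>uncovered_words k m. bern (real S) a s" "value_of A (uncovered_poly k m)"]
    by simp
  have F5: "F * (5 * (1/2) ^ accuracy k) \<le> ?h"
  proof -
    have "real (5 * F) \<le> real (2 ^ (5 * F))" using less_exp[of "5 * F"] by linarith
    then have "real (5 * F) * (1/2) ^ (5 * F) \<le> 1" by (simp add: power_one_over divide_le_eq)
    then have "?h * (real (5 * F) * (1/2) ^ (5 * F)) \<le> ?h * 1" by (intro mult_left_mono) auto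
    then show ?thesis by (simp add: accuracy_def power_add algebra_simps)
  qed
  define B where "B z = (\<Sum>s\<in>covered_words k m. coefficient k m s * bern (real S) z s)" for z
  have cB: "continuous_on (spectrum a) B" unfolding B_def by (intro continuous_intros continuous_on_bern)
  have "cmod (f z - B z) \<le> 3 * ?h" if z: "z \<in> spectrum a" for z
  proof -
    let ?b = "bern_num (real S) z"
    have b: "0 \<le> ?b s" for s using spectrum_cmod_le[OF z] by (rule bern_num_nonneg)
    \<comment> \<open>The weights have sum \<open>1\<close>, so \<open>f z\<close> can be distributed over all words.\<close>
    define near where "near = {s \<in> covered_words k m. cmod (z - position (real S) s) < (1/2) ^ m}"
    define far where "far = covered_words k m - near"
    have fin: "finite near" "finite far" "finite (covered_words k m)" "finite (uncovered_words k m)"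
      by (auto simp: near_def far_def covered_words_def uncovered_words_def)
    have one: "(\<Sum>s\<in>covered_words k m. ?b s) + (\<Sum>s\<in>uncovered_words k m. ?b s) = 1"
      using sum.subset_diff[of "covered_words k m" "words (word_length m)" ?b] sum_bern_num[of "real S" z "word_length m"] S_pos
      by (simp add: uncovered_words_def covered_words_def)
    have "f z - B z = f z * complex_of_real ((\<Sum>s\<in>covered_words k m. ?b s) + (\<Sum>s\<in>uncovered_words k m. ?b s)) - B z"
      unfolding one by simp
    also have "\<dots> = (\<Sum>s\<in>covered_words k m. (f z - coefficient k m s) * ?b s) + f z * complex_of_real (\<Sum>s\<in>uncovered_words k m. ?b s)"
      unfolding B_def bern_real left_diff_distrib sum_subtractf
      by (simp add: sum_distrib_left distrib_left)
    also have "(\<Sum>s\<in>covered_words k m. (f z - coefficient k m s) * ?b s) =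
        (\<Sum>s\<in>near. (f z - coefficient k m s) * ?b s) + (\<Sum>s\<in>far. (f z - coefficient k m s) * ?b s)"
      unfolding far_def using sum.subset_diff[of near "covered_words k m"] fin by (simp add: near_def add.commute)
    finally have split: "f z - B z = (\<Sum>s\<in>near. (f z - coefficient k m s) * ?b s) +
        (\<Sum>s\<in>far. (f z - coefficient k m s) * ?b s) + f z * complex_of_real (\<Sum>s\<in>uncovered_words k m. ?b s)" .
    have "cmod (\<Sum>s\<in>near. (f z - coefficient k m s) * ?b s) \<le> (\<Sum>s\<in>near. ?h * ?b s)"
    proof (rule sum_norm_le)
      fix s assume s: "s \<in> near"
      then obtain r where r: "piece k m (position_gauss s) = Some r" by (auto simp: near_def covered_words_def)
      have "gval (position_gauss s) = position (real S) s"
        using s by (intro gval_position_gauss[of _ "word_length m"]) (auto simp: near_def covered_words_def)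
      then have "cmod (f z - coefficient k m s) \<le> ?h"
        using piece_sound[OF r z] s by (simp add: near_def coefficient_def r)
      then show "cmod ((f z - coefficient k m s) * ?b s) \<le> ?h * ?b s"
        using b by (simp add: norm_mult mult_right_mono)
    qed
    also have "\<dots> \<le> ?h * 1"
    proof -
      have "(\<Sum>s\<in>near. ?b s) \<le> (\<Sum>s\<in>covered_words k m. ?b s)"
        using fin b by (intro sum_mono2) (auto simp: near_def)
      also have "\<dots> \<le> 1" using one sum_nonneg[of "uncovered_words k m" ?b] b by simp
      finally show ?thesis unfolding sum_distrib_left[symmetric] by (intro mult_left_mono) auto
    qed
    finally have n: "cmod (\<Sum>s\<in>near. (f z - coefficient k m s) * ?b s) \<le> ?h" by simp
    have "cmod (\<Sum>s\<in>far. (f z - coefficient k m s) * ?b s) \<le> (\<Sum>s\<in>far. (4 * real F + 4) * ?b s)"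
    proof (rule sum_norm_le)
      fix s assume s: "s \<in> far"
      then have "cmod (f z - coefficient k m s) \<le> F + (2 * F + 2)"
        using f_le[OF z] coefficient_le[of s k m] norm_triangle_ineq4[of "f z" "coefficient k m s"]
        by (simp add: far_def)
      then have "cmod (f z - coefficient k m s) \<le> 4 * real F + 4" by simp
      then show "cmod ((f z - coefficient k m s) * ?b s) \<le> (4 * real F + 4) * ?b s"
        using b by (simp add: norm_mult mult_right_mono)
    qed
    also have "\<dots> = (4 * real F + 4) * (\<Sum>s\<in>far. ?b s)" by (simp add: sum_distrib_left)
    also have "\<dots> \<le> (4 * real F + 4) * (1 / ((4 * real F + 4) * 8 ^ m * ((1/2) ^ m)\<^sup>2))"
      by (intro mult_left_mono far_sum_le z) (auto simp: far_def near_def covered_words_def)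
    also have "\<dots> = (1/2) ^ m"
    proof -
      have "(8::real) ^ m * ((1/2) ^ m)\<^sup>2 * (1/2) ^ m = (8 * (1/2 * (1/2)) * (1/2)) ^ m"
        unfolding power2_eq_square power_mult_distrib[symmetric] ..
      then have X: "((8::real) ^ m * ((1/2) ^ m)\<^sup>2) * (1/2) ^ m = 1" by simp
      have inv: "1 / x = y" if "x * y = 1" for x y :: real
        using that by (cases "x = 0") (auto simp: field_simps)
      have "4 * real F + 4 \<noteq> 0" by (simp add: add_nonneg_eq_0_iff)
      then have "(4 * real F + 4) * (1 / ((4 * real F + 4) * 8 ^ m * ((1/2) ^ m)\<^sup>2)) = 1 / (8 ^ m * ((1/2) ^ m)\<^sup>2)"
        by (simp only: mult.assoc times_divide_eq_right mult_1_right)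
          (rule nonzero_divide_mult_cancel_left)
      then show ?thesis using inv[OF X] by (simp only:)
    qed
    also have "\<dots> \<le> ?h" using m by (intro power_decreasing) auto
    finally have fr: "cmod (\<Sum>s\<in>far. (f z - coefficient k m s) * ?b s) \<le> ?h" .
    have "cmod (f z * complex_of_real (\<Sum>s\<in>uncovered_words k m. ?b s)) \<le> F * (5 * (1/2) ^ accuracy k)"
    proof -
      have "cmod (complex_of_real (\<Sum>s\<in>uncovered_words k m. ?b s)) \<le> 5 * (1/2) ^ accuracy k"
        using norm_\<Phi>_ge[OF continuous_uncovered_words z, of k m] bad unfolding \<Phi>_uncovered_words by linarith
      then show ?thesis unfolding norm_mult using f_le[OF z] by (intro mult_mono) auto
    qed
    then have "cmod (f z * complex_of_real (\<Sum>s\<in>uncovered_words k m. ?b s)) \<le> ?h" using F5 by linarith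
    then have "cmod (f z - B z) \<le> ?h + ?h + ?h"
      unfolding split using n fr by (intro norm_triangle_mono)
    then show ?thesis by simp
  qed
  then have "norm (\<Phi> (\<lambda>z. f z - B z)) \<le> 3 * ?h"
    by (intro norm_\<Phi>_le continuous_intros cont_f cB) auto
  then have "norm (\<Phi> f - \<Phi> B) \<le> 3 * ?h" by (simp add: \<Phi>_diff cont_f cB)
  moreover have "norm (\<Phi> B - value_of A (output_poly k m)) \<le> ?h"
  proof -
    have "(1/2::real) ^ accuracy k \<le> ?h" unfolding accuracy_def by (intro power_decreasing) auto
    then show ?thesis using output_poly_close[of k m] unfolding B_def \<Phi>_bern_sum by linarith
  qed
  ultimately have "norm (\<Phi> f - value_of A (output_poly k m)) \<le> 4 * ?h"
    using norm_triangle_ineq[of "\<Phi> f - \<Phi> B" "\<Phi> B - value_of A (output_poly k m)"] by simp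
  also have "\<dots> < (1/2) ^ k" by (simp add: power_add power3_eq_cube)
  finally show ?thesis .
qed

lemma computable_point_\<Phi>: "computable_point A (\<Phi> f)"
proof (rule computable_pointI)
  have "computable (\<lambda>k. LEAST m. accepted k m)"
    by (rule computable_Least[OF computable_accepted ex_accepted])
  then show "computable (\<lambda>k. output_poly k (LEAST m. accepted k m))"
    using computable_comp[OF computable_output_poly computable_Pair[OF computable_id]] by fastforce
  show "valid A (output_poly k (LEAST m. accepted k m))" for k by (rule valid_output_poly)
  show "norm (\<Phi> f - value_of A (output_poly k (LEAST m. accepted k m))) < (1/2) ^ k" for k
    by (rule accepted_close, rule LeastI_ex[OF ex_accepted])
qed

end


theorem corollary3p7:
  fixes A :: "'a::unital_cstar_algebra presentation"
    and a :: 'a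
    and f :: "complex \<Rightarrow> complex"
  assumes "separable_space (euclidean :: 'a topology)"
    and "is_presentation A"
    and "computable_presentation A"
    and "computably_unital A"
    and "normal_element a"
    and "computable_point A a"
    and "computable_function_on (spectrum a) f"
  shows "computable_point A (cfc a f)"
proof -
  obtain \<Phi> where \<Phi>: "is_functional_calculus a \<Phi>"
    using functional_calculus_exists[OF assms(5)] by blast
  have f: "continuous_on (spectrum a) f"
    by (rule computable_function_on_imp_continuous_on[OF assms(7)])
  obtain c where c: "\<And>z. z \<in> spectrum a \<Longrightarrow> cmod (f z) \<le> c"
    using compact_imp_bounded[OF compact_continuous_image[OF f compact_spectrum]]
    unfolding bounded_iff by auto
  obtain F :: nat where F: "c \<le> real F" using real_arch_simple by blast
  obtain S :: nat where S: "norm a \<le> real S" "0 < S"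
  proof -
    obtain n :: nat where "norm a \<le> real n" using real_arch_simple by blast
    then show thesis using that[of "Suc n"] by simp
  qed
  obtain P where P: "computes_on P (spectrum a) f"
    using assms(7) unfolding computable_function_on_def computes_on_def by blast
  obtain N where N: "\<And>e \<rho> k. is_code_of A e \<rho> \<Longrightarrow> \<exists>q. run_plain N [e, k] = Some q \<and>
      \<bar>norm \<rho> - of_rat (nat_to_rat_surj q)\<bar> < (1/2) ^ k"
    using assms(3) unfolding computable_presentation_def by metis
  obtain U where U: "approximates A U 1"
    using computable_point_imp_approximates assms(4) unfolding computably_unital_def by blast
  obtain E where E: "approximates A E a"
    using computable_point_imp_approximates assms(6) by blast
  obtain G where G: "computable (\<lambda>z. G (fst z) (snd z))" "\<And>k l. valid A (G k l)"
    "\<And>k l. l < 4 \<Longrightarrow> norm (weight (real S) a l - value_of A (G k l)) \<le> (1/2) ^ k"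
    using ex_approximates_weights[OF U E, of S] by blast
  interpret calculus_algorithm a \<Phi> A f S F P N G U
  proof unfold_locales
    show "cmod (f z) \<le> real F" if "z \<in> spectrum a" for z using c[OF that] F by linarith
  qed (use \<Phi> S f P N G U in \<open>auto simp: approximates_def\<close>)
  show ?thesis using computable_point_\<Phi> cfc_eq[OF \<Phi> f] by simp
qed

end
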